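(* (Soundness.) Let $\vdash t : A$ be a closed, well-typed term of the guarded $\lambda$-calculus and suppose $t \twoheadrightarrow u$ (call-by-name reduction). Then $[\![t]\!] = [\![u]\!]$ as morphisms of the topos of trees.
   Context: The guarded $\lambda$-calculus ($\mathsf{g}\lambda$). Types: $A ::= \alpha \mid \mathbf{N} \mid \mathbf{1} \mid A\times A \mid \mathbf{0} \mid A+A \mid A\to A \mid \mu\alpha.A \mid \blacktriangleright A \mid \blacksquare A$. A judgement $\nabla\vdash A$ ($\nabla$ a finite set of type variables) is derived by: $\alpha\in\nabla$ gives $\nabla\vdash\alpha$; $\nabla\vdash\mathbf N,\mathbf 1,\mathbf 0$; $\times,+,\to$ are formed from well-formed components; $\nabla\vdash\mu\alpha.A$ if $\nabla,\alpha\vdash A$ and $\alpha$ is guarded in $A$ (every occurrence of $\alpha$ lies beneath an occurrence of $\blacktriangleright$); $\nabla\vdash\blacktriangleright A$ if $\nabla\vdash A$; $\nabla\vdash\blacksquare A$ if $\emptyset\vdash A$. Types are closed unless stated otherwise. A type is constant if every occurrence of $\blacktriangleright$ in it lies beneath an occurrence of $\blacksquare$. Terms: $t ::= x \mid \mathsf{zero} \mid \mathsf{succ}\,t \mid \langle\rangle \mid \langle t,t\rangle \mid \pi_1 t \mid \pi_2 t \mid \mathsf{abort}\,t \mid \mathsf{in}_1 t \mid \mathsf{in}_2 t \mid \mathsf{case}\,t\,\mathsf{of}\,x_1.t;x_2.t \mid \lambda x.t \mid t\,t \mid \mathsf{fold}\,t \mid \mathsf{unfold}\,t \mid \mathsf{next}\,t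 \mid \mathsf{prev}\,\sigma.t \mid t\circledast t \mid \mathsf{box}\,\sigma.t \mid \mathsf{unbox}\,t \mid \mathsf{box}^+\sigma.t$, where $\sigma=[x_1\leftarrow t_1,\dots,x_n\leftarrow t_n]$ is an explicit substitution binding $x_1,\dots,x_n$ in the body but not in the $t_k$; $\mathsf{prev}\,t$, $\mathsf{box}\,t$, $\mathsf{box}^+t$ denote the case $n=0$. Typing: the usual rules for variables, $\mathsf{zero}:\mathbf N$, $\mathsf{succ}$, $\langle\rangle:\mathbf 1$, pairs/projections, $\mathsf{abort}$ (from $\mathbf 0$ to any type), injections and case, abstraction and application; $\mathsf{fold}\,t:\mu\alpha.A$ if $t:A[\mu\alpha.A/\alpha]$ and $\mathsf{unfold}\,t:A[\mu\alpha.A/\alpha]$ if $t:\mu\alpha.A$; $\mathsf{next}\,t:\blacktriangleright A$ if $t:A$; $t_1\circledast t_2:\blacktriangleright B$ if $t_1:\blacktriangleright(A\to B)$, $t_2:\blacktriangleright A$; $\mathsf{unbox}\,t:A$ if $t:\blacksquare A$; and, when $A_1,\dots,A_n$ are constant and $\Gamma\vdash t_k:A_k$ for all $k$: $\Gamma\vdash\mathsf{prev}[\vec x\leftarrow\vec t].t:A$ if $x_1{:}A_1,\dots,x_n{:}A_n\vdash t:\blacktriangleright A$; $\Gamma\vdash\mathsf{box}[\vec x\leftarrow\vec t].t:\blacksquare A$ if $\vec x{:}\vec A\vdash t:A$; $\Gamma\vdash\mathsf{box}^+[\vec x\leftarrow\vec t].t:\blacksquare B_1+\blacksquare B_2$ if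 $\vec x{:}\vec A\vdash t:B_1+B_2$. Reduction rules on closed terms: $\pi_d\langle t_1,t_2\rangle\mapsto t_d$; $\mathsf{case}\,\mathsf{in}_d t\,\mathsf{of}\,x_1.t_1;x_2.t_2\mapsto t_d[t/x_d]$; $(\lambda x.t_1)t_2\mapsto t_1[t_2/x]$; $\mathsf{unfold}\,\mathsf{fold}\,t\mapsto t$; $\mathsf{prev}[\vec x\leftarrow\vec t].t\mapsto\mathsf{prev}(t[\vec t/\vec x])$ ($\vec x$ nonempty); $\mathsf{prev}\,\mathsf{next}\,t\mapsto t$; $\mathsf{next}\,t_1\circledast\mathsf{next}\,t_2\mapsto\mathsf{next}(t_1t_2)$; $\mathsf{unbox}(\mathsf{box}[\vec x\leftarrow\vec t].t)\mapsto t[\vec t/\vec x]$; $\mathsf{box}^+[\vec x\leftarrow\vec t].t\mapsto\mathsf{box}^+(t[\vec t/\vec x])$ ($\vec x$ nonempty); $\mathsf{box}^+(\mathsf{in}_d t)\mapsto\mathsf{in}_d(\mathsf{box}\,t)$. Values: $\mathsf{succ}^n\mathsf{zero}$, $\langle\rangle$, $\langle t,t'\rangle$, $\mathsf{in}_d t$, $\lambda x.t$, $\mathsf{fold}\,t$, $\mathsf{next}\,t$, $\mathsf{box}\,\sigma.t$. Evaluation contexts: $E::=\cdot\mid\mathsf{succ}\,E\mid\pi_1E\mid\pi_2E\mid\mathsf{case}\,E\,\mathsf{of}\,x_1.t_1;x_2.t_2\mid E\,t\mid\mathsf{unfold}\,E\mid\mathsf{prev}\,E\mid E\circledast t\mid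 v\circledast E\ (v\text{ a value})\mid\mathsf{unbox}\,E\mid\mathsf{box}^+E$. Call-by-name reduction: $E[t]\mapsto E[u]$ whenever $t\mapsto u$ is a reduction rule; $\twoheadrightarrow$ is its reflexive–transitive closure. The topos of trees $\mathcal S$: objects $X$ are families of sets $X_1,X_2,\dots$ with restriction maps $r^X_i:X_{i+1}\to X_i$; morphisms $f:X\to Y$ are families $f_i:X_i\to Y_i$ with $f_i\circ r^X_i=r^Y_i\circ f_{i+1}$. For $i\le j$, $\restriction_i:X_j\to X_i$ is the composite restriction. Products and coproducts are pointwise; $(Y^X)_i$ is the set of tuples $(f_1,\dots,f_i)$, $f_j:X_j\to Y_j$, commuting with restrictions, restricted by projection. $\Delta Z$ has all sets $Z$ and identity restrictions; an object is constant if all its restriction maps are bijections (an element of $X_i$ is then identified with its preimages at higher stages). $\blacksquare X=\Delta(\mathrm{Hom}_{\mathcal S}(1,X))$ with $\mathsf{unbox}:\blacksquare X\to X$, $\mathsf{unbox}_i(x)=x_i$. $(\blacktriangleright X)_1=\{*\}$, $(\blacktriangleright X)_{i+1}=X_i$ with inherited restrictions; $\mathsf{next}:X\to\blacktriangleright X$ has $\mathsf{next}_1$ the unique map and $\mathsf{next}_{i+1}=r^X_i$. Denotation of types: a type with $n$ free variables denotes a mixed-variance functor $(\mathcal S^{op}\times\mathcal S)^n\to\mathcal S$: variables project to their covariant argument; $[\![\mathbf N]\!]=\Delta\mathbb N$, $[\![\mathbf 1]\!]=\Delta\{*\}$, $[\![\mathbf 0]\!]=\Delta\emptyset$; $\times,+$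 pointwise, $\to$ by exponential; $\blacktriangleright,\blacksquare$ by composing with the functors above; $[\![\mu\alpha.A]\!](\vec W)$ is the unique-up-to-isomorphism $X$ with $[\![A]\!](\vec W,X,X)\cong X$. Denotation of terms: a context $x_1{:}A_1,\dots,x_n{:}A_n$ denotes $[\![A_1]\!]\times\dots\times[\![A_n]\!]$ and $\Gamma\vdash t:A$ denotes $[\![t]\!]:[\![\Gamma]\!]\to[\![A]\!]$: variables are projections; zero/succ as expected; products, sums and functions via the cartesian closed and coproduct structure ($[\![\lambda x.t]\!]_i(\gamma)_j(a)=[\![t]\!]_j(\restriction_j\gamma,a)$, $[\![t_1t_2]\!]_i(\gamma)=[\![t_1]\!]_i(\gamma)_i([\![t_2]\!]_i(\gamma))$); fold/unfold via the isomorphism $[\![\mu\alpha.A]\!]\cong[\![A[\mu\alpha.A/\alpha]]\!]$; next and unbox by composing with $\mathsf{next}$ and $\mathsf{unbox}$; $[\![t_1\circledast t_2]\!]_{i+1}(\gamma)=[\![t_1]\!]_{i+1}(\gamma)_i([\![t_2]\!]_{i+1}(\gamma))$ (stage 1 trivial); $[\![\mathsf{prev}[\vec x\leftarrow\vec t].t]\!]_i(\gamma)=[\![t]\!]_{i+1}([\![t_1]\!]_i(\gamma),\dots,[\![t_n]\!]_i(\gamma))$; $[\![\mathsf{box}[\vec x\leftarrow\vec t].t]\!]_i(\gamma)$ is the global element with $j$-th component $[\![t]\!]_j([\![t_1]\!]_i(\gamma),\dots)$; $[\![\mathsf{box}^+[\vec x\leftarrow\vec t].t]\!]_i(\gamma)=[a,d]$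 where $[\![t]\!]_j([\![t_1]\!]_i(\gamma),\dots)=[a_j,d]$ for all $j$ (same $d$) and $a$ is the global element with components $a_j$. *)

theory Defs
  imports "HOL-Library.FuncSet" "HOL-Library.Countable_Set"
begin

section \<open>Syntax\<close>

text \<open>
  Type and term variables are de Bruijn indices, so that syntax is identified up to
  renaming of bound variables.
\<close>

datatype ty =
    TVar nat
  | TNat
  | TUnit
  | TProd ty ty
  | TVoid
  | TSum ty ty
  | TFun ty ty
  | TMu ty
  | TLater ty
  | TBox ty

primrec tlift :: "nat \<Rightarrow> ty \<Rightarrow> ty" where
  "tlift k (TVar i) = TVar (if i < k then i else Suc i)"
| "tlift k TNat = TNat"
| "tlift k TUnit = TUnit"
| "tlift k (TProd A B) = TProd (tlift k A) (tlift k B)"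
| "tlift k TVoid = TVoid"
| "tlift k (TSum A B) = TSum (tlift k A) (tlift k B)"
| "tlift k (TFun A B) = TFun (tlift k A) (tlift k B)"
| "tlift k (TMu A) = TMu (tlift (Suc k) A)"
| "tlift k (TLater A) = TLater (tlift k A)"
| "tlift k (TBox A) = TBox (tlift k A)"

primrec tsubst :: "nat \<Rightarrow> ty \<Rightarrow> ty \<Rightarrow> ty" where
  "tsubst k C (TVar i) = (if i < k then TVar i else if i = k then C else TVar (i - 1))"
| "tsubst k C TNat = TNat"
| "tsubst k C TUnit = TUnit"
| "tsubst k C (TProd A B) = TProd (tsubst k C A) (tsubst k C B)"
| "tsubst k C TVoid = TVoid"
| "tsubst k C (TSum A B) = TSum (tsubst k C A) (tsubst k C B)"
| "tsubst k C (TFun A B) = TFun (tsubst k C A) (tsubst k C B)"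
| "tsubst k C (TMu A) = TMu (tsubst (Suc k) (tlift 0 C) A)"
| "tsubst k C (TLater A) = TLater (tsubst k C A)"
| "tsubst k C (TBox A) = TBox (tsubst k C A)"

abbreviation unfold_mu :: "ty \<Rightarrow> ty" where
  "unfold_mu A \<equiv> tsubst 0 (TMu A) A"

primrec guarded :: "nat \<Rightarrow> ty \<Rightarrow> bool" where
  "guarded k (TVar i) \<longleftrightarrow> i \<noteq> k"
| "guarded k TNat \<longleftrightarrow> True"
| "guarded k TUnit \<longleftrightarrow> True"
| "guarded k (TProd A B) \<longleftrightarrow> guarded k A \<and> guarded k B"
| "guarded k TVoid \<longleftrightarrow> True"
| "guarded k (TSum A B) \<longleftrightarrow> guarded k A \<and> guarded k B"
| "guarded k (TFun A B) \<longleftrightarrow> guarded k A \<and> guarded k B"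
| "guarded k (TMu A) \<longleftrightarrow> guarded (Suc k) A"
| "guarded k (TLater A) \<longleftrightarrow> True"
| "guarded k (TBox A) \<longleftrightarrow> guarded k A"

text \<open>\<open>wft n A\<close>: the type \<open>A\<close> is well-formed over the type variables \<open>0, \<dots>, n - 1\<close>.\<close>

inductive wft :: "nat \<Rightarrow> ty \<Rightarrow> bool" where
  "i < n \<Longrightarrow> wft n (TVar i)"
| "wft n TNat"
| "wft n TUnit"
| "wft n A \<Longrightarrow> wft n B \<Longrightarrow> wft n (TProd A B)"
| "wft n TVoid"
| "wft n A \<Longrightarrow> wft n B \<Longrightarrow> wft n (TSum A B)"
| "wft n A \<Longrightarrow> wft n B \<Longrightarrow> wft n (TFun A B)"
| "wft (Suc n) A \<Longrightarrow> guarded 0 A \<Longrightarrow> wft n (TMu A)"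
| "wft n A \<Longrightarrow> wft n (TLater A)"
| "wft 0 A \<Longrightarrow> wft n (TBox A)"

primrec const_ty :: "ty \<Rightarrow> bool" where
  "const_ty (TVar i) \<longleftrightarrow> True"
| "const_ty TNat \<longleftrightarrow> True"
| "const_ty TUnit \<longleftrightarrow> True"
| "const_ty (TProd A B) \<longleftrightarrow> const_ty A \<and> const_ty B"
| "const_ty TVoid \<longleftrightarrow> True"
| "const_ty (TSum A B) \<longleftrightarrow> const_ty A \<and> const_ty B"
| "const_ty (TFun A B) \<longleftrightarrow> const_ty A \<and> const_ty B"
| "const_ty (TMu A) \<longleftrightarrow> const_ty A"
| "const_ty (TLater A) \<longleftrightarrow> False"
| "const_ty (TBox A) \<longleftrightarrow> True"

text \<open>
  \<open>Case t s1 s2\<close> binds index \<open>0\<close> in \<open>s1\<close> and in \<open>s2\<close>.  In \<open>Prev ts t\<close>, \<open>Box ts t\<close> and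
  \<open>BoxPlus ts t\<close> the list \<open>ts = [t\<^sub>1, \<dots>, t\<^sub>n]\<close> is the explicit substitution: the indices
  \<open>0, \<dots>, n - 1\<close> are bound in \<open>t\<close> (index \<open>k\<close> standing for the variable that is assigned
  \<open>ts ! k\<close>), and nothing is bound in \<open>ts\<close>.
\<close>

datatype tm =
    Var nat
  | Zero
  | Succ tm
  | Unit
  | Pair tm tm
  | Fst tm
  | Snd tm
  | Abort tm
  | In1 tm
  | In2 tm
  | Case tm tm tm
  | Lam tm
  | App tm tm
  | Fold tm
  | Unfold tm
  | Next tm
  | Prev "tm list" tm
  | LApp tm tm  (infixl \<open>\<circledast>\<close> 70)
  | Box "tm list" tm
  | Unbox tm
  | BoxPlus "tm list" tm

definition upr :: "(nat \<Rightarrow> nat) \<Rightarrow> nat \<Rightarrow> nat" where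
  "upr \<rho> = case_nat 0 (\<lambda>i. Suc (\<rho> i))"

primrec rename :: "(nat \<Rightarrow> nat) \<Rightarrow> tm \<Rightarrow> tm" where
  "rename \<rho> (Var i) = Var (\<rho> i)"
| "rename \<rho> Zero = Zero"
| "rename \<rho> (Succ t) = Succ (rename \<rho> t)"
| "rename \<rho> Unit = Unit"
| "rename \<rho> (Pair s t) = Pair (rename \<rho> s) (rename \<rho> t)"
| "rename \<rho> (Fst t) = Fst (rename \<rho> t)"
| "rename \<rho> (Snd t) = Snd (rename \<rho> t)"
| "rename \<rho> (Abort t) = Abort (rename \<rho> t)"
| "rename \<rho> (In1 t) = In1 (rename \<rho> t)"
| "rename \<rho> (In2 t) = In2 (rename \<rho> t)"
| "rename \<rho> (Case t s1 s2) = Case (rename \<rho> t) (rename (upr \<rho>) s1) (rename (upr \<rho>) s2)"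
| "rename \<rho> (Lam t) = Lam (rename (upr \<rho>) t)"
| "rename \<rho> (App s t) = App (rename \<rho> s) (rename \<rho> t)"
| "rename \<rho> (Fold t) = Fold (rename \<rho> t)"
| "rename \<rho> (Unfold t) = Unfold (rename \<rho> t)"
| "rename \<rho> (Next t) = Next (rename \<rho> t)"
| "rename \<rho> (Prev ts t) = Prev (map (rename \<rho>) ts) (rename ((upr ^^ length ts) \<rho>) t)"
| "rename \<rho> (s \<circledast> t) = rename \<rho> s \<circledast> rename \<rho> t"
| "rename \<rho> (Box ts t) = Box (map (rename \<rho>) ts) (rename ((upr ^^ length ts) \<rho>) t)"
| "rename \<rho> (Unbox t) = Unbox (rename \<rho> t)"
| "rename \<rho> (BoxPlus ts t) = BoxPlus (map (rename \<rho>) ts) (rename ((upr ^^ length ts) \<rho>) t)"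

definition ups :: "(nat \<Rightarrow> tm) \<Rightarrow> nat \<Rightarrow> tm" where
  "ups \<theta> = case_nat (Var 0) (\<lambda>i. rename Suc (\<theta> i))"

primrec subst :: "(nat \<Rightarrow> tm) \<Rightarrow> tm \<Rightarrow> tm" where
  "subst \<theta> (Var i) = \<theta> i"
| "subst \<theta> Zero = Zero"
| "subst \<theta> (Succ t) = Succ (subst \<theta> t)"
| "subst \<theta> Unit = Unit"
| "subst \<theta> (Pair s t) = Pair (subst \<theta> s) (subst \<theta> t)"
| "subst \<theta> (Fst t) = Fst (subst \<theta> t)"
| "subst \<theta> (Snd t) = Snd (subst \<theta> t)"
| "subst \<theta> (Abort t) = Abort (subst \<theta> t)"
| "subst \<theta> (In1 t) = In1 (subst \<theta> t)"
| "subst \<theta> (In2 t) = In2 (subst \<theta> t)"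
| "subst \<theta> (Case t s1 s2) = Case (subst \<theta> t) (subst (ups \<theta>) s1) (subst (ups \<theta>) s2)"
| "subst \<theta> (Lam t) = Lam (subst (ups \<theta>) t)"
| "subst \<theta> (App s t) = App (subst \<theta> s) (subst \<theta> t)"
| "subst \<theta> (Fold t) = Fold (subst \<theta> t)"
| "subst \<theta> (Unfold t) = Unfold (subst \<theta> t)"
| "subst \<theta> (Next t) = Next (subst \<theta> t)"
| "subst \<theta> (Prev ts t) = Prev (map (subst \<theta>) ts) (subst ((ups ^^ length ts) \<theta>) t)"
| "subst \<theta> (s \<circledast> t) = subst \<theta> s \<circledast> subst \<theta> t"
| "subst \<theta> (Box ts t) = Box (map (subst \<theta>) ts) (subst ((ups ^^ length ts) \<theta>) t)"
| "subst \<theta> (Unbox t) = Unbox (subst \<theta> t)"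
| "subst \<theta> (BoxPlus ts t) = BoxPlus (map (subst \<theta>) ts) (subst ((ups ^^ length ts) \<theta>) t)"

text \<open>Simultaneous substitution of \<open>ts\<close> for the indices \<open>0, \<dots>, length ts - 1\<close>.\<close>

definition inst :: "tm \<Rightarrow> tm list \<Rightarrow> tm" where
  "inst t ts = subst (\<lambda>i. if i < length ts then ts ! i else Var (i - length ts)) t"


section \<open>Typing\<close>

text \<open>
  All types are closed and well-formed; \<open>wft 0\<close> is required wherever a rule introduces a type
  that does not already occur in a premise.
\<close>

inductive typing :: "ty list \<Rightarrow> tm \<Rightarrow> ty \<Rightarrow> bool"  (\<open>_ \<turnstile> _ \<^bold>: _\<close> [50, 50, 50] 50) where
  "k < length \<Gamma> \<Longrightarrow> wft 0 (\<Gamma> ! k) \<Longrightarrow> \<Gamma> \<turnstile> Var k \<^bold>: \<Gamma> ! k"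
| "\<Gamma> \<turnstile> Zero \<^bold>: TNat"
| "\<Gamma> \<turnstile> t \<^bold>: TNat \<Longrightarrow> \<Gamma> \<turnstile> Succ t \<^bold>: TNat"
| "\<Gamma> \<turnstile> Unit \<^bold>: TUnit"
| "\<Gamma> \<turnstile> s \<^bold>: A \<Longrightarrow> \<Gamma> \<turnstile> t \<^bold>: B \<Longrightarrow> \<Gamma> \<turnstile> Pair s t \<^bold>: TProd A B"
| "\<Gamma> \<turnstile> t \<^bold>: TProd A B \<Longrightarrow> \<Gamma> \<turnstile> Fst t \<^bold>: A"
| "\<Gamma> \<turnstile> t \<^bold>: TProd A B \<Longrightarrow> \<Gamma> \<turnstile> Snd t \<^bold>: B"
| "\<Gamma> \<turnstile> t \<^bold>: TVoid \<Longrightarrow> wft 0 A \<Longrightarrow> \<Gamma> \<turnstile> Abort t \<^bold>: A"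
| "\<Gamma> \<turnstile> t \<^bold>: A \<Longrightarrow> wft 0 B \<Longrightarrow> \<Gamma> \<turnstile> In1 t \<^bold>: TSum A B"
| "\<Gamma> \<turnstile> t \<^bold>: B \<Longrightarrow> wft 0 A \<Longrightarrow> \<Gamma> \<turnstile> In2 t \<^bold>: TSum A B"
| "\<Gamma> \<turnstile> t \<^bold>: TSum A B \<Longrightarrow> A # \<Gamma> \<turnstile> s1 \<^bold>: C \<Longrightarrow> B # \<Gamma> \<turnstile> s2 \<^bold>: C \<Longrightarrow> \<Gamma> \<turnstile> Case t s1 s2 \<^bold>: C"
| "A # \<Gamma> \<turnstile> t \<^bold>: B \<Longrightarrow> wft 0 A \<Longrightarrow> \<Gamma> \<turnstile> Lam t \<^bold>: TFun A B"
| "\<Gamma> \<turnstile> s \<^bold>: TFun A B \<Longrightarrow> \<Gamma> \<turnstile> t \<^bold>: A \<Longrightarrow> \<Gamma> \<turnstile> App s t \<^bold>: B"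
| "\<Gamma> \<turnstile> t \<^bold>: unfold_mu A \<Longrightarrow> wft 0 (TMu A) \<Longrightarrow> \<Gamma> \<turnstile> Fold t \<^bold>: TMu A"
| "\<Gamma> \<turnstile> t \<^bold>: TMu A \<Longrightarrow> \<Gamma> \<turnstile> Unfold t \<^bold>: unfold_mu A"
| "\<Gamma> \<turnstile> t \<^bold>: A \<Longrightarrow> \<Gamma> \<turnstile> Next t \<^bold>: TLater A"
| "length As = length ts \<Longrightarrow> \<forall>k<length ts. const_ty (As ! k) \<Longrightarrow>
   \<forall>k<length ts. \<Gamma> \<turnstile> ts ! k \<^bold>: As ! k \<Longrightarrow> As \<turnstile> t \<^bold>: TLater A \<Longrightarrow> \<Gamma> \<turnstile> Prev ts t \<^bold>: A"
| "\<Gamma> \<turnstile> s \<^bold>: TLater (TFun A B) \<Longrightarrow> \<Gamma> \<turnstile> t \<^bold>: TLater A \<Longrightarrow> \<Gamma> \<turnstile> s \<circledast> t \<^bold>: TLater B"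
| "length As = length ts \<Longrightarrow> \<forall>k<length ts. const_ty (As ! k) \<Longrightarrow>
   \<forall>k<length ts. \<Gamma> \<turnstile> ts ! k \<^bold>: As ! k \<Longrightarrow> As \<turnstile> t \<^bold>: A \<Longrightarrow> \<Gamma> \<turnstile> Box ts t \<^bold>: TBox A"
| "\<Gamma> \<turnstile> t \<^bold>: TBox A \<Longrightarrow> \<Gamma> \<turnstile> Unbox t \<^bold>: A"
| "length As = length ts \<Longrightarrow> \<forall>k<length ts. const_ty (As ! k) \<Longrightarrow>
   \<forall>k<length ts. \<Gamma> \<turnstile> ts ! k \<^bold>: As ! k \<Longrightarrow> As \<turnstile> t \<^bold>: TSum B1 B2 \<Longrightarrow>
   \<Gamma> \<turnstile> BoxPlus ts t \<^bold>: TSum (TBox B1) (TBox B2)"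


section \<open>Call-by-name reduction\<close>

inductive numeral_tm :: "tm \<Rightarrow> bool" where
  "numeral_tm Zero"
| "numeral_tm t \<Longrightarrow> numeral_tm (Succ t)"

inductive is_value :: "tm \<Rightarrow> bool" where
  "numeral_tm t \<Longrightarrow> is_value t"
| "is_value Unit"
| "is_value (Pair s t)"
| "is_value (In1 t)"
| "is_value (In2 t)"
| "is_value (Lam t)"
| "is_value (Fold t)"
| "is_value (Next t)"
| "is_value (Box ts t)"

inductive redex :: "tm \<Rightarrow> tm \<Rightarrow> bool"  (infix \<open>\<mapsto>\<^sub>0\<close> 50) where
  "Fst (Pair s t) \<mapsto>\<^sub>0 s"
| "Snd (Pair s t) \<mapsto>\<^sub>0 t"
| "Case (In1 t) s1 s2 \<mapsto>\<^sub>0 inst s1 [t]"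
| "Case (In2 t) s1 s2 \<mapsto>\<^sub>0 inst s2 [t]"
| "App (Lam s) t \<mapsto>\<^sub>0 inst s [t]"
| "Unfold (Fold t) \<mapsto>\<^sub>0 t"
| "ts \<noteq> [] \<Longrightarrow> Prev ts t \<mapsto>\<^sub>0 Prev [] (inst t ts)"
| "Prev [] (Next t) \<mapsto>\<^sub>0 t"
| "Next s \<circledast> Next t \<mapsto>\<^sub>0 Next (App s t)"
| "Unbox (Box ts t) \<mapsto>\<^sub>0 inst t ts"
| "ts \<noteq> [] \<Longrightarrow> BoxPlus ts t \<mapsto>\<^sub>0 BoxPlus [] (inst t ts)"
| "BoxPlus [] (In1 t) \<mapsto>\<^sub>0 In1 (Box [] t)"
| "BoxPlus [] (In2 t) \<mapsto>\<^sub>0 In2 (Box [] t)"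

text \<open>An evaluation context is represented by the function that fills its hole.\<close>

inductive eval_ctx :: "(tm \<Rightarrow> tm) \<Rightarrow> bool" where
  "eval_ctx (\<lambda>r. r)"
| "eval_ctx E \<Longrightarrow> eval_ctx (\<lambda>r. Succ (E r))"
| "eval_ctx E \<Longrightarrow> eval_ctx (\<lambda>r. Fst (E r))"
| "eval_ctx E \<Longrightarrow> eval_ctx (\<lambda>r. Snd (E r))"
| "eval_ctx E \<Longrightarrow> eval_ctx (\<lambda>r. Case (E r) s1 s2)"
| "eval_ctx E \<Longrightarrow> eval_ctx (\<lambda>r. App (E r) t)"
| "eval_ctx E \<Longrightarrow> eval_ctx (\<lambda>r. Unfold (E r))"
| "eval_ctx E \<Longrightarrow> eval_ctx (\<lambda>r. Prev [] (E r))"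
| "eval_ctx E \<Longrightarrow> eval_ctx (\<lambda>r. E r \<circledast> t)"
| "is_value v \<Longrightarrow> eval_ctx E \<Longrightarrow> eval_ctx (\<lambda>r. v \<circledast> E r)"
| "eval_ctx E \<Longrightarrow> eval_ctx (\<lambda>r. Unbox (E r))"
| "eval_ctx E \<Longrightarrow> eval_ctx (\<lambda>r. BoxPlus [] (E r))"

inductive step :: "tm \<Rightarrow> tm \<Rightarrow> bool"  (infix \<open>\<mapsto>\<close> 50) where
  "eval_ctx E \<Longrightarrow> t \<mapsto>\<^sub>0 u \<Longrightarrow> E t \<mapsto> E u"

abbreviation steps :: "tm \<Rightarrow> tm \<Rightarrow> bool"  (infix \<open>\<Zsurj>\<close> 50) where
  "t \<Zsurj> u \<equiv> step\<^sup>*\<^sup>* t u"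


section \<open>The universe of sets\<close>

text \<open>
  The sets denoted by the types of the calculus have unbounded size: already iterated function
  types over the naturals exceed every fixed HOL type built from \<open>nat\<close>.  The semantics is
  therefore given relative to an arbitrary type \<open>'v\<close> of sets with a membership relation that is
  closed under the usual operations.  In ZFC the set \<open>V\<^sub>\<omega>\<^sub>1\<close> (sets of countable rank) with its
  membership relation satisfies all the assumptions, and so does \<open>V\<^sub>\<kappa>\<close> for every ordinal
  \<open>\<kappa>\<close> of uncountable cofinality.
\<close>

class set_universe =
  fixes elts :: "'a \<Rightarrow> 'a set"
  assumes elts_inject: "elts x = elts y \<Longrightarrow> x = y"
    and elts_subset: "X \<subseteq> elts x \<Longrightarrow> X \<in> range elts"
    and elts_Pow: "{y. elts y \<subseteq> elts x} \<in> range elts"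
    and elts_Union: "(\<Union>y\<in>elts x. elts y) \<in> range elts"
    and elts_countable: "countable X \<Longrightarrow> X \<in> range elts"

text \<open>\<open>vset\<close> is meaningful only for collections in \<open>range elts\<close>.\<close>

definition vset :: "'v::set_universe set \<Rightarrow> 'v" where
  "vset X = (THE x. elts x = X)"

definition vpair :: "'v::set_universe \<Rightarrow> 'v \<Rightarrow> 'v" where
  "vpair a b = vset {vset {a}, vset {a, b}}"

definition vfst :: "'v::set_universe \<Rightarrow> 'v" where
  "vfst p = (THE a. \<exists>b. p = vpair a b)"

definition vsnd :: "'v::set_universe \<Rightarrow> 'v" where
  "vsnd p = (THE b. \<exists>a. p = vpair a b)"

definition vsucc :: "'v::set_universe \<Rightarrow> 'v" where
  "vsucc x = vset {x}"

primrec vnat :: "nat \<Rightarrow> 'v::set_universe" where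
  "vnat 0 = vset {}"
| "vnat (Suc n) = vsucc (vnat n)"

definition vunit :: "'v::set_universe" where
  "vunit = vset {}"

definition vinl :: "'v::set_universe \<Rightarrow> 'v" where
  "vinl a = vpair (vnat 0) a"

definition vinr :: "'v::set_universe \<Rightarrow> 'v" where
  "vinr b = vpair (vnat 1) b"

definition voutl :: "'v::set_universe \<Rightarrow> 'v" where
  "voutl x = (THE a. x = vinl a)"

definition voutr :: "'v::set_universe \<Rightarrow> 'v" where
  "voutr x = (THE b. x = vinr b)"

definition vcase :: "('v::set_universe \<Rightarrow> 'b) \<Rightarrow> ('v \<Rightarrow> 'b) \<Rightarrow> 'v \<Rightarrow> 'b" where
  "vcase f g x = (if \<exists>a. x = vinl a then f (voutl x) else g (voutr x))"

definition vgraph :: "'v::set_universe set \<Rightarrow> ('v \<Rightarrow> 'v) \<Rightarrow> 'v" where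
  "vgraph X f = vset ((\<lambda>a. vpair a (f a)) ` X)"

definition vapp :: "'v::set_universe \<Rightarrow> 'v \<Rightarrow> 'v" where
  "vapp g a = (THE b. vpair a b \<in> elts g)"

text \<open>Finite or infinite tuples \<open>(x\<^sub>j)\<^sub>j\<^sub>\<in>\<^sub>J\<close> with \<open>J \<subseteq> \<nat>\<close>, and their components.\<close>

definition vtup :: "nat set \<Rightarrow> (nat \<Rightarrow> 'v::set_universe) \<Rightarrow> 'v" where
  "vtup J x = vset ((\<lambda>j. vpair (vnat j) (x j)) ` J)"

definition vcomp :: "'v::set_universe \<Rightarrow> nat \<Rightarrow> 'v" where
  "vcomp x j = vapp x (vnat j)"


section \<open>The topos of trees\<close>

text \<open>
  Stages are numbered from \<open>0\<close>: \<open>stg X i\<close> is what is usually written \<open>X\<^sub>i\<^sub>+\<^sub>1\<close>, and \<open>res X i\<close> is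
  the restriction map from \<open>stg X (Suc i)\<close> to \<open>stg X i\<close>.
\<close>

record 'e tree =
  stg :: "nat \<Rightarrow> 'e set"
  res :: "nat \<Rightarrow> 'e \<Rightarrow> 'e"

definition hom :: "'a tree \<Rightarrow> 'b tree \<Rightarrow> (nat \<Rightarrow> 'a \<Rightarrow> 'b) set" where
  "hom X Y = {f. (\<forall>i. f i \<in> stg X i \<rightarrow>\<^sub>E stg Y i) \<and>
                 (\<forall>i. \<forall>x\<in>stg X (Suc i). f i (res X i x) = res Y i (f (Suc i) x))}"

text \<open>For \<open>i \<le> j\<close>, \<open>restr X i j\<close> is the composite restriction from \<open>stg X j\<close> to \<open>stg X i\<close>.\<close>

primrec restr :: "'e tree \<Rightarrow> nat \<Rightarrow> nat \<Rightarrow> 'e \<Rightarrow> 'e" where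
  "restr X i 0 x = x"
| "restr X i (Suc j) x = (if i \<le> j then restr X i j (res X j x) else x)"

text \<open>
  For constant \<open>X\<close>, \<open>transport X i j\<close> is the identification of \<open>stg X i\<close> with \<open>stg X j\<close>.
\<close>

definition transport :: "'e tree \<Rightarrow> nat \<Rightarrow> nat \<Rightarrow> 'e \<Rightarrow> 'e" where
  "transport X i j x =
     (if j \<le> i then restr X j i x else (THE y. y \<in> stg X j \<and> restr X i j y = x))"

definition Delta :: "'e set \<Rightarrow> 'e tree" where
  "Delta Z = \<lparr>stg = \<lambda>i. Z, res = \<lambda>i x. x\<rparr>"

definition nat_obj :: "'v::set_universe tree" where
  "nat_obj = Delta (range vnat)"

definition one_obj :: "'v::set_universe tree" where
  "one_obj = Delta {vunit}"

definition zero_obj :: "'v::set_universe tree" where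
  "zero_obj = Delta {}"

definition prod_obj :: "'v::set_universe tree \<Rightarrow> 'v tree \<Rightarrow> 'v tree" where
  "prod_obj X Y =
     \<lparr>stg = \<lambda>i. {vpair a b | a b. a \<in> stg X i \<and> b \<in> stg Y i},
      res = \<lambda>i p. vpair (res X i (vfst p)) (res Y i (vsnd p))\<rparr>"

definition sum_obj :: "'v::set_universe tree \<Rightarrow> 'v tree \<Rightarrow> 'v tree" where
  "sum_obj X Y =
     \<lparr>stg = \<lambda>i. vinl ` stg X i \<union> vinr ` stg Y i,
      res = \<lambda>i. vcase (\<lambda>a. vinl (res X i a)) (\<lambda>b. vinr (res Y i b))\<rparr>"

definition exp_obj :: "'v::set_universe tree \<Rightarrow> 'v tree \<Rightarrow> 'v tree" where
  "exp_obj X Y =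
     \<lparr>stg = \<lambda>i. {vtup {..i} (\<lambda>j. vgraph (stg X j) (f j)) | f.
                  (\<forall>j\<le>i. f j \<in> stg X j \<rightarrow> stg Y j) \<and>
                  (\<forall>j<i. \<forall>x\<in>stg X (Suc j). f j (res X j x) = res Y j (f (Suc j) x))},
      res = \<lambda>i g. vtup {..i} (vcomp g)\<rparr>"

definition later_obj :: "'v::set_universe tree \<Rightarrow> 'v tree" where
  "later_obj X =
     \<lparr>stg = case_nat {vunit} (stg X), res = case_nat (\<lambda>x. vunit) (res X)\<rparr>"

definition next_map :: "'v::set_universe tree \<Rightarrow> nat \<Rightarrow> 'v \<Rightarrow> 'v" where
  "next_map X i x = (case i of 0 \<Rightarrow> vunit | Suc j \<Rightarrow> res X j x)"

text \<open>A global element is encoded as the sequence of its components.\<close>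

definition box_obj :: "'v::set_universe tree \<Rightarrow> 'v tree" where
  "box_obj X = Delta {vtup UNIV (\<lambda>i. x i vunit) | x. x \<in> hom (one_obj :: 'v tree) X}"

definition unbox_map :: "nat \<Rightarrow> 'v::set_universe \<Rightarrow> 'v" where
  "unbox_map i x = vcomp x i"

text \<open>
  If the first \<open>n + 1\<close> stages of \<open>F X\<close> depend only on the first \<open>n\<close> stages of \<open>X\<close>, then the
  iterates of \<open>F\<close> stabilise stage by stage, and \<open>fix_obj F\<close> collects the stable parts.
\<close>

definition fix_obj :: "('v::set_universe tree \<Rightarrow> 'v tree) \<Rightarrow> 'v tree" where
  "fix_obj F = \<lparr>stg = \<lambda>i. stg ((F ^^ Suc i) one_obj) i,
                res = \<lambda>i. res ((F ^^ Suc (Suc i)) one_obj) i\<rparr>"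


section \<open>Denotation of types\<close>

text \<open>
  The action on objects of the mixed-variance functor denoted by a type: \<open>N\<close> and \<open>P\<close> give the
  contravariant and the covariant arguments.
\<close>

primrec ty_den :: "ty \<Rightarrow> (nat \<Rightarrow> 'v::set_universe tree) \<Rightarrow> (nat \<Rightarrow> 'v tree) \<Rightarrow> 'v tree" where
  "ty_den (TVar i) N P = P i"
| "ty_den TNat N P = nat_obj"
| "ty_den TUnit N P = one_obj"
| "ty_den (TProd A B) N P = prod_obj (ty_den A N P) (ty_den B N P)"
| "ty_den TVoid N P = zero_obj"
| "ty_den (TSum A B) N P = sum_obj (ty_den A N P) (ty_den B N P)"
| "ty_den (TFun A B) N P = exp_obj (ty_den A P N) (ty_den B N P)"
| "ty_den (TMu A) N P = fix_obj (\<lambda>X. ty_den A (case_nat X N) (case_nat X P))"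
| "ty_den (TLater A) N P = later_obj (ty_den A N P)"
| "ty_den (TBox A) N P = box_obj (ty_den A N P)"

text \<open>Closed types; the arguments for the (absent) type variables are irrelevant.\<close>

definition tden :: "ty \<Rightarrow> 'v::set_universe tree" where
  "tden A = ty_den A (\<lambda>_. one_obj) (\<lambda>_. one_obj)"


subsection \<open>Recursive types denote fixed points\<close>

definition agree :: "nat \<Rightarrow> 'e tree \<Rightarrow> 'e tree \<Rightarrow> bool" where
  "agree n X Y \<longleftrightarrow> (\<forall>i<n. stg X i = stg Y i) \<and> (\<forall>i. Suc i < n \<longrightarrow> res X i = res Y i)"

lemma agree_refl [simp]: "agree n X X"
  by (simp add: agree_def)

lemma agree_mono: "agree n X Y \<Longrightarrow> m \<le> n \<Longrightarrow> agree m X Y"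
  by (auto simp: agree_def)

lemma agree_eqI:
  assumes "\<And>n. agree n X Y"
  shows "X = (Y :: 'e tree)"
proof -
  have "stg X i = stg Y i \<and> res X i = res Y i" for i
    using assms[of "Suc (Suc i)"] by (simp add: agree_def)
  then show ?thesis by (intro tree.equality ext) auto
qed

lemma agree_prod: "agree n X X' \<Longrightarrow> agree n Y Y' \<Longrightarrow> agree n (prod_obj X Y) (prod_obj X' Y')"
  by (simp add: agree_def prod_obj_def)

lemma agree_sum: "agree n X X' \<Longrightarrow> agree n Y Y' \<Longrightarrow> agree n (sum_obj X Y) (sum_obj X' Y')"
  by (simp add: agree_def sum_obj_def)

lemma agree_exp:
  assumes "agree n X X'" and "agree n Y Y'"
  shows "agree n (exp_obj X Y) (exp_obj X' Y')"
proof -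
  have "stg (exp_obj X Y) i \<subseteq> stg (exp_obj X' Y') i"
    if "i < n" "agree n X X'" "agree n Y Y'" for i and X X' Y Y' :: "'a tree"
  proof
    fix g assume "g \<in> stg (exp_obj X Y) i"
    then obtain f where f: "g = vtup {..i} (\<lambda>j. vgraph (stg X j) (f j))"
        "\<forall>j\<le>i. f j \<in> stg X j \<rightarrow> stg Y j"
        "\<forall>j<i. \<forall>x\<in>stg X (Suc j). f j (res X j x) = res Y j (f (Suc j) x)"
      by (auto simp: exp_obj_def)
    have "g = vtup {..i} (\<lambda>j. vgraph (stg X' j) (f j))"
      unfolding f(1) vtup_def using that by (auto simp: agree_def intro!: arg_cong[of _ _ vset])
    moreover have "\<forall>j\<le>i. f j \<in> stg X' j \<rightarrow> stg Y' j"
      using f(2) that by (auto simp: agree_def)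
    moreover have "\<forall>j<i. \<forall>x\<in>stg X' (Suc j). f j (res X' j x) = res Y' j (f (Suc j) x)"
      using f(3) that by (auto simp: agree_def)
    ultimately show "g \<in> stg (exp_obj X' Y') i"
      by (auto simp: exp_obj_def)
  qed
  moreover have "agree n X' X" "agree n Y' Y"
    using assms by (simp_all add: agree_def)
  ultimately have "stg (exp_obj X Y) i = stg (exp_obj X' Y') i" if "i < n" for i
    using assms that by blast
  moreover have "res (exp_obj X Y) = res (exp_obj X' Y')"
    by (simp add: exp_obj_def)
  ultimately show ?thesis
    by (simp add: agree_def)
qed

lemma agree_later: "agree n X Y \<Longrightarrow> agree (Suc n) (later_obj X) (later_obj Y)"
  by (auto simp: agree_def later_obj_def split: nat.split)

lemma agree_fix:
  assumes "\<And>m X Y. m \<le> n \<Longrightarrow> agree m X Y \<Longrightarrow> agree m (F X) (G Y)"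
  shows "agree n (fix_obj F) (fix_obj G)"
proof -
  have "agree n ((F ^^ k) one_obj) ((G ^^ k) one_obj)" for k
    by (induction k) (use assms in auto)
  then show ?thesis
    by (simp add: agree_def fix_obj_def del: funpow.simps)
qed

lemma ty_den_agree:
  "wft k A \<Longrightarrow> \<forall>i<k. agree n (N i) (N' i) \<and> agree n (P i) (P' i) \<Longrightarrow>
   agree n (ty_den A N P) (ty_den A N' P')"
proof (induction k A arbitrary: n N N' P P' rule: wft.induct)
  case (7 k A B)
  then show ?case by (auto intro!: agree_exp)
next
  case (8 k A)
  show ?case unfolding ty_den.simps
  proof (rule agree_fix)
    fix m and X Y :: "'a tree"
    assume m: "m \<le> n" and a: "agree m X Y"
    show "agree m (ty_den A (case_nat X N) (case_nat X P)) (ty_den A (case_nat Y N') (case_nat Y P'))"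
      by (rule 8(3)) (use 8(4) m a in \<open>auto split: nat.split intro: agree_mono\<close>)
  qed
next
  case (9 k A)
  then have "agree n (ty_den A N P) (ty_den A N' P')" by auto
  from agree_later[OF this] show ?case by (simp add: agree_mono)
next
  case (10 A k)
  have "agree m (ty_den A N P) (ty_den A N' P')" for m
    by (rule 10(2)) simp
  then have "ty_den A N P = ty_den A N' P'"
    by (rule agree_eqI)
  then show ?case by simp
qed (auto intro!: agree_prod agree_sum)

lemma ty_den_closed: "wft 0 A \<Longrightarrow> ty_den A N P = tden A"
  unfolding tden_def by (rule agree_eqI, rule ty_den_agree) auto

lemma ty_den_guarded:
  "wft k A \<Longrightarrow> guarded l A \<Longrightarrow>
   \<forall>i<k. if i = l then agree n (N i) (N' i) \<and> agree n (P i) (P' i)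
         else agree (Suc n) (N i) (N' i) \<and> agree (Suc n) (P i) (P' i) \<Longrightarrow>
   agree (Suc n) (ty_den A N P) (ty_den A N' P')"
proof (induction k A arbitrary: l n N N' P P' rule: wft.induct)
  case (7 k A B)
  show ?case unfolding ty_den.simps
    by (intro agree_exp 7(3)[where l = l] 7(4)[where l = l]) (use 7(5,6) in \<open>auto split: if_splits\<close>)
next
  case (8 k A)
  show ?case unfolding ty_den.simps
  proof (rule agree_fix)
    fix m and X Y :: "'a tree"
    assume m: "m \<le> Suc n" and a: "agree m X Y"
    show "agree m (ty_den A (case_nat X N) (case_nat X P)) (ty_den A (case_nat Y N') (case_nat Y P'))"
    proof (cases m)
      case 0
      then show ?thesis by (simp add: agree_def)
    next
      case (Suc m')
      show ?thesis unfolding Suc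
        by (rule 8(3)[of "Suc l"])
          (use 8(4,5) m a Suc in \<open>auto split: nat.split if_splits intro: agree_mono\<close>)
    qed
  qed
next
  case (9 k A)
  have "agree n (ty_den A N P) (ty_den A N' P')"
  proof (rule ty_den_agree[OF 9(1)], intro allI impI)
    fix i assume "i < k"
    then show "agree n (N i) (N' i) \<and> agree n (P i) (P' i)"
      using 9(4)[rule_format, of i] by (auto split: if_splits intro: agree_mono[of "Suc n"])
  qed
  from agree_later[OF this] show ?case by simp
next
  case (10 A k)
  then show ?case by (simp add: ty_den_closed)
next
  case (4 k A B)
  then show ?case unfolding ty_den.simps guarded.simps by (intro agree_prod) blast+
next
  case (6 k A B)
  then show ?case unfolding ty_den.simps guarded.simps by (intro agree_sum) blast+
qed (auto split: if_splits)

lemma fix_obj_fixpoint: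
  assumes F: "\<And>n X Y. agree n X Y \<Longrightarrow> agree (Suc n) (F X) (F Y)"
  shows "F (fix_obj F) = fix_obj F"
proof -
  have iter: "agree n ((F ^^ n) one_obj) ((F ^^ m) one_obj)" if "n \<le> m" for n m
    using that
  proof (induction n arbitrary: m)
    case (Suc n)
    then show ?case by (cases m) (auto intro: F)
  qed (simp add: agree_def)
  have fx: "agree n (fix_obj F) ((F ^^ n) one_obj)" for n
  proof -
    have "stg (fix_obj F) i = stg ((F ^^ n) one_obj) i" if "i < n" for i
      using iter[of "Suc i" n] that by (simp add: agree_def fix_obj_def del: funpow.simps)
    moreover have "res (fix_obj F) i = res ((F ^^ n) one_obj) i" if "Suc i < n" for i
      using iter[of "Suc (Suc i)" n] that
      by (simp add: agree_def fix_obj_def del: funpow.simps)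
    ultimately show ?thesis by (simp add: agree_def)
  qed
  have "agree n (F (fix_obj F)) (fix_obj F)" for n
    using F[OF fx[of n]] fx[of "Suc n"] by (auto simp: agree_def)
  then show ?thesis
    by (rule agree_eqI)
qed

lemma ty_den_tlift:
  "ty_den (tlift k A) N P =
   ty_den A (\<lambda>i. N (if i < k then i else Suc i)) (\<lambda>i. P (if i < k then i else Suc i))"
proof (induction A arbitrary: k N P)
  case (TMu A)
  have "(\<lambda>i. case_nat X M (if i < Suc k then i else Suc i)) =
        case_nat X (\<lambda>i. M (if i < k then i else Suc i))" for X and M :: "nat \<Rightarrow> 'a tree"
    by (auto split: nat.split)
  then show ?case by (simp add: TMu)
qed auto

definition env_insert :: "nat \<Rightarrow> 'e \<Rightarrow> (nat \<Rightarrow> 'e) \<Rightarrow> nat \<Rightarrow> 'e" where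
  "env_insert k x M i = (if i < k then M i else if i = k then x else M (i - 1))"

lemma ty_den_tsubst:
  "ty_den (tsubst k C A) N P =
   ty_den A (env_insert k (ty_den C P N) N) (env_insert k (ty_den C N P) P)"
proof (induction A arbitrary: k C N P)
  case (TMu A)
  have "env_insert (Suc k) Z (case_nat X M) = case_nat X (env_insert k Z M)"
    for X Z and M :: "nat \<Rightarrow> 'a tree"
    by (auto simp: env_insert_def fun_eq_iff split: nat.split)
  then show ?case by (simp add: TMu ty_den_tlift)
qed (auto simp: env_insert_def)

lemma tden_unfold_mu:
  assumes "wft 0 (TMu A)"
  shows "tden (unfold_mu A) = (tden (TMu A) :: 'v::set_universe tree)"
proof -
  define M :: "nat \<Rightarrow> 'v tree" where "M = (\<lambda>_. one_obj)"
  define F where "F = (\<lambda>X. ty_den A (case_nat X M) (case_nat X M))"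
  have A: "wft (Suc 0) A" "guarded 0 A"
    using assms by (auto elim: wft.cases)
  have "agree n X Y \<Longrightarrow> agree (Suc n) (F X) (F Y)" for n X Y
    unfolding F_def by (rule ty_den_guarded[OF A]) simp
  then have "F (fix_obj F) = fix_obj F"
    by (rule fix_obj_fixpoint)
  moreover have "tden (TMu A) = fix_obj F"
    by (simp add: tden_def F_def M_def)
  moreover have "tden (unfold_mu A) = F (tden (TMu A))"
  proof -
    have "env_insert 0 X M = case_nat X M" for X
      by (auto simp: env_insert_def fun_eq_iff split: nat.split)
    then show ?thesis
      by (simp add: tden_def F_def M_def[symmetric] ty_den_tsubst del: ty_den.simps)
  qed
  ultimately show ?thesis by simp
qed


section \<open>Denotation of terms\<close>

text \<open>Elements of the product denoted by a context are lists.\<close>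

definition ctx_den :: "ty list \<Rightarrow> 'v::set_universe list tree" where
  "ctx_den \<Gamma> =
     \<lparr>stg = \<lambda>i. {\<gamma>. length \<gamma> = length \<Gamma> \<and> (\<forall>k<length \<Gamma>. \<gamma> ! k \<in> stg (tden (\<Gamma> ! k)) i)},
      res = \<lambda>i \<gamma>. map2 (\<lambda>A. res (tden A) i) \<Gamma> \<gamma>\<rparr>"

definition arr :: "ty list \<Rightarrow> (nat \<Rightarrow> 'v::set_universe list \<Rightarrow> 'v) \<Rightarrow> nat \<Rightarrow> 'v list \<Rightarrow> 'v" where
  "arr \<Gamma> f = (\<lambda>i. restrict (f i) (stg (ctx_den \<Gamma>) i))"

text \<open>
  The values of an explicit substitution with denotations \<open>fs\<close> of constant types \<open>As\<close>, computed
  at stage \<open>i\<close> and regarded as an element of stage \<open>j\<close>.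
\<close>

definition sub_den ::
  "ty list \<Rightarrow> (nat \<Rightarrow> 'v::set_universe list \<Rightarrow> 'v) list \<Rightarrow> nat \<Rightarrow> nat \<Rightarrow> 'v list \<Rightarrow> 'v list" where
  "sub_den As fs i j \<gamma> = map2 (\<lambda>A f. transport (tden A) i j (f i \<gamma>)) As fs"

definition boxplus_den :: "(nat \<Rightarrow> 'v::set_universe) \<Rightarrow> 'v" where
  "boxplus_den x =
     (if \<forall>j. \<exists>a. x j = vinl a then vinl (vtup UNIV (\<lambda>j. voutl (x j)))
      else vinr (vtup UNIV (\<lambda>j. voutr (x j))))"

text \<open>
  Since terms carry no type annotations, the denotation is defined along typing derivations:
  \<open>denotes \<Gamma> t A f\<close> holds if some derivation of \<open>\<Gamma> \<turnstile> t \<^bold>: A\<close> has denotation \<open>f\<close>.  The rules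
  correspond one-to-one to the typing rules.  By \<open>tden_unfold_mu\<close> the isomorphism between the
  denotations of a recursive type and of its unfolding is the identity, hence the rules for
  \<open>Fold\<close> and \<open>Unfold\<close>.  In the rule for \<open>Abort\<close> the stages of the context are empty, so that the
  value is immaterial.
\<close>

inductive denotes :: "ty list \<Rightarrow> tm \<Rightarrow> ty \<Rightarrow> (nat \<Rightarrow> 'v::set_universe list \<Rightarrow> 'v) \<Rightarrow> bool" where
  "k < length \<Gamma> \<Longrightarrow> wft 0 (\<Gamma> ! k) \<Longrightarrow> denotes \<Gamma> (Var k) (\<Gamma> ! k) (arr \<Gamma> (\<lambda>i \<gamma>. \<gamma> ! k))"
| "denotes \<Gamma> Zero TNat (arr \<Gamma> (\<lambda>i \<gamma>. vnat 0))"
| "denotes \<Gamma> t TNat f \<Longrightarrow> denotes \<Gamma> (Succ t) TNat (arr \<Gamma> (\<lambda>i \<gamma>. vsucc (f i \<gamma>)))"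
| "denotes \<Gamma> Unit TUnit (arr \<Gamma> (\<lambda>i \<gamma>. vunit))"
| "denotes \<Gamma> s A f \<Longrightarrow> denotes \<Gamma> t B g \<Longrightarrow>
   denotes \<Gamma> (Pair s t) (TProd A B) (arr \<Gamma> (\<lambda>i \<gamma>. vpair (f i \<gamma>) (g i \<gamma>)))"
| "denotes \<Gamma> t (TProd A B) f \<Longrightarrow> denotes \<Gamma> (Fst t) A (arr \<Gamma> (\<lambda>i \<gamma>. vfst (f i \<gamma>)))"
| "denotes \<Gamma> t (TProd A B) f \<Longrightarrow> denotes \<Gamma> (Snd t) B (arr \<Gamma> (\<lambda>i \<gamma>. vsnd (f i \<gamma>)))"
| "denotes \<Gamma> t TVoid f \<Longrightarrow> wft 0 A \<Longrightarrow> denotes \<Gamma> (Abort t) A (arr \<Gamma> (\<lambda>i \<gamma>. undefined))"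
| "denotes \<Gamma> t A f \<Longrightarrow> wft 0 B \<Longrightarrow>
   denotes \<Gamma> (In1 t) (TSum A B) (arr \<Gamma> (\<lambda>i \<gamma>. vinl (f i \<gamma>)))"
| "denotes \<Gamma> t B f \<Longrightarrow> wft 0 A \<Longrightarrow>
   denotes \<Gamma> (In2 t) (TSum A B) (arr \<Gamma> (\<lambda>i \<gamma>. vinr (f i \<gamma>)))"
| "denotes \<Gamma> t (TSum A B) f \<Longrightarrow> denotes (A # \<Gamma>) s1 C g \<Longrightarrow> denotes (B # \<Gamma>) s2 C h \<Longrightarrow>
   denotes \<Gamma> (Case t s1 s2) C
     (arr \<Gamma> (\<lambda>i \<gamma>. vcase (\<lambda>a. g i (a # \<gamma>)) (\<lambda>b. h i (b # \<gamma>)) (f i \<gamma>)))"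
| "denotes (A # \<Gamma>) t B f \<Longrightarrow> wft 0 A \<Longrightarrow>
   denotes \<Gamma> (Lam t) (TFun A B)
     (arr \<Gamma> (\<lambda>i \<gamma>. vtup {..i} (\<lambda>j. vgraph (stg (tden A) j)
                                       (\<lambda>a. f j (a # restr (ctx_den \<Gamma>) j i \<gamma>)))))"
| "denotes \<Gamma> s (TFun A B) f \<Longrightarrow> denotes \<Gamma> t A g \<Longrightarrow>
   denotes \<Gamma> (App s t) B (arr \<Gamma> (\<lambda>i \<gamma>. vapp (vcomp (f i \<gamma>) i) (g i \<gamma>)))"
| "denotes \<Gamma> t (unfold_mu A) f \<Longrightarrow> wft 0 (TMu A) \<Longrightarrow> denotes \<Gamma> (Fold t) (TMu A) f"
| "denotes \<Gamma> t (TMu A) f \<Longrightarrow> denotes \<Gamma> (Unfold t) (unfold_mu A) f"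
| "denotes \<Gamma> t A f \<Longrightarrow>
   denotes \<Gamma> (Next t) (TLater A) (arr \<Gamma> (\<lambda>i \<gamma>. next_map (tden A) i (f i \<gamma>)))"
| "length As = length ts \<Longrightarrow> length fs = length ts \<Longrightarrow> \<forall>k<length ts. const_ty (As ! k) \<Longrightarrow>
   \<forall>k<length ts. denotes \<Gamma> (ts ! k) (As ! k) (fs ! k) \<Longrightarrow> denotes As t (TLater A) f \<Longrightarrow>
   denotes \<Gamma> (Prev ts t) A (arr \<Gamma> (\<lambda>i \<gamma>. f (Suc i) (sub_den As fs i (Suc i) \<gamma>)))"
| "denotes \<Gamma> s (TLater (TFun A B)) f \<Longrightarrow> denotes \<Gamma> t (TLater A) g \<Longrightarrow>
   denotes \<Gamma> (s \<circledast> t) (TLater B)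
     (arr \<Gamma> (\<lambda>i \<gamma>. case i of 0 \<Rightarrow> vunit | Suc j \<Rightarrow> vapp (vcomp (f i \<gamma>) j) (g i \<gamma>)))"
| "length As = length ts \<Longrightarrow> length fs = length ts \<Longrightarrow> \<forall>k<length ts. const_ty (As ! k) \<Longrightarrow>
   \<forall>k<length ts. denotes \<Gamma> (ts ! k) (As ! k) (fs ! k) \<Longrightarrow> denotes As t A f \<Longrightarrow>
   denotes \<Gamma> (Box ts t) (TBox A)
     (arr \<Gamma> (\<lambda>i \<gamma>. vtup UNIV (\<lambda>j. f j (sub_den As fs i j \<gamma>))))"
| "denotes \<Gamma> t (TBox A) f \<Longrightarrow> denotes \<Gamma> (Unbox t) A (arr \<Gamma> (\<lambda>i \<gamma>. unbox_map i (f i \<gamma>)))"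
| "length As = length ts \<Longrightarrow> length fs = length ts \<Longrightarrow> \<forall>k<length ts. const_ty (As ! k) \<Longrightarrow>
   \<forall>k<length ts. denotes \<Gamma> (ts ! k) (As ! k) (fs ! k) \<Longrightarrow> denotes As t (TSum B1 B2) f \<Longrightarrow>
   denotes \<Gamma> (BoxPlus ts t) (TSum (TBox B1) (TBox B2))
     (arr \<Gamma> (\<lambda>i \<gamma>. boxplus_den (\<lambda>j. f j (sub_den As fs i j \<gamma>))))"

text \<open>A judgement may have several derivations, but they all have the same denotation.\<close>

definition den :: "ty list \<Rightarrow> tm \<Rightarrow> ty \<Rightarrow> nat \<Rightarrow> 'v::set_universe list \<Rightarrow> 'v" where
  "den \<Gamma> t A = (THE f. denotes \<Gamma> t A f)"

end

theory Submission
  imports Defs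
begin

text \<open>
  Terms carry no type annotations, so a judgement may have many derivations, and soundness splits
  into two parts.  First, a derivation of \<open>t\<close> with denotation \<open>f\<close> is turned into a derivation of each
  reduct of \<open>t\<close> with the same denotation \<open>f\<close>; this is the usual argument by a semantic substitution
  lemma.  Second, all derivations of a closed judgement have the same denotation (coherence).  For this,
  \<open>rel A B i\<close> relates stage \<open>i\<close> of the denotations of two types \<open>A\<close> and \<open>B\<close>, following their common
  structure and being empty where that differs.  Any two derivations for one term, possibly at
  different types, have related denotations, whereas \<open>rel A A i\<close> is the equality.  The relation is
  well defined by recursion on the nesting depth of boxes, then the stage, then the part of the type
  that is not beneath a \<open>TLater\<close>.
\<close>

section \<open>The universe of sets\<close>

text \<open>Coherence has to compare different types because a term does not determine the types
  that its rules hide: \<open>App (Lam Zero) (In1 Unit)\<close> is typable with argument type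
  \<open>TSum TUnit B\<close> for every closed \<open>B\<close>. Two derivations of one judgement
  thus contain subderivations at different types and in different contexts, where equality is no
  usable induction hypothesis; it is replaced by a heterogeneous relation that is equality on the
  diagonal. Recursive types forbid defining it by recursion on the type alone. Explicit
  substitutions move an environment from one stage to all others, so relatedness at constant types
  must pass upwards as well as downwards.

  A second obstacle is the coding of sets. \<open>vset\<close> is a description, and application
  recovers a function from its graph only if the graph is a set of the universe. The axioms give
  replacement only for countable families, so pairs, tuples and graphs are instead bounded by power
  sets, and smallness of the stages has to be known before values of functions can be
  computed.\<close>

definition small :: "'v::set_universe set \<Rightarrow> bool" where
  "small X \<longleftrightarrow> X \<in> range elts"

lemma elts_vset: "small X \<Longrightarrow> elts (vset X) = X"
  unfolding vset_def small_def by (rule theI') (auto dest: elts_inject)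

lemma vset_inject: "small X \<Longrightarrow> small Y \<Longrightarrow> vset X = vset Y \<longleftrightarrow> X = Y"
  by (metis elts_vset)

lemma small_countable: "countable X \<Longrightarrow> small X"
  unfolding small_def by (rule elts_countable)

lemma small_subset: "small Y \<Longrightarrow> X \<subseteq> Y \<Longrightarrow> small X"
  using elts_subset by (auto simp: small_def)

lemma small_Pow: "small X \<Longrightarrow> small {y. elts y \<subseteq> X}"
  using elts_Pow by (auto simp: small_def)

lemma small_Union:
  assumes "small X" shows "small (\<Union>y\<in>X. elts y)"
  using assms elts_Union by (auto simp: small_def)

text \<open>Countability of the index set makes the collection of all \<open>vset (X j)\<close>
  small, so that a single union in the universe applies.\<close>

lemma small_UN_nat:
  fixes X :: "nat \<Rightarrow> 'v::set_universe set"
  assumes "\<And>j. small (X j)"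
  shows "small (\<Union>j. X j)"
proof -
  have "small (\<Union>y\<in>range (\<lambda>j. vset (X j)). elts y)"
    by (intro small_Union small_countable) simp
  then show ?thesis by (simp add: elts_vset assms)
qed

lemma small_Un: "small X \<Longrightarrow> small Y \<Longrightarrow> small (X \<union> Y)"
proof -
  assume *: "small X" "small Y"
  then have "small (\<Union>y\<in>{vset X, vset Y}. elts y)"
    by (intro small_Union small_countable) simp
  then show ?thesis by (simp add: elts_vset *)
qed

lemma small_finite: "finite X \<Longrightarrow> small X"
  by (simp add: small_countable countable_finite)

lemma elts_vset_finite: "finite X \<Longrightarrow> elts (vset X) = X"
  by (simp add: elts_vset small_finite)

section \<open>Ordered pairs, numerals and tagged unions\<close>

lemma vpair_eq_iff [simp]: "vpair a b = vpair a' b' \<longleftrightarrow> a = a' \<and> b = b'"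
proof
  assume "vpair a b = vpair a' b'"
  then have "{vset {a}, vset {a, b}} = {vset {a'}, vset {a', b'}}"
    by (simp add: vpair_def vset_inject small_finite)
  then show "a = a' \<and> b = b'"
    by (auto simp: doubleton_eq_iff vset_inject small_finite)
qed simp

lemma vfst_vpair [simp]: "vfst (vpair a b) = a"
  by (simp add: vfst_def)

lemma vsnd_vpair [simp]: "vsnd (vpair a b) = b"
  by (simp add: vsnd_def)

lemma vnat_inject [simp]: "vnat m = vnat n \<longleftrightarrow> m = n"
proof (induction m arbitrary: n)
  case 0
  show ?case by (cases n) (auto simp: vsucc_def vset_inject small_finite)
next
  case (Suc m)
  then show ?case by (cases n) (auto simp: vsucc_def vset_inject small_finite)
qed

lemma vinl_eq_iff [simp]: "vinl a = vinl b \<longleftrightarrow> a = b"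
  by (simp add: vinl_def)

lemma vinr_eq_iff [simp]: "vinr a = vinr b \<longleftrightarrow> a = b"
  by (simp add: vinr_def)

lemma vinl_neq_vinr [simp]: "vinl a \<noteq> vinr b" "vinr b \<noteq> vinl a"
  by (auto simp: vinl_def vinr_def simp del: vnat.simps)

lemma voutl_vinl [simp]: "voutl (vinl a) = a"
  by (simp add: voutl_def)

lemma voutr_vinr [simp]: "voutr (vinr a) = a"
  by (simp add: voutr_def)

lemma vcase_simps [simp]: "vcase f g (vinl a) = f a" "vcase f g (vinr b) = g b"
  by (simp_all add: vcase_def)

text \<open>Pairs are coded as Kuratowski pairs: both members of a pair code subsets of
  \<open>X \<union> Y\<close>, so all pairs lie in the double power set and are separated from it.
  This bounding takes the place of a general replacement principle.\<close>

lemma small_vpair: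
  assumes "small X" "small Y"
  shows "small {vpair a b | a b. a \<in> X \<and> b \<in> Y}"
proof (rule small_subset)
  show "small {z. elts z \<subseteq> {y. elts y \<subseteq> X \<union> Y}}"
    by (intro small_Pow small_Un assms)
  show "{vpair a b | a b. a \<in> X \<and> b \<in> Y} \<subseteq> {z. elts z \<subseteq> {y. elts y \<subseteq> X \<union> Y}}"
    by (auto simp: vpair_def elts_vset_finite)
qed

section \<open>Tuples and function graphs\<close>

lemma elts_vtup: "elts (vtup J x) = (\<lambda>j. vpair (vnat j) (x j)) ` J"
  unfolding vtup_def by (intro elts_vset small_countable) simp

lemma vcomp_vtup [simp]: "j \<in> J \<Longrightarrow> vcomp (vtup J x) j = x j"
  unfolding vcomp_def vapp_def by (rule the_equality) (auto simp: elts_vtup)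

lemma vtup_cong: "(\<And>j. j \<in> J \<Longrightarrow> x j = y j) \<Longrightarrow> vtup J x = vtup J y"
  unfolding vtup_def by (metis (no_types, lifting) image_cong)

lemma small_vtup:
  fixes X :: "nat \<Rightarrow> 'v::set_universe set"
  assumes "\<And>j. small (X j)"
  shows "small {vtup J x | x. \<forall>j\<in>J. x j \<in> X j}"
proof (rule small_subset)
  let ?P = "{vpair a b | a b. a \<in> range vnat \<and> b \<in> (\<Union>j. X j)}"
  show "small {z. elts z \<subseteq> ?P}"
    by (intro small_Pow small_vpair small_UN_nat assms small_countable) simp
  show "{vtup J x | x. \<forall>j\<in>J. x j \<in> X j} \<subseteq> {z. elts z \<subseteq> ?P}"
    by (fastforce simp: elts_vtup)
qed

text \<open>A small codomain is what makes the graph a set of the universe: it is then cut out of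
  the pairs over \<open>X\<close> and \<open>Y\<close>.\<close>

lemma elts_vgraph:
  assumes "small X" "small Y" "f \<in> X \<rightarrow> Y"
  shows "elts (vgraph X f) = (\<lambda>a. vpair a (f a)) ` X"
proof -
  have "(\<lambda>a. vpair a (f a)) ` X \<subseteq> {vpair a b | a b. a \<in> X \<and> b \<in> Y}"
    using assms(3) by auto
  then show ?thesis
    unfolding vgraph_def by (intro elts_vset small_subset[OF small_vpair[OF assms(1,2)]])
qed

lemma vapp_vgraph:
  assumes "small X" "small Y" "f \<in> X \<rightarrow> Y" "a \<in> X"
  shows "vapp (vgraph X f) a = f a"
  unfolding vapp_def by (rule the_equality) (use assms(4) in \<open>auto simp: elts_vgraph[OF assms(1-3)]\<close>)

lemma vgraph_cong: "(\<And>a. a \<in> X \<Longrightarrow> f a = g a) \<Longrightarrow> vgraph X f = vgraph X g"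
  unfolding vgraph_def by (metis (no_types, lifting) image_cong)

lemma small_vgraph:
  assumes "small X" "small Y"
  shows "small {vgraph X f | f. f \<in> X \<rightarrow> Y}"
proof (rule small_subset)
  let ?P = "{vpair a b | a b. a \<in> X \<and> b \<in> Y}"
  show "small {z. elts z \<subseteq> ?P}"
    by (intro small_Pow small_vpair assms)
  show "{vgraph X f | f. f \<in> X \<rightarrow> Y} \<subseteq> {z. elts z \<subseteq> ?P}"
    by (auto simp: elts_vgraph[OF assms] Pi_iff)
qed

section \<open>Trees\<close>

lemma stg_prod [simp]: "stg (prod_obj X Y) i = {vpair a b | a b. a \<in> stg X i \<and> b \<in> stg Y i}"
  and res_prod [simp]: "res (prod_obj X Y) i (vpair a b) = vpair (res X i a) (res Y i b)"
  by (simp_all add: prod_obj_def)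

lemma stg_sum [simp]: "stg (sum_obj X Y) i = vinl ` stg X i \<union> vinr ` stg Y i"
  and res_sum [simp]:
    "res (sum_obj X Y) i (vinl a) = vinl (res X i a)"
    "res (sum_obj X Y) i (vinr b) = vinr (res Y i b)"
  by (simp_all add: sum_obj_def)

lemma stg_later [simp]: "stg (later_obj X) 0 = {vunit}" "stg (later_obj X) (Suc i) = stg X i"
  and res_later [simp]: "res (later_obj X) 0 x = vunit" "res (later_obj X) (Suc i) = res X i"
  by (simp_all add: later_obj_def)

lemma stg_Delta [simp]: "stg (Delta Z) i = Z"
  and res_Delta [simp]: "res (Delta Z) i x = x"
  by (simp_all add: Delta_def)

lemma homI:
  assumes "\<And>i x. x \<in> stg X i \<Longrightarrow> f i x \<in> stg Y i"
    and "\<And>i x. x \<notin> stg X i \<Longrightarrow> f i x = undefined"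
    and "\<And>i x. x \<in> stg X (Suc i) \<Longrightarrow> f i (res X i x) = res Y i (f (Suc i) x)"
  shows "f \<in> hom X Y"
  unfolding hom_def using assms by blast

lemma hom_in: "f \<in> hom X Y \<Longrightarrow> x \<in> stg X i \<Longrightarrow> f i x \<in> stg Y i"
  and hom_res: "f \<in> hom X Y \<Longrightarrow> x \<in> stg X (Suc i) \<Longrightarrow> f i (res X i x) = res Y i (f (Suc i) x)"
  and hom_undefined: "f \<in> hom X Y \<Longrightarrow> x \<notin> stg X i \<Longrightarrow> f i x = undefined"
  unfolding hom_def by blast+

lemma hom_eqI:
  assumes "f \<in> hom X Y" "g \<in> hom X Z" "\<And>i x. x \<in> stg X i \<Longrightarrow> f i x = g i x"
  shows "f = g"
proof (intro ext)
  show "f i x = g i x" for i x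
    using assms(3) hom_undefined[OF assms(1)] hom_undefined[OF assms(2)] by (cases "x \<in> stg X i") auto
qed

text \<open>A morphism from the terminal object, stripped of its argument and of its values off the
  domain; equivalently, a point of the inverse limit of \<open>X\<close>.\<close>

definition global_elt :: "'e tree \<Rightarrow> (nat \<Rightarrow> 'e) \<Rightarrow> bool" where
  "global_elt X x \<longleftrightarrow> (\<forall>j. x j \<in> stg X j \<and> res X j (x (Suc j)) = x j)"

lemma stg_box: "stg (box_obj X) i = {vtup UNIV x | x. global_elt X x}"
proof (intro equalityI subsetI)
  fix z assume "z \<in> stg (box_obj X) i"
  then obtain y where y: "z = vtup UNIV (\<lambda>i. y i vunit)" "y \<in> hom (one_obj :: 'a tree) X"
    by (auto simp: box_obj_def)
  have "y j vunit \<in> stg X j" and "res X j (y (Suc j) vunit) = y j vunit" for j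
    using hom_in[OF y(2), of vunit j] hom_res[OF y(2), of vunit j] by (simp_all add: one_obj_def)
  then have "global_elt X (\<lambda>i. y i vunit)"
    by (simp add: global_elt_def)
  with y(1) show "z \<in> {vtup UNIV x | x. global_elt X x}" by blast
next
  fix z assume "z \<in> {vtup UNIV x | x. global_elt X x}"
  then obtain x where x: "z = vtup UNIV x" "global_elt X x" by blast
  define y where "y i = (\<lambda>u\<in>{vunit :: 'a}. x i)" for i
  have "y \<in> hom one_obj X"
    using x(2) by (intro homI) (auto simp: y_def global_elt_def one_obj_def)
  moreover have "z = vtup UNIV (\<lambda>i. y i vunit)"
    by (simp add: x(1) y_def)
  ultimately show "z \<in> stg (box_obj X) i"
    unfolding box_obj_def by auto
qed

lemma res_box [simp]: "res (box_obj X) i x = x"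
  by (simp add: box_obj_def)

text \<open>Restrictions preserve the tag, so the tag at stage \<open>0\<close> fixes the tags at
  all stages. This is what allows \<open>boxplus_den\<close> to choose one side for the whole
  family.\<close>

lemma global_elt_sum:
  assumes "global_elt (sum_obj X Y) x"
  shows "(\<exists>a. global_elt X a \<and> x = (\<lambda>j. vinl (a j))) \<or> (\<exists>b. global_elt Y b \<and> x = (\<lambda>j. vinr (b j)))"
proof -
  have mem: "x j \<in> stg (sum_obj X Y) j" and nat: "res (sum_obj X Y) j (x (Suc j)) = x j" for j
    using assms by (auto simp: global_elt_def)
  show ?thesis
  proof (cases "\<exists>a. x 0 = vinl a")
    case True
    have "\<exists>a. x j = vinl a" for j
    proof (induction j)
      case (Suc j)
      then show ?case using nat[of j] mem[of "Suc j"] by auto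
    qed (use True in simp)
    then obtain a where a: "\<And>j. x j = vinl (a j)" by metis
    have "global_elt X a"
      unfolding global_elt_def
    proof
      fix j show "a j \<in> stg X j \<and> res X j (a (Suc j)) = a j"
        using mem[of j] nat[of j] by (auto simp: a)
    qed
    moreover have "x = (\<lambda>j. vinl (a j))" using a by auto
    ultimately show ?thesis by blast
  next
    case False
    then have 0: "\<exists>a. x 0 = vinr a" using mem[of 0] by auto
    have "\<exists>a. x j = vinr a" for j
    proof (induction j)
      case (Suc j)
      then show ?case using nat[of j] mem[of "Suc j"] by auto
    qed (use 0 in simp)
    then obtain a where a: "\<And>j. x j = vinr (a j)" by metis
    have "global_elt Y a"
      unfolding global_elt_def
    proof
      fix j show "a j \<in> stg Y j \<and> res Y j (a (Suc j)) = a j"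
        using mem[of j] nat[of j] by (auto simp: a)
    qed
    moreover have "x = (\<lambda>j. vinr (a j))" using a by auto
    ultimately show ?thesis by blast
  qed
qed

text \<open>The record type does not force restrictions to stay within the stages. Smallness is
  included because graphs code functions faithfully between small sets.\<close>

definition wf_tree :: "'v::set_universe tree \<Rightarrow> bool" where
  "wf_tree X \<longleftrightarrow> (\<forall>i. small (stg X i) \<and> res X i \<in> stg X (Suc i) \<rightarrow> stg X i)"

lemma wf_tree_small: "wf_tree X \<Longrightarrow> small (stg X i)"
  and wf_tree_res: "wf_tree X \<Longrightarrow> x \<in> stg X (Suc i) \<Longrightarrow> res X i x \<in> stg X i"
  by (auto simp: wf_tree_def)

section \<open>Elements of exponential objects\<close>

abbreviation exp_app :: "'v::set_universe \<Rightarrow> nat \<Rightarrow> 'v \<Rightarrow> 'v" where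
  "exp_app g j a \<equiv> vapp (vcomp g j) a"

lemma
  assumes g: "g \<in> stg (exp_obj X Y) i" and X: "wf_tree X" and Y: "wf_tree Y"
  shows exp_obj_eta: "g = vtup {..i} (\<lambda>j. vgraph (stg X j) (exp_app g j))"
    and exp_app_in: "j \<le> i \<Longrightarrow> a \<in> stg X j \<Longrightarrow> exp_app g j a \<in> stg Y j"
    and exp_app_res: "j < i \<Longrightarrow> a \<in> stg X (Suc j) \<Longrightarrow>
      exp_app g j (res X j a) = res Y j (exp_app g (Suc j) a)"
proof -
  obtain f where eq: "g = vtup {..i} (\<lambda>j. vgraph (stg X j) (f j))"
      and mem: "\<And>j. j \<le> i \<Longrightarrow> f j \<in> stg X j \<rightarrow> stg Y j"
      and nat: "\<forall>j<i. \<forall>x\<in>stg X (Suc j). f j (res X j x) = res Y j (f (Suc j) x)"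
    using g by (auto simp: exp_obj_def)
  \<comment> \<open>Whichever family \<open>f\<close> codes \<open>g\<close>, application recovers
    it on the stages, so all three claims can be read off from \<open>f\<close>.\<close>
  have app: "exp_app g j a = f j a" if "j \<le> i" "a \<in> stg X j" for j a
    using that by (simp add: eq vapp_vgraph[OF wf_tree_small[OF X] wf_tree_small[OF Y] mem])
  have "vtup {..i} (\<lambda>j. vgraph (stg X j) (f j)) = vtup {..i} (\<lambda>j. vgraph (stg X j) (exp_app g j))"
    by (intro vtup_cong vgraph_cong) (simp add: app)
  with eq show "g = vtup {..i} (\<lambda>j. vgraph (stg X j) (exp_app g j))" by simp
  show "exp_app g j a \<in> stg Y j" if "j \<le> i" "a \<in> stg X j"
    using mem that by (auto simp: app)
  show "exp_app g j (res X j a) = res Y j (exp_app g (Suc j) a)" if "j < i" "a \<in> stg X (Suc j)"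
    using that nat by (simp add: app wf_tree_res[OF X])
qed

lemma exp_obj_eqI:
  assumes "g \<in> stg (exp_obj X Y) i" "h \<in> stg (exp_obj X Y) i" "wf_tree X" "wf_tree Y"
    and eq: "\<And>j a. j \<le> i \<Longrightarrow> a \<in> stg X j \<Longrightarrow> exp_app g j a = exp_app h j a"
  shows "g = h"
proof -
  have "vtup {..i} (\<lambda>j. vgraph (stg X j) (exp_app g j)) =
        vtup {..i} (\<lambda>j. vgraph (stg X j) (exp_app h j))"
    by (intro vtup_cong vgraph_cong) (simp add: eq)
  then show ?thesis
    using exp_obj_eta[OF assms(1,3,4)] exp_obj_eta[OF assms(2,3,4)] by simp
qed

lemma exp_app_lam:
  assumes "wf_tree X" "wf_tree Y" "j \<le> i" "a \<in> stg X j" "f j \<in> stg X j \<rightarrow> stg Y j"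
  shows "exp_app (vtup {..i} (\<lambda>j. vgraph (stg X j) (f j))) j a = f j a"
  using assms(3,4) by (simp add: vapp_vgraph[OF wf_tree_small[OF assms(1)] wf_tree_small[OF assms(2)] assms(5)])

lemma exp_obj_lam_in:
  assumes "\<And>j a. j \<le> i \<Longrightarrow> a \<in> stg X j \<Longrightarrow> f j a \<in> stg Y j"
    and "\<And>j a. j < i \<Longrightarrow> a \<in> stg X (Suc j) \<Longrightarrow> f j (res X j a) = res Y j (f (Suc j) a)"
  shows "vtup {..i} (\<lambda>j. vgraph (stg X j) (f j)) \<in> stg (exp_obj X Y) i"
  using assms by (auto simp: exp_obj_def)

lemma vcomp_res_exp [simp]: "j \<le> i \<Longrightarrow> vcomp (res (exp_obj X Y) i g) j = vcomp g j"
  by (simp add: exp_obj_def)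

lemma res_exp_lam:
  "res (exp_obj X Y) i (vtup {..Suc i} g) = vtup {..i} g"
  by (auto simp: exp_obj_def intro!: vtup_cong)

lemma res_exp_in: "g \<in> stg (exp_obj X Y) (Suc i) \<Longrightarrow> res (exp_obj X Y) i g \<in> stg (exp_obj X Y) i"
proof -
  assume "g \<in> stg (exp_obj X Y) (Suc i)"
  then obtain f where "g = vtup {..Suc i} (\<lambda>j. vgraph (stg X j) (f j))"
      "\<forall>j\<le>Suc i. f j \<in> stg X j \<rightarrow> stg Y j"
      "\<forall>j<Suc i. \<forall>x\<in>stg X (Suc j). f j (res X j x) = res Y j (f (Suc j) x)"
    by (auto simp: exp_obj_def)
  then show ?thesis
    by (auto simp: res_exp_lam Pi_iff intro!: exp_obj_lam_in)
qed

lemma small_exp: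
  assumes "\<And>j. j \<le> i \<Longrightarrow> small (stg X j)" "\<And>j. j \<le> i \<Longrightarrow> small (stg Y j)"
  shows "small (stg (exp_obj X Y) i)"
proof (rule small_subset)
  \<comment> \<open>The empty default makes the family small at every index, although smallness is
    known only for the stages up to \<open>i\<close>.\<close>
  let ?Z = "\<lambda>j. if j \<le> i then {vgraph (stg X j) f | f. f \<in> stg X j \<rightarrow> stg Y j} else {}"
  show "small {vtup {..i} x | x. \<forall>j\<in>{..i}. x j \<in> ?Z j}"
  proof (rule small_vtup)
    show "small (?Z j)" for j
      using small_vgraph[OF assms] by (cases "j \<le> i") (simp_all add: small_finite)
  qed
  show "stg (exp_obj X Y) i \<subseteq> {vtup {..i} x | x. \<forall>j\<in>{..i}. x j \<in> ?Z j}"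
  proof
    fix g assume "g \<in> stg (exp_obj X Y) i"
    then obtain f where "g = vtup {..i} (\<lambda>j. vgraph (stg X j) (f j))"
        "\<forall>j\<le>i. f j \<in> stg X j \<rightarrow> stg Y j"
      by (auto simp: exp_obj_def)
    moreover from this(2) have "\<forall>j\<in>{..i}. vgraph (stg X j) (f j) \<in> ?Z j" by auto
    ultimately show "g \<in> {vtup {..i} x | x. \<forall>j\<in>{..i}. x j \<in> ?Z j}" by blast
  qed
qed

section \<open>Closed types\<close>

inductive_cases wft_TVarE: "wft n (TVar i)"
inductive_cases wft_TProdE [elim!]: "wft n (TProd A B)"
inductive_cases wft_TSumE [elim!]: "wft n (TSum A B)"
inductive_cases wft_TFunE [elim!]: "wft n (TFun A B)"
inductive_cases wft_TMuE: "wft n (TMu A)"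
inductive_cases wft_TLaterE [elim!]: "wft n (TLater A)"
inductive_cases wft_TBoxE [elim!]: "wft n (TBox A)"

lemma wft_mono: "wft n A \<Longrightarrow> n \<le> m \<Longrightarrow> wft m A"
  by (induction arbitrary: m rule: wft.induct) (auto intro: wft.intros)

lemma guarded_wft: "wft n A \<Longrightarrow> n \<le> k \<Longrightarrow> guarded k A"
  by (induction arbitrary: k rule: wft.induct) auto

lemma tlift_wft: "wft n A \<Longrightarrow> n \<le> k \<Longrightarrow> tlift k A = A"
  by (induction arbitrary: k rule: wft.induct) auto

lemma tsubst_wft: "wft n A \<Longrightarrow> n \<le> k \<Longrightarrow> tsubst k C A = A"
  by (induction arbitrary: k C rule: wft.induct) auto

lemma guarded_tsubst:
  "wft 0 C \<Longrightarrow> guarded l A \<Longrightarrow> l < k \<Longrightarrow> guarded l (tsubst k C A)"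
  by (induction A arbitrary: k l) (auto simp: tlift_wft intro: guarded_wft)

lemma wft_tsubst:
  "wft n A \<Longrightarrow> n = Suc k \<Longrightarrow> wft 0 C \<Longrightarrow> wft k (tsubst k C A)"
proof (induction arbitrary: k rule: wft.induct)
  case (1 i n)
  then show ?case by (auto intro: wft.intros wft_mono)
qed (auto simp: tlift_wft tsubst_wft intro: wft.intros guarded_tsubst)

lemma wft_unfold_mu: "wft 0 (TMu A) \<Longrightarrow> wft 0 (unfold_mu A)"
  by (auto elim: wft_TMuE intro: wft_tsubst)

lemma const_ty_tsubst: "wft 0 C \<Longrightarrow> const_ty C \<Longrightarrow> const_ty A \<Longrightarrow> const_ty (tsubst k C A)"
  by (induction A arbitrary: k) (auto simp: tlift_wft)

lemma const_ty_unfold_mu: "wft 0 (TMu A) \<Longrightarrow> const_ty (TMu A) \<Longrightarrow> const_ty (unfold_mu A)"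
  by (rule const_ty_tsubst) auto

section \<open>A well-founded order on closed types paired with stages\<close>

primrec box_depth :: "ty \<Rightarrow> nat" where
  "box_depth (TVar i) = 0"
| "box_depth TNat = 0"
| "box_depth TUnit = 0"
| "box_depth (TProd A B) = max (box_depth A) (box_depth B)"
| "box_depth TVoid = 0"
| "box_depth (TSum A B) = max (box_depth A) (box_depth B)"
| "box_depth (TFun A B) = max (box_depth A) (box_depth B)"
| "box_depth (TMu A) = box_depth A"
| "box_depth (TLater A) = box_depth A"
| "box_depth (TBox A) = Suc (box_depth A)"

text \<open>The size is cut off at \<open>TLater\<close> and \<open>TBox\<close> because passing
  beneath them already decreases the stage or the box depth. It therefore does not see the
  occurrences of a guarded variable.\<close>

primrec unguarded_size :: "ty \<Rightarrow> nat" where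
  "unguarded_size (TVar i) = 0"
| "unguarded_size TNat = 0"
| "unguarded_size TUnit = 0"
| "unguarded_size (TProd A B) = Suc (unguarded_size A + unguarded_size B)"
| "unguarded_size TVoid = 0"
| "unguarded_size (TSum A B) = Suc (unguarded_size A + unguarded_size B)"
| "unguarded_size (TFun A B) = Suc (unguarded_size A + unguarded_size B)"
| "unguarded_size (TMu A) = Suc (unguarded_size A)"
| "unguarded_size (TLater A) = 0"
| "unguarded_size (TBox A) = 0"

lemma box_depth_tsubst:
  "wft n A \<Longrightarrow> wft 0 C \<Longrightarrow> box_depth A \<le> d \<Longrightarrow> box_depth C \<le> d \<Longrightarrow>
   box_depth (tsubst k C A) \<le> d"
  by (induction arbitrary: k rule: wft.induct) (auto simp: tlift_wft tsubst_wft)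

lemma unguarded_size_tsubst:
  "guarded k A \<Longrightarrow> unguarded_size (tsubst k C A) = unguarded_size A"
  by (induction A arbitrary: k C) auto

text \<open>
  Unfolding a recursive type is decreasing because its variable is guarded, so it does not count
  for \<open>unguarded_size\<close>, and cannot occur beneath a box, so \<open>box_depth\<close> does not grow.
\<close>

definition ty_order :: "((ty \<times> nat) \<times> (ty \<times> nat)) set" where
  "ty_order = inv_image (less_than <*lex*> less_than <*lex*> less_than)
     (\<lambda>(A, i). (box_depth A, i, unguarded_size A))"

lemma wf_ty_order: "wf ty_order"
  unfolding ty_order_def by (intro wf_inv_image wf_lex_prod wf_less_than)

lemma ty_order_iff:
  "((A, i), (B, j)) \<in> ty_order \<longleftrightarrow> box_depth A < box_depth B \<or>
     box_depth A = box_depth B \<and> (i < j \<or> i = j \<and> unguarded_size A < unguarded_size B)"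
  by (simp add: ty_order_def)

lemma ty_order_unfold_mu:
  assumes "wft 0 (TMu A)"
  shows "((unfold_mu A, i), (TMu A, i)) \<in> ty_order"
proof -
  have "wft (Suc 0) A" "guarded 0 A" using assms by (auto elim: wft_TMuE)
  then show ?thesis
    using box_depth_tsubst[of "Suc 0" A "TMu A" "box_depth A" 0] assms
    by (auto simp: ty_order_iff unguarded_size_tsubst)
qed

text \<open>The hypotheses cover the stages at which a constructor looks at its components: all
  stages up to \<open>i\<close> for functions, which are tuples of maps; the earlier stages for
  \<open>TLater\<close>, which shifts; all stages for \<open>TBox\<close>, which collects global
  elements. Products and sums stay at stage \<open>i\<close> and descend in size, unless the box
  depth already drops.\<close>

lemma closed_ty_induct [consumes 1, case_names Nat Unit Void Prod Sum Fun Mu Later Box]: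
  fixes P :: "ty \<Rightarrow> nat \<Rightarrow> bool"
  assumes "wft 0 A"
    and "\<And>i. P TNat i" "\<And>i. P TUnit i" "\<And>i. P TVoid i"
    and "\<And>A B i. wft 0 A \<Longrightarrow> wft 0 B \<Longrightarrow> P A i \<Longrightarrow> P B i \<Longrightarrow> P (TProd A B) i"
    and "\<And>A B i. wft 0 A \<Longrightarrow> wft 0 B \<Longrightarrow> P A i \<Longrightarrow> P B i \<Longrightarrow> P (TSum A B) i"
    and "\<And>A B i. wft 0 A \<Longrightarrow> wft 0 B \<Longrightarrow> (\<And>j. j \<le> i \<Longrightarrow> P A j) \<Longrightarrow> (\<And>j. j \<le> i \<Longrightarrow> P B j) \<Longrightarrow>
           P (TFun A B) i"
    and "\<And>A i. wft 0 (TMu A) \<Longrightarrow> P (unfold_mu A) i \<Longrightarrow> P (TMu A) i"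
    and "\<And>A i. wft 0 A \<Longrightarrow> (\<And>j. j < i \<Longrightarrow> P A j) \<Longrightarrow> P (TLater A) i"
    and "\<And>A i. wft 0 A \<Longrightarrow> (\<And>j. P A j) \<Longrightarrow> P (TBox A) i"
  shows "P A i"
proof -
  have "wft 0 (fst p) \<longrightarrow> P (fst p) (snd p)" for p :: "ty \<times> nat"
  proof (induction p rule: wf_induct_rule[OF wf_ty_order])
    case (1 p)
    obtain A i where p: "p = (A, i)" by (cases p)
    have IH: "P B j" if "((B, j), (A, i)) \<in> ty_order" "wft 0 B" for B j
      using 1[of "(B, j)"] that by (simp add: p)
    show ?case
    proof
      assume "wft 0 (fst p)"
      then have wf: "wft 0 A" by (simp add: p)
      have "P A i"
      proof (cases A)
        case (TMu B)
        then show ?thesis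
          using assms(8) IH ty_order_unfold_mu wf wft_unfold_mu by blast
      next
        case (TVar k)
        then show ?thesis using wf by (auto elim: wft_TVarE)
      next
        case (TProd B C)
        then have "P B i" "P C i"
          using wf by (auto simp: ty_order_iff intro!: IH)
        then show ?thesis using wf assms(5) TProd by auto
      next
        case (TSum B C)
        then have "P B i" "P C i"
          using wf by (auto simp: ty_order_iff intro!: IH)
        then show ?thesis using wf assms(6) TSum by auto
      next
        case (TFun B C)
        then have "P B j" "P C j" if "j \<le> i" for j
          using wf that by (auto simp: ty_order_iff intro!: IH)
        then show ?thesis using wf assms(7) TFun by auto
      next
        case (TLater B)
        then have "P B j" if "j < i" for j
          using wf that by (auto simp: ty_order_iff intro!: IH)
        then show ?thesis using wf assms(9) TLater by auto
      next
        case (TBox B)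
        then have "P B j" for j
          using wf by (auto simp: ty_order_iff intro!: IH)
        then show ?thesis using wf assms(10) TBox by auto
      qed (simp_all add: assms(2-4))
      then show "P (fst p) (snd p)" by (simp add: p)
    qed
  qed
  from this[of "(A, i)"] assms(1) show ?thesis by simp
qed

section \<open>Closed types denote well-formed trees\<close>

lemma tden_simps [simp]:
  "tden TNat = nat_obj" "tden TUnit = one_obj" "tden TVoid = zero_obj"
  "tden (TProd A B) = prod_obj (tden A) (tden B)"
  "tden (TSum A B) = sum_obj (tden A) (tden B)"
  "tden (TFun A B) = exp_obj (tden A) (tden B)"
  "tden (TLater A) = later_obj (tden A)"
  "tden (TBox A) = box_obj (tden A)"
  by (simp_all add: tden_def)

text \<open>The step by which inductions over closed types treat \<open>TMu\<close>. It is not a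
  simplification rule, since the unfolding may contain \<open>TMu A\<close> again.\<close>

lemma tden_TMu: "wft 0 (TMu A) \<Longrightarrow> tden (TMu A) = tden (unfold_mu A)"
  by (simp add: tden_unfold_mu)

lemma small_tden: "wft 0 A \<Longrightarrow> small (stg (tden A :: 'v::set_universe tree) i)"
proof (induction A i rule: closed_ty_induct)
  case (Prod A B i)
  then show ?case by (simp add: small_vpair)
next
  case (Sum A B i)
  \<comment> \<open>Injections are pairs tagged by \<open>vnat 0\<close> or \<open>vnat 1\<close>,
    so a sum is bounded by a product with the numerals.\<close>
  let ?Z = "{vpair a b | a b. a \<in> range vnat \<and> b \<in> stg (tden A :: 'v tree) i \<union> stg (tden B) i}"
  have "small ?Z"
    by (intro small_vpair small_Un Sum small_countable) simp
  then show ?case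
    by (rule small_subset) (auto simp: vinl_def vinr_def simp del: vnat.simps)
next
  case (Fun A B i)
  then show ?case by (simp add: small_exp)
next
  case (Later A i)
  then show ?case by (cases i) (auto simp: small_finite)
next
  case (Box A i)
  then have "small {vtup UNIV x | x. \<forall>j\<in>UNIV. x j \<in> stg (tden A :: 'v tree) j}"
    by (intro small_vtup)
  then show ?case
    by (rule small_subset) (auto simp: stg_box global_elt_def)
next
  case (Mu A i)
  then show ?case by (simp only: tden_TMu)
qed (simp_all add: nat_obj_def one_obj_def zero_obj_def small_countable)

lemma res_tden_in:
  "wft 0 A \<Longrightarrow> res (tden A :: 'v::set_universe tree) i \<in> stg (tden A) (Suc i) \<rightarrow> stg (tden A) i"
proof (induction A i rule: closed_ty_induct)
  case (Prod A B i)
  then show ?case by (fastforce simp: Pi_iff)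
next
  case (Later A i)
  then show ?case by (cases i) auto
next
  case (Sum A B i)
  then show ?case by auto
next
  case (Mu A i)
  then show ?case by (simp only: tden_TMu)
next
  case (Fun A B i)
  then show ?case by (auto simp: res_exp_in)
next
  case (Box A i)
  then show ?case by (auto simp: stg_box)
qed (simp_all add: nat_obj_def one_obj_def zero_obj_def)

lemma wf_tree_tden: "wft 0 A \<Longrightarrow> wf_tree (tden A)"
  by (simp add: wf_tree_def small_tden res_tden_in)

section \<open>Constant trees and transport\<close>

lemma restr_self [simp]: "restr X i i x = x"
  by (cases i) auto

lemma restr_Suc: "i \<le> j \<Longrightarrow> restr X i (Suc j) x = restr X i j (res X j x)"
  by simp

declare restr.simps(2) [simp del]

text \<open>Separate from \<open>wf_tree\<close> because contexts denote trees of lists, for which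
  smallness has no meaning.\<close>

definition res_closed :: "'e tree \<Rightarrow> bool" where
  "res_closed X \<longleftrightarrow> (\<forall>i. res X i \<in> stg X (Suc i) \<rightarrow> stg X i)"

lemma res_closed_in: "res_closed X \<Longrightarrow> x \<in> stg X (Suc i) \<Longrightarrow> res X i x \<in> stg X i"
  by (auto simp: res_closed_def)

lemma restr_in: "res_closed X \<Longrightarrow> i \<le> j \<Longrightarrow> x \<in> stg X j \<Longrightarrow> restr X i j x \<in> stg X i"
proof (induction j arbitrary: x)
  case (Suc j)
  then show ?case by (cases "i = Suc j") (auto simp: restr_Suc res_closed_in)
qed simp

lemma res_restr: "i < j \<Longrightarrow> res X i (restr X (Suc i) j x) = restr X i j x"
proof (induction j arbitrary: x)
  case (Suc j)
  then show ?case by (cases "i = j") (auto simp: restr_Suc)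
qed simp

lemma restr_hom:
  "f \<in> hom X Y \<Longrightarrow> res_closed X \<Longrightarrow> i \<le> j \<Longrightarrow> x \<in> stg X j \<Longrightarrow>
   f i (restr X i j x) = restr Y i j (f j x)"
proof (induction j arbitrary: x)
  case (Suc j)
  then show ?case
    by (cases "i = Suc j") (auto simp: restr_Suc res_closed_in hom_res)
qed simp

lemma restr_global_elt: "global_elt X a \<Longrightarrow> i \<le> j \<Longrightarrow> restr X i j (a j) = a i"
proof (induction j)
  case (Suc j)
  then show ?case by (cases "i = Suc j") (auto simp: restr_Suc global_elt_def)
qed simp

definition const_tree :: "'e tree \<Rightarrow> bool" where
  "const_tree X \<longleftrightarrow> (\<forall>i. bij_betw (res X i) (stg X (Suc i)) (stg X i))"

lemma const_tree_res_closed: "const_tree X \<Longrightarrow> res_closed X"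
  by (auto simp: const_tree_def res_closed_def bij_betw_def)

lemma restr_bij:
  assumes "const_tree X" "i \<le> j"
  shows "bij_betw (restr X i j) (stg X j) (stg X i)"
  using assms(2)
proof (induction j)
  case 0
  then show ?case by (simp add: bij_betw_def inj_on_def)
next
  case (Suc j)
  show ?case
  proof (cases "i = Suc j")
    case True
    then show ?thesis by (simp add: bij_betw_def inj_on_def)
  next
    case False
    then have "i \<le> j" using Suc.prems by simp
    then have "bij_betw (restr X i j \<circ> res X j) (stg X (Suc j)) (stg X i)"
      using Suc.IH assms(1) by (auto simp: const_tree_def intro: bij_betw_trans)
    then show ?thesis
      by (rule bij_betw_cong[THEN iffD1, rotated]) (simp add: restr_Suc \<open>i \<le> j\<close>)
  qed
qed

text \<open>Upward transport is a description; injectivity of the composite restriction makes it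
  pick the only preimage.\<close>

lemma transport_eq:
  assumes X: "const_tree X" and y: "y \<in> stg X j" "restr X i j y = x" and "i \<le> j"
  shows "transport X i j x = y"
proof (cases "i = j")
  case False
  have "(THE z. z \<in> stg X j \<and> restr X i j z = x) = y"
    using y restr_bij[OF X \<open>i \<le> j\<close>] by (auto simp: bij_betw_def inj_on_def)
  with False \<open>i \<le> j\<close> show ?thesis by (simp add: transport_def)
qed (use y in \<open>simp add: transport_def\<close>)

lemma transport_up:
  assumes X: "const_tree X" and "i \<le> j" "x \<in> stg X i"
  shows "transport X i j x \<in> stg X j" "restr X i j (transport X i j x) = x"
proof -
  obtain y where "y \<in> stg X j" "restr X i j y = x"
    using restr_bij[OF assms(1,2)] assms(3) by (metis bij_betw_def imageE)
  then show "transport X i j x \<in> stg X j" "restr X i j (transport X i j x) = x"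
    using transport_eq[OF X _ _ assms(2)] by auto
qed

lemma transport_down: "j \<le> i \<Longrightarrow> transport X i j x = restr X j i x"
  by (simp add: transport_def)

lemma transport_in: "const_tree X \<Longrightarrow> x \<in> stg X i \<Longrightarrow> transport X i j x \<in> stg X j"
  by (cases "i \<le> j") (auto simp: transport_up transport_down restr_in const_tree_res_closed)

text \<open>Naturality in the source stage. For explicit substitutions it means that restricting the
  environment beforehand does not change the values.\<close>

lemma transport_res:
  assumes X: "const_tree X" and a: "a \<in> stg X (Suc i)"
  shows "transport X i j (res X i a) = transport X (Suc i) j a"
proof (cases "j \<le> i")
  case True
  then show ?thesis by (simp add: transport_down restr_Suc)
next
  case False
  then have ij: "Suc i \<le> j" by simp
  show ?thesis
  proof (rule transport_eq[OF X])
    show "transport X (Suc i) j a \<in> stg X j" by (rule transport_in[OF X a])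
    show "restr X i j (transport X (Suc i) j a) = res X i a"
      using res_restr[of i j X "transport X (Suc i) j a"] transport_up(2)[OF X ij a] ij by simp
  qed (use ij in simp)
qed

text \<open>Naturality in the target stage: the transports of one element to all stages form a
  global element.\<close>

lemma res_transport:
  assumes X: "const_tree X" and x: "x \<in> stg X i"
  shows "res X j (transport X i (Suc j) x) = transport X i j x"
proof (cases "i \<le> j")
  case True
  then have "transport X i j x = res X j (transport X i (Suc j) x)"
    using transport_up[OF X _ x, of "Suc j"]
    by (intro transport_eq[OF X]) (auto simp: restr_Suc res_closed_in const_tree_res_closed[OF X])
  then show ?thesis by simp
next
  case False
  then show ?thesis by (simp add: transport_down res_restr)
qed

lemma transport_global_elt:
  assumes "const_tree X" "global_elt X a"
  shows "transport X i j (a i) = a j"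
proof (cases "i \<le> j")
  case True
  then show ?thesis
    using assms(2) by (intro transport_eq[OF assms(1)]) (auto simp: restr_global_elt global_elt_def)
next
  case False
  then show ?thesis using assms by (simp add: transport_down restr_global_elt)
qed

text \<open>A tuple of functions satisfies \<open>f i (res X i a) = res Y i (f (Suc i) a)\<close>.
  As \<open>res Y i\<close> is invertible, the component at \<open>Suc i\<close> is forced by the
  one at \<open>i\<close>, and can always be supplied.\<close>

lemma bij_betw_res_exp:
  assumes X: "wf_tree X" "bij_betw (res X i) (stg X (Suc i)) (stg X i)"
    and Y: "wf_tree Y" "bij_betw (res Y i) (stg Y (Suc i)) (stg Y i)"
  shows "bij_betw (res (exp_obj X Y) i) (stg (exp_obj X Y) (Suc i)) (stg (exp_obj X Y) i)"
  unfolding bij_betw_def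
proof
  show "inj_on (res (exp_obj X Y) i) (stg (exp_obj X Y) (Suc i))"
  proof (rule inj_onI)
    fix g h assume g: "g \<in> stg (exp_obj X Y) (Suc i)" and h: "h \<in> stg (exp_obj X Y) (Suc i)"
      and eq: "res (exp_obj X Y) i g = res (exp_obj X Y) i h"
    have low: "vcomp g j = vcomp h j" if "j \<le> i" for j
      using arg_cong[OF eq, of "\<lambda>z. vcomp z j"] that by simp
    show "g = h"
    proof (rule exp_obj_eqI[OF g h X(1) Y(1)])
      fix j a assume j: "j \<le> Suc i" and a: "a \<in> stg X j"
      show "exp_app g j a = exp_app h j a"
      proof (cases "j = Suc i")
        case True
        have "res Y i (exp_app g (Suc i) a) = res Y i (exp_app h (Suc i) a)"
          using exp_app_res[OF g X(1) Y(1), of i a] exp_app_res[OF h X(1) Y(1), of i a] a True low[of i]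
          by simp
        then show ?thesis
          using Y(2) a True exp_app_in[OF g X(1) Y(1), of "Suc i" a]
            exp_app_in[OF h X(1) Y(1), of "Suc i" a]
          by (auto simp: bij_betw_def inj_on_def)
      qed (use j low in simp)
    qed
  qed
  show "res (exp_obj X Y) i ` stg (exp_obj X Y) (Suc i) = stg (exp_obj X Y) i"
  proof (intro equalityI subsetI)
    fix g assume g: "g \<in> stg (exp_obj X Y) i"
    \<comment> \<open>The new component at \<open>Suc i\<close> is the last one of \<open>g\<close>,
      pulled back along \<open>res Y i\<close>.\<close>
    define f where "f j = (if j \<le> i then exp_app g j else
      (\<lambda>a. inv_into (stg Y (Suc i)) (res Y i) (exp_app g i (res X i a))))" for j
    have top: "f (Suc i) a \<in> stg Y (Suc i)" "res Y i (f (Suc i) a) = exp_app g i (res X i a)"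
      if "a \<in> stg X (Suc i)" for a
    proof -
      have "exp_app g i (res X i a) \<in> res Y i ` stg Y (Suc i)"
        using exp_app_in[OF g X(1) Y(1), of i "res X i a"] wf_tree_res[OF X(1) that] Y(2)
        by (simp add: bij_betw_def)
      then show "f (Suc i) a \<in> stg Y (Suc i)" "res Y i (f (Suc i) a) = exp_app g i (res X i a)"
        by (simp_all add: f_def inv_into_into f_inv_into_f)
    qed
    let ?h = "vtup {..Suc i} (\<lambda>j. vgraph (stg X j) (f j))"
    have "?h \<in> stg (exp_obj X Y) (Suc i)"
    proof (rule exp_obj_lam_in)
      show "f j a \<in> stg Y j" if "j \<le> Suc i" "a \<in> stg X j" for j a
        using that top(1) exp_app_in[OF g X(1) Y(1)] by (cases "j = Suc i") (auto simp: f_def)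
      show "f j (res X j a) = res Y j (f (Suc j) a)" if "j < Suc i" "a \<in> stg X (Suc j)" for j a
      proof (cases "j = i")
        case True
        then show ?thesis using top(2) that by (simp add: f_def)
      next
        case False
        then show ?thesis using that exp_app_res[OF g X(1) Y(1)] by (simp add: f_def)
      qed
    qed
    moreover have "res (exp_obj X Y) i ?h = g"
    proof -
      have "vtup {..i} (\<lambda>j. vgraph (stg X j) (f j)) = vtup {..i} (\<lambda>j. vgraph (stg X j) (exp_app g j))"
        by (intro vtup_cong vgraph_cong) (simp add: f_def)
      then show ?thesis
        using exp_obj_eta[OF g X(1) Y(1)] by (simp add: res_exp_lam)
    qed
    ultimately show "g \<in> res (exp_obj X Y) i ` stg (exp_obj X Y) (Suc i)" by force
  qed (auto simp: res_exp_in)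
qed

text \<open>In a constant type no \<open>TLater\<close> occurs outside a box, and
  \<open>TBox\<close> is constant whatever lies beneath it, so only constructors that preserve
  invertibility of the restrictions remain.\<close>

lemma bij_betw_res_tden:
  "wft 0 A \<Longrightarrow> const_ty A \<Longrightarrow>
   bij_betw (res (tden A :: 'v::set_universe tree) i) (stg (tden A) (Suc i)) (stg (tden A) i)"
proof (induction A i rule: closed_ty_induct)
  case (Prod A B i)
  then have *: "bij_betw (res (tden A :: 'v tree) i) (stg (tden A) (Suc i)) (stg (tden A) i)"
    "bij_betw (res (tden B :: 'v tree) i) (stg (tden B) (Suc i)) (stg (tden B) i)"
    by auto
  show ?case
    unfolding bij_betw_def
  proof
    show "inj_on (res (tden (TProd A B)) i) (stg (tden (TProd A B) :: 'v tree) (Suc i))"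
      using *[THEN bij_betw_imp_inj_on] by (intro inj_onI) (auto dest: inj_onD)
    show "res (tden (TProd A B)) i ` stg (tden (TProd A B) :: 'v tree) (Suc i) = stg (tden (TProd A B)) i"
    proof (intro equalityI subsetI)
      fix z :: 'v assume "z \<in> stg (tden (TProd A B)) i"
      then obtain a b where z: "z = vpair a b" "a \<in> stg (tden A) i" "b \<in> stg (tden B) i"
        by auto
      have "a \<in> res (tden A) i ` stg (tden A) (Suc i)" "b \<in> res (tden B) i ` stg (tden B) (Suc i)"
        using * z by (simp_all add: bij_betw_def)
      then obtain a' b' where "a' \<in> stg (tden A) (Suc i)" "a = res (tden A) i a'"
          "b' \<in> stg (tden B) (Suc i)" "b = res (tden B) i b'"
        by blast
      then show "z \<in> res (tden (TProd A B)) i ` stg (tden (TProd A B)) (Suc i)"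
        by (intro image_eqI[of _ _ "vpair a' b'"]) (auto simp: z)
    qed (auto intro: bij_betw_apply[OF *(1)] bij_betw_apply[OF *(2)])
  qed
next
  case (Sum A B i)
  then have *: "bij_betw (res (tden A :: 'v tree) i) (stg (tden A) (Suc i)) (stg (tden A) i)"
    "bij_betw (res (tden B :: 'v tree) i) (stg (tden B) (Suc i)) (stg (tden B) i)"
    by auto
  show ?case
    unfolding bij_betw_def
  proof
    show "inj_on (res (tden (TSum A B)) i) (stg (tden (TSum A B) :: 'v tree) (Suc i))"
      using *[THEN bij_betw_imp_inj_on] by (intro inj_onI) (auto dest: inj_onD)
    show "res (tden (TSum A B)) i ` stg (tden (TSum A B) :: 'v tree) (Suc i) = stg (tden (TSum A B)) i"
      by (simp only: tden_simps stg_sum image_Un image_image res_sum *[THEN bij_betw_imp_surj_on, symmetric])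

  qed
next
  case (Fun A B i)
  then show ?case by (simp add: bij_betw_res_exp wf_tree_tden)
next
  case (Mu A i)
  then show ?case
    using const_ty_unfold_mu[OF Mu(1,3)] by (simp only: tden_TMu[OF Mu(1)])
next
  case (Box A i)
  then show ?case by (simp add: bij_betw_def inj_on_def stg_box)
qed (simp_all add: nat_obj_def one_obj_def zero_obj_def bij_betw_def inj_on_def)

lemma const_tree_tden: "wft 0 A \<Longrightarrow> const_ty A \<Longrightarrow> const_tree (tden A)"
  by (simp add: const_tree_def bij_betw_res_tden)

section \<open>A logical relation between types\<close>

text \<open>
  Types with distinct head constructors are unrelated: two derivations for the same term agree on
  the head constructor wherever a typing rule inspects or determines it.
\<close>

function rel :: "ty \<Rightarrow> ty \<Rightarrow> nat \<Rightarrow> 'v::set_universe \<Rightarrow> 'v \<Rightarrow> bool" where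
  "rel (TVar k) B i x y \<longleftrightarrow> False"
| "rel TNat B i x y \<longleftrightarrow> B = TNat \<and> x = y"
| "rel TUnit B i x y \<longleftrightarrow> B = TUnit \<and> x = y"
| "rel (TProd A1 A2) B i x y \<longleftrightarrow> (\<exists>B1 B2. B = TProd B1 B2 \<and>
     rel A1 B1 i (vfst x) (vfst y) \<and> rel A2 B2 i (vsnd x) (vsnd y))"
| "rel TVoid B i x y \<longleftrightarrow> B = TVoid \<and> x = y"
| "rel (TSum A1 A2) B i x y \<longleftrightarrow> (\<exists>B1 B2. B = TSum B1 B2 \<and>
     ((\<exists>a b. x = vinl a \<and> y = vinl b \<and> rel A1 B1 i a b) \<or>
      (\<exists>a b. x = vinr a \<and> y = vinr b \<and> rel A2 B2 i a b)))"
| "rel (TFun A1 A2) B i x y \<longleftrightarrow> (\<exists>B1 B2. B = TFun B1 B2 \<and>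
     (\<forall>j\<in>{..i}. \<forall>a\<in>stg (tden A1) j. \<forall>b\<in>stg (tden B1) j.
        rel A1 B1 j a b \<longrightarrow> rel A2 B2 j (exp_app x j a) (exp_app y j b)))"
| "rel (TMu A) B i x y \<longleftrightarrow>
     (if wft 0 (TMu A) then \<exists>B'. B = TMu B' \<and> rel (unfold_mu A) (unfold_mu B') i x y else False)"
| "rel (TLater A) B i x y \<longleftrightarrow>
     (\<exists>B'. B = TLater B' \<and> (case i of 0 \<Rightarrow> x = y | Suc j \<Rightarrow> rel A B' j x y))"
| "rel (TBox A) B i x y \<longleftrightarrow> (\<exists>B'. B = TBox B' \<and> (\<forall>j. rel A B' j (vcomp x j) (vcomp y j)))"
  by pat_completeness auto
text \<open>The order concerns the first type and the stage only. The conditional for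
  \<open>TMu\<close> and the bounded quantifier over \<open>{..i}\<close> hand well-formedness and
  \<open>j \<le> i\<close> to the termination conditions.\<close>

termination
  by (relation "inv_image ty_order (\<lambda>(A, B, i, x, y). (A, i))")
    (simp_all add: wf_ty_order ty_order_unfold_mu, auto simp: ty_order_iff)

declare rel.simps(8) [simp del]

lemma rel_TMu: "wft 0 (TMu A) \<Longrightarrow> rel (TMu A) (TMu B) i x y \<longleftrightarrow> rel (unfold_mu A) (unfold_mu B) i x y"
  by (simp add: rel.simps(8))

lemma rel_TMuE:
  assumes "rel (TMu A) B i x y"
  obtains B' where "B = TMu B'" "rel (unfold_mu A) (unfold_mu B') i x y"
  using assms by (auto simp: rel.simps(8) split: if_splits)

lemma vtup_UNIV_eq_iff: "vtup UNIV a = vtup UNIV b \<longleftrightarrow> (\<forall>j. a j = b j)"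
proof
  assume "vtup UNIV a = vtup UNIV b"
  then have "vcomp (vtup UNIV a) j = vcomp (vtup UNIV b) j" for j by simp
  then show "\<forall>j. a j = b j" by simp
qed (auto intro: vtup_cong)

text \<open>By the induction hypotheses, relatedness at a function type becomes pointwise equality
  at all stages up to \<open>i\<close>, and exponentials are extensional. Membership in the stages
  matters: other codes need not be determined by their components.\<close>

lemma rel_same:
  "wft 0 A \<Longrightarrow> x \<in> stg (tden A) i \<Longrightarrow> y \<in> stg (tden A) i \<Longrightarrow> rel A A i x y \<longleftrightarrow> x = y"
proof (induction A i arbitrary: x y rule: closed_ty_induct)
  case (Fun A B i)
  note wf = wf_tree_tden[OF Fun(1)] wf_tree_tden[OF Fun(2)]
  note x = Fun.prems(1)[unfolded tden_simps] and y = Fun.prems(2)[unfolded tden_simps]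
  have "rel (TFun A B) (TFun A B) i x y \<longleftrightarrow>
      (\<forall>j\<le>i. \<forall>a\<in>stg (tden A) j. exp_app x j a = exp_app y j a)"
    by (auto simp: Fun.IH exp_app_in[OF x wf] exp_app_in[OF y wf])
  also have "\<dots> \<longleftrightarrow> x = y"
    using exp_obj_eqI[OF x y wf] by auto
  finally show ?case .
next
  case (Mu A i)
  then show ?case by (simp only: rel_TMu tden_TMu)
next
  case (Later A i)
  then show ?case by (cases i) auto
next
  case (Box A i)
  then obtain a b where "x = vtup UNIV a" "global_elt (tden A) a" "y = vtup UNIV b" "global_elt (tden A) b"
    by (auto simp: stg_box)
  then show ?case
    by (auto simp: Box.IH global_elt_def vtup_UNIV_eq_iff)
qed auto

text \<open>The relation is of Kripke style: its function clause quantifies over all earlier stages,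
  so that restriction merely drops a condition.\<close>

lemma rel_res:
  fixes x y :: "'v::set_universe"
  assumes "wft 0 A" "wft 0 B" "x \<in> stg (tden A) (Suc i)" "y \<in> stg (tden B) (Suc i)"
    "rel A B (Suc i) x y"
  shows "rel A B i (res (tden A) i x) (res (tden B) i y)"
  using assms
proof (induction A i arbitrary: B x y rule: closed_ty_induct)
  case (Sum A1 A2 i)
  then show ?case by fastforce
next
  case (Prod A1 A2 i)
  then show ?case by fastforce
next
  case (Mu A i)
  from Mu.prems(4) obtain B' where B: "B = TMu B'" "rel (unfold_mu A) (unfold_mu B') (Suc i) x y"
    by (rule rel_TMuE)
  then have wf: "wft 0 (TMu B')" using Mu.prems(1) by simp
  show ?case
    using Mu.prems Mu.IH[OF wft_unfold_mu[OF wf] _ _ B(2)]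
    by (simp add: B(1) rel_TMu[OF Mu(1)] tden_TMu[OF Mu(1)] tden_TMu[OF wf])
next
  case (Later A i)
  then show ?case by (cases i) auto
qed (auto simp: nat_obj_def one_obj_def zero_obj_def)

lemma rel_restr:
  "wft 0 A \<Longrightarrow> wft 0 B \<Longrightarrow> i \<le> j \<Longrightarrow> x \<in> stg (tden A) j \<Longrightarrow> y \<in> stg (tden B) j \<Longrightarrow>
   rel A B j x y \<Longrightarrow> rel A B i (restr (tden A) i j x) (restr (tden B) i j y)"
proof (induction j arbitrary: x y)
  case (Suc j)
  then show ?case
    by (cases "i = Suc j") (auto simp: restr_Suc wf_tree_tden wf_tree_res rel_res)
qed simp

text \<open>Restriction loses no information at constant types, whereas at \<open>TLater\<close> the
  passage to stage \<open>0\<close> forgets everything. For functions the new obligation is at the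
  top stage: the arguments are restricted, the results are related one stage lower, and the
  hypothesis for the codomain lifts this back.\<close>

lemma rel_res_const:
  fixes x y :: "'v::set_universe"
  assumes "wft 0 A" "wft 0 B" "const_ty A" "const_ty B"
    "x \<in> stg (tden A) (Suc i)" "y \<in> stg (tden B) (Suc i)"
    "rel A B i (res (tden A) i x) (res (tden B) i y)"
  shows "rel A B (Suc i) x y"
  using assms
proof (induction A i arbitrary: B x y rule: closed_ty_induct)
  case (Sum A1 A2 i)
  then show ?case by fastforce
next
  case (Prod A1 A2 i)
  then show ?case by fastforce
next
  case (Fun A1 A2 i)
  then obtain B1 B2 where B: "B = TFun B1 B2" by auto
  have wfA: "wf_tree (tden A1 :: 'v tree)" "wf_tree (tden A2 :: 'v tree)"
    and wfB: "wf_tree (tden B1 :: 'v tree)" "wf_tree (tden B2 :: 'v tree)"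
    and wft: "wft 0 B1" "wft 0 B2" and const: "const_ty A1" "const_ty A2" "const_ty B1" "const_ty B2"
    using Fun B by (auto intro: wf_tree_tden)
  have x: "x \<in> stg (exp_obj (tden A1) (tden A2)) (Suc i)" and y: "y \<in> stg (exp_obj (tden B1) (tden B2)) (Suc i)"
    using Fun.prems B by auto
  have low: "rel A2 B2 j (exp_app x j a) (exp_app y j b)"
    if "j \<le> i" "a \<in> stg (tden A1) j" "b \<in> stg (tden B1) j" "rel A1 B1 j a b" for j a b
    using Fun.prems(6) that by (auto simp: B)
  have "rel A2 B2 j (exp_app x j a) (exp_app y j b)"
    if j: "j \<le> Suc i" and a: "a \<in> stg (tden A1) j" and b: "b \<in> stg (tden B1) j"
      and ab: "rel A1 B1 j a b" for j a b
  proof (cases "j = Suc i")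
    case True
    have "rel A2 B2 i (exp_app x i (res (tden A1) i a)) (exp_app y i (res (tden B1) i b))"
      using a b ab True Fun(1) wft by (intro low rel_res) (auto intro: wf_tree_res wfA wfB)
    then show ?thesis
      using a b True exp_app_in[OF x wfA] exp_app_in[OF y wfB]
        exp_app_res[OF x wfA] exp_app_res[OF y wfB] wft const
      by (auto intro!: Fun.IH(2))
  qed (use low[OF _ a b ab] j in simp)
  then show ?case by (simp add: B)
next
  case (Mu A i)
  from Mu.prems(6) obtain B' where
    B: "B = TMu B'" "rel (unfold_mu A) (unfold_mu B') i (res (tden (TMu A)) i x) (res (tden B) i y)"
    by (rule rel_TMuE)
  then have wf: "wft 0 (TMu B')" using Mu.prems(1) by simp
  have "rel (unfold_mu A) (unfold_mu B') (Suc i) x y"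
    by (rule Mu.IH)
      (use Mu.prems Mu(1) wf B in \<open>simp_all add: wft_unfold_mu const_ty_unfold_mu flip: tden_TMu\<close>)
  then show ?case by (simp add: B(1) rel_TMu[OF Mu(1)])
qed (auto simp: nat_obj_def one_obj_def zero_obj_def)

lemma rel_restr_const:
  "wft 0 A \<Longrightarrow> wft 0 B \<Longrightarrow> const_ty A \<Longrightarrow> const_ty B \<Longrightarrow> i \<le> j \<Longrightarrow>
   x \<in> stg (tden A) j \<Longrightarrow> y \<in> stg (tden B) j \<Longrightarrow>
   rel A B i (restr (tden A) i j x) (restr (tden B) i j y) \<Longrightarrow> rel A B j x y"
proof (induction j arbitrary: x y)
  case (Suc j)
  show ?case
  proof (cases "i = Suc j")
    case False
    then have "rel A B j (res (tden A) j x) (res (tden B) j y)"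
      using Suc.prems by (intro Suc.IH) (auto simp: restr_Suc wf_tree_tden wf_tree_res)
    then show ?thesis using Suc.prems by (intro rel_res_const) auto
  qed (use Suc in simp)
qed simp

lemma rel_transport:
  assumes "wft 0 A" "wft 0 B" "const_ty A" "const_ty B"
    "x \<in> stg (tden A) i" "y \<in> stg (tden B) i" "rel A B i x y"
  shows "rel A B j (transport (tden A) i j x) (transport (tden B) i j y)"
proof (cases "i \<le> j")
  case True
  then show ?thesis
    using assms by (intro rel_restr_const[of A B i j]) (auto simp: transport_up const_tree_tden)
next
  case False
  then show ?thesis using assms by (simp add: transport_down rel_restr)
qed

section \<open>Denotations are morphisms\<close>

definition wf_ctx :: "ty list \<Rightarrow> bool" where
  "wf_ctx \<Gamma> \<longleftrightarrow> (\<forall>k<length \<Gamma>. wft 0 (\<Gamma> ! k))"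

lemma wf_ctx_nth: "wf_ctx \<Gamma> \<Longrightarrow> k < length \<Gamma> \<Longrightarrow> wft 0 (\<Gamma> ! k)"
  by (simp add: wf_ctx_def)

lemma wf_ctx_Nil [simp]: "wf_ctx []"
  by (simp add: wf_ctx_def)

lemma wf_ctx_Cons [simp]: "wf_ctx (A # \<Gamma>) \<longleftrightarrow> wft 0 A \<and> wf_ctx \<Gamma>"
  by (auto simp: wf_ctx_def nth_Cons split: nat.splits)

lemma ctx_den_iff:
  "\<gamma> \<in> stg (ctx_den \<Gamma>) i \<longleftrightarrow> length \<gamma> = length \<Gamma> \<and> (\<forall>k<length \<Gamma>. \<gamma> ! k \<in> stg (tden (\<Gamma> ! k)) i)"
  by (simp add: ctx_den_def)

lemma ctx_den_Nil [simp]: "stg (ctx_den []) i = {[]}" "res (ctx_den []) i \<gamma> = []"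
  by (auto simp: ctx_den_def)

lemma ctx_den_Cons [simp]:
  "a # \<gamma> \<in> stg (ctx_den (A # \<Gamma>)) i \<longleftrightarrow> a \<in> stg (tden A) i \<and> \<gamma> \<in> stg (ctx_den \<Gamma>) i"
  "res (ctx_den (A # \<Gamma>)) i (a # \<gamma>) = res (tden A) i a # res (ctx_den \<Gamma>) i \<gamma>"
  by (auto simp: ctx_den_def nth_Cons split: nat.splits)

lemma res_ctx_nth:
  "length \<gamma> = length \<Gamma> \<Longrightarrow> k < length \<Gamma> \<Longrightarrow> res (ctx_den \<Gamma>) i \<gamma> ! k = res (tden (\<Gamma> ! k)) i (\<gamma> ! k)"
  by (simp add: ctx_den_def)

lemma length_res_ctx: "length \<gamma> = length \<Gamma> \<Longrightarrow> length (res (ctx_den \<Gamma>) i \<gamma>) = length \<Gamma>"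
  by (simp add: ctx_den_def)

lemma res_closed_ctx: "wf_ctx \<Gamma> \<Longrightarrow> res_closed (ctx_den \<Gamma>)"
  unfolding res_closed_def
  by (auto simp: ctx_den_iff res_ctx_nth length_res_ctx wf_ctx_nth wf_tree_tden wf_tree_res)

lemma res_ctx_in: "wf_ctx \<Gamma> \<Longrightarrow> \<gamma> \<in> stg (ctx_den \<Gamma>) (Suc i) \<Longrightarrow> res (ctx_den \<Gamma>) i \<gamma> \<in> stg (ctx_den \<Gamma>) i"
  by (rule res_closed_in[OF res_closed_ctx])

lemma restr_ctx_in:
  "wf_ctx \<Gamma> \<Longrightarrow> \<gamma> \<in> stg (ctx_den \<Gamma>) j \<Longrightarrow> i \<le> j \<Longrightarrow> restr (ctx_den \<Gamma>) i j \<gamma> \<in> stg (ctx_den \<Gamma>) i"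
  by (rule restr_in[OF res_closed_ctx])

lemma restr_ctx_nth:
  "length \<gamma> = length \<Gamma> \<Longrightarrow> k < length \<Gamma> \<Longrightarrow> i \<le> j \<Longrightarrow>
   restr (ctx_den \<Gamma>) i j \<gamma> ! k = restr (tden (\<Gamma> ! k)) i j (\<gamma> ! k)"
proof (induction j arbitrary: \<gamma>)
  case (Suc j)
  then show ?case by (cases "i = Suc j") (auto simp: restr_Suc length_res_ctx res_ctx_nth)
qed simp

lemma arr_eq: "\<gamma> \<in> stg (ctx_den \<Gamma>) i \<Longrightarrow> arr \<Gamma> f i \<gamma> = f i \<gamma>"
  by (simp add: arr_def)

lemma arr_undefined: "\<gamma> \<notin> stg (ctx_den \<Gamma>) i \<Longrightarrow> arr \<Gamma> f i \<gamma> = undefined"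
  by (simp add: arr_def)

lemma arr_cong: "(\<And>i \<gamma>. \<gamma> \<in> stg (ctx_den \<Gamma>) i \<Longrightarrow> f i \<gamma> = g i \<gamma>) \<Longrightarrow> arr \<Gamma> f = arr \<Gamma> g"
  by (auto simp: arr_def fun_eq_iff restrict_def)

lemma arr_hom:
  assumes "wf_ctx \<Gamma>"
    and "\<And>i \<gamma>. \<gamma> \<in> stg (ctx_den \<Gamma>) i \<Longrightarrow> f i \<gamma> \<in> stg Y i"
    and "\<And>i \<gamma>. \<gamma> \<in> stg (ctx_den \<Gamma>) (Suc i) \<Longrightarrow> f i (res (ctx_den \<Gamma>) i \<gamma>) = res Y i (f (Suc i) \<gamma>)"
  shows "arr \<Gamma> f \<in> hom (ctx_den \<Gamma>) Y"
  by (rule homI) (simp_all add: arr_eq arr_undefined assms res_ctx_in)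

lemma arr_hom_eq: "f \<in> hom (ctx_den \<Gamma>) Y \<Longrightarrow> arr \<Gamma> f = f"
  by (auto simp: arr_def fun_eq_iff restrict_def hom_undefined)

section \<open>Semantics of explicit substitutions\<close>

definition const_sub :: "ty list \<Rightarrow> ty list \<Rightarrow> (nat \<Rightarrow> 'v::set_universe list \<Rightarrow> 'v) list \<Rightarrow> bool" where
  "const_sub \<Gamma> As fs \<longleftrightarrow> length fs = length As \<and>
     (\<forall>k<length As. const_ty (As ! k) \<and> wft 0 (As ! k) \<and> fs ! k \<in> hom (ctx_den \<Gamma>) (tden (As ! k)))"

lemma length_sub_den [simp]: "length (sub_den As fs i j \<gamma>) = min (length As) (length fs)"
  by (simp add: sub_den_def)

lemma sub_den_nth:
  "length fs = length As \<Longrightarrow> k < length As \<Longrightarrow>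
   sub_den As fs i j \<gamma> ! k = transport (tden (As ! k)) i j ((fs ! k) i \<gamma>)"
  by (simp add: sub_den_def)

lemma sub_den_Nil [simp]: "sub_den [] fs i j \<gamma> = []"
  by (simp add: sub_den_def)

lemma const_subD:
  assumes "const_sub \<Gamma> As fs"
  shows "length fs = length As"
    and "k < length As \<Longrightarrow> const_tree (tden (As ! k))"
    and "k < length As \<Longrightarrow> \<gamma> \<in> stg (ctx_den \<Gamma>) i \<Longrightarrow> (fs ! k) i \<gamma> \<in> stg (tden (As ! k)) i"
    and "k < length As \<Longrightarrow> \<gamma> \<in> stg (ctx_den \<Gamma>) (Suc i) \<Longrightarrow>
      (fs ! k) i (res (ctx_den \<Gamma>) i \<gamma>) = res (tden (As ! k)) i ((fs ! k) (Suc i) \<gamma>)"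
  using assms hom_in[of "fs ! k" "ctx_den \<Gamma>" "tden (As ! k)"]
    hom_res[of "fs ! k" "ctx_den \<Gamma>" "tden (As ! k)"]
  by (simp_all add: const_sub_def const_tree_tden)

lemma sub_den_in:
  assumes "const_sub \<Gamma> As fs" "\<gamma> \<in> stg (ctx_den \<Gamma>) i"
  shows "sub_den As fs i j \<gamma> \<in> stg (ctx_den As) j"
  using assms(2) by (simp add: ctx_den_iff[of _ As] const_subD[OF assms(1)] sub_den_nth transport_in)

lemma sub_den_res:
  assumes "const_sub \<Gamma> As fs" "\<gamma> \<in> stg (ctx_den \<Gamma>) (Suc i)"
  shows "sub_den As fs i j (res (ctx_den \<Gamma>) i \<gamma>) = sub_den As fs (Suc i) j \<gamma>"
  by (rule nth_equalityI)
    (simp_all add: assms(2) const_subD[OF assms(1)] sub_den_nth transport_res)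

lemma res_sub_den:
  assumes "const_sub \<Gamma> As fs" "\<gamma> \<in> stg (ctx_den \<Gamma>) i"
  shows "res (ctx_den As) j (sub_den As fs i (Suc j) \<gamma>) = sub_den As fs i j \<gamma>"
  by (rule nth_equalityI)
    (simp_all add: assms(2) const_subD[OF assms(1)] sub_den_nth length_res_ctx res_ctx_nth res_transport)

lemma boxplus_den_simps [simp]:
  "boxplus_den (\<lambda>j. vinl (a j)) = vinl (vtup UNIV a)"
  "boxplus_den (\<lambda>j. vinr (a j)) = vinr (vtup UNIV a)"
  by (simp_all add: boxplus_den_def)

lemma denotes_wft: "denotes \<Gamma> t A f \<Longrightarrow> wft 0 A"
  by (induction rule: denotes.induct) (auto intro: wft.intros wft_unfold_mu)

text \<open>The conjunct \<open>P\<close> stands for the induction hypotheses that accompany the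
  premises for \<open>ts\<close> in a rule induction on \<open>denotes\<close>.\<close>

lemma denotes_wf_ctx:
  "length As = n \<Longrightarrow> \<forall>k<n. denotes \<Gamma> (ts ! k) (As ! k) (fs ! k) \<and> P k \<Longrightarrow> wf_ctx As"
  by (auto simp: wf_ctx_def intro: denotes_wft)

text \<open>The types \<open>As\<close> being constant, an environment known at the single stage
  \<open>i\<close> can be moved to every stage compatibly with restriction. This makes the values of
  \<open>Box\<close> global elements.\<close>

lemma global_elt_hom_sub:
  assumes "f \<in> hom (ctx_den As) Y" "const_sub \<Gamma> As fs" "\<gamma> \<in> stg (ctx_den \<Gamma>) i"
  shows "global_elt Y (\<lambda>j. f j (sub_den As fs i j \<gamma>))"
  unfolding global_elt_def
proof (intro allI conjI)
  fix j
  show "f j (sub_den As fs i j \<gamma>) \<in> stg Y j"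
    by (intro hom_in[OF assms(1)] sub_den_in[OF assms(2,3)])
  show "res Y j (f (Suc j) (sub_den As fs i (Suc j) \<gamma>)) = f j (sub_den As fs i j \<gamma>)"
    using hom_res[OF assms(1) sub_den_in[OF assms(2,3)], of j] by (simp add: res_sub_den[OF assms(2,3)])
qed

lemma denotes_hom:
  "denotes \<Gamma> t A f \<Longrightarrow> wf_ctx \<Gamma> \<Longrightarrow> f \<in> hom (ctx_den \<Gamma>) (tden A :: 'v::set_universe tree)"
proof (induction rule: denotes.induct)
  case (1 k \<Gamma>)
  then show ?case
    by (intro arr_hom) (auto simp: ctx_den_iff res_ctx_nth)
next
  case (2 \<Gamma>)
  then show ?case by (intro arr_hom) (auto simp: nat_obj_def simp del: vnat.simps)
next
  case (3 \<Gamma> t f)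
  from 3 have f: "f \<in> hom (ctx_den \<Gamma>) nat_obj" by simp
  have "vsucc x \<in> range vnat" if "x \<in> range vnat" for x :: 'v
  proof -
    from that obtain n where "x = vnat n" by auto
    then have "vsucc x = vnat (Suc n)" by simp
    then show ?thesis by blast
  qed
  then show ?case
    using 3(3) hom_in[OF f] hom_res[OF f] by (intro arr_hom) (auto simp: nat_obj_def)
next
  case (4 \<Gamma>)
  then show ?case by (intro arr_hom) (auto simp: one_obj_def)
next
  case (5 \<Gamma> s A f t B g)
  then show ?case by (intro arr_hom) (auto simp: hom_in hom_res)
next
  case (6 \<Gamma> t A B f)
  then have f: "f \<in> hom (ctx_den \<Gamma>) (prod_obj (tden A) (tden B))" by simp
  show ?case
  proof (rule arr_hom[OF 6(3)])
    show "vfst (f i \<gamma>) \<in> stg (tden A) i" if "\<gamma> \<in> stg (ctx_den \<Gamma>) i" for i \<gamma>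
      using hom_in[OF f that] by auto
    show "vfst (f i (res (ctx_den \<Gamma>) i \<gamma>)) = res (tden A) i (vfst (f (Suc i) \<gamma>))"
      if "\<gamma> \<in> stg (ctx_den \<Gamma>) (Suc i)" for i \<gamma>
      using hom_in[OF f that] hom_res[OF f that] by auto
  qed
next
  case (7 \<Gamma> t A B f)
  then have f: "f \<in> hom (ctx_den \<Gamma>) (prod_obj (tden A) (tden B))" by simp
  show ?case
  proof (rule arr_hom[OF 7(3)])
    show "vsnd (f i \<gamma>) \<in> stg (tden B) i" if "\<gamma> \<in> stg (ctx_den \<Gamma>) i" for i \<gamma>
      using hom_in[OF f that] by auto
    show "vsnd (f i (res (ctx_den \<Gamma>) i \<gamma>)) = res (tden B) i (vsnd (f (Suc i) \<gamma>))"
      if "\<gamma> \<in> stg (ctx_den \<Gamma>) (Suc i)" for i \<gamma>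
      using hom_in[OF f that] hom_res[OF f that] by auto
  qed
next
  case (8 \<Gamma> t f A)
  then have f: "f \<in> hom (ctx_den \<Gamma>) zero_obj" by simp
  \<comment> \<open>An element of the context would yield an element of the void type at the same
    stage, so the context is empty at all stages.\<close>
  have "\<gamma> \<notin> stg (ctx_den \<Gamma>) i" for i and \<gamma> :: "'v list"
    using hom_in[OF f] by (auto simp: zero_obj_def)
  then show ?case using 8 by (intro arr_hom) auto
next
  case (9 \<Gamma> t A f B)
  then show ?case by (intro arr_hom) (auto simp: hom_in hom_res)
next
  case (10 \<Gamma> t B f A)
  then show ?case by (intro arr_hom) (auto simp: hom_in hom_res)
next
  case (11 \<Gamma> t A B f s1 C g s2 h)
  have "wft 0 A" "wft 0 B" using denotes_wft[OF 11(1)] by auto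
  then have f: "f \<in> hom (ctx_den \<Gamma>) (sum_obj (tden A) (tden B))"
    and g: "g \<in> hom (ctx_den (A # \<Gamma>)) (tden C)" and h: "h \<in> hom (ctx_den (B # \<Gamma>)) (tden C)"
    using 11 by auto
  let ?c = "\<lambda>i \<gamma>. vcase (\<lambda>a. g i (a # \<gamma>)) (\<lambda>b. h i (b # \<gamma>)) (f i \<gamma>)"
  show ?case
  proof (rule arr_hom[OF 11(7)])
    show "?c i \<gamma> \<in> stg (tden C) i" if "\<gamma> \<in> stg (ctx_den \<Gamma>) i" for i \<gamma>
      using hom_in[OF f that] that by (auto simp: hom_in[OF g] hom_in[OF h])
    show "?c i (res (ctx_den \<Gamma>) i \<gamma>) = res (tden C) i (?c (Suc i) \<gamma>)"
      if \<gamma>: "\<gamma> \<in> stg (ctx_den \<Gamma>) (Suc i)" for i \<gamma>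
    proof -
      consider a where "f (Suc i) \<gamma> = vinl a" "a \<in> stg (tden A) (Suc i)"
        | b where "f (Suc i) \<gamma> = vinr b" "b \<in> stg (tden B) (Suc i)"
        using hom_in[OF f \<gamma>] by auto
      then show ?thesis
      proof cases
        case 1
        then show ?thesis using hom_res[OF g, of "a # \<gamma>" i] \<gamma> by (simp add: hom_res[OF f \<gamma>])
      next
        case 2
        then show ?thesis using hom_res[OF h, of "b # \<gamma>" i] \<gamma> by (simp add: hom_res[OF f \<gamma>])
      qed
    qed
  qed
next
  case (12 A \<Gamma> t B f)
  then have f: "f \<in> hom (ctx_den (A # \<Gamma>)) (tden B)" by simp
  show ?case unfolding tden_simps
  proof (rule arr_hom[OF 12(4)])
    fix i and \<gamma> :: "'v list"
    assume \<gamma>: "\<gamma> \<in> stg (ctx_den \<Gamma>) i"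
    show "vtup {..i} (\<lambda>j. vgraph (stg (tden A) j) (\<lambda>a. f j (a # restr (ctx_den \<Gamma>) j i \<gamma>)))
        \<in> stg (exp_obj (tden A) (tden B)) i"
    proof (rule exp_obj_lam_in)
      show "f j (a # restr (ctx_den \<Gamma>) j i \<gamma>) \<in> stg (tden B) j"
        if "j \<le> i" "a \<in> stg (tden A) j" for j a
        using that \<gamma> 12(4) by (simp add: hom_in[OF f] restr_ctx_in)
      show "f j (res (tden A) j a # restr (ctx_den \<Gamma>) j i \<gamma>) =
          res (tden B) j (f (Suc j) (a # restr (ctx_den \<Gamma>) (Suc j) i \<gamma>))"
        if "j < i" "a \<in> stg (tden A) (Suc j)" for j a
        using that \<gamma> 12(4) hom_res[OF f, of "a # restr (ctx_den \<Gamma>) (Suc j) i \<gamma>" j]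
        by (simp add: restr_ctx_in res_restr)
    qed
  next
    fix i and \<gamma> :: "'v list"
    \<comment> \<open>For \<open>j \<le> i\<close> the restriction from \<open>Suc i\<close> to
      \<open>j\<close> passes through stage \<open>i\<close> anyway, so restricting the environment
      first changes nothing.\<close>
    show "vtup {..i} (\<lambda>j. vgraph (stg (tden A) j) (\<lambda>a. f j (a # restr (ctx_den \<Gamma>) j i (res (ctx_den \<Gamma>) i \<gamma>)))) =
      res (exp_obj (tden A) (tden B)) i
       (vtup {..Suc i} (\<lambda>j. vgraph (stg (tden A) j) (\<lambda>a. f j (a # restr (ctx_den \<Gamma>) j (Suc i) \<gamma>))))"
      unfolding res_exp_lam by (intro vtup_cong vgraph_cong) (simp add: restr_Suc)
  qed
next
  case (13 \<Gamma> s A B f t g)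
  have "wft 0 A" "wft 0 B" using denotes_wft[OF 13(1)] by auto
  note wf = this[THEN wf_tree_tden]
  have f: "f \<in> hom (ctx_den \<Gamma>) (exp_obj (tden A) (tden B))" and g: "g \<in> hom (ctx_den \<Gamma>) (tden A)"
    using 13 by auto
  show ?case
  proof (rule arr_hom[OF 13(5)])
    show "exp_app (f i \<gamma>) i (g i \<gamma>) \<in> stg (tden B) i" if "\<gamma> \<in> stg (ctx_den \<Gamma>) i" for i \<gamma>
      using exp_app_in[OF hom_in[OF f that] wf] hom_in[OF g that] by simp
    show "exp_app (f i (res (ctx_den \<Gamma>) i \<gamma>)) i (g i (res (ctx_den \<Gamma>) i \<gamma>)) =
        res (tden B) i (exp_app (f (Suc i) \<gamma>) (Suc i) (g (Suc i) \<gamma>))"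
      if "\<gamma> \<in> stg (ctx_den \<Gamma>) (Suc i)" for i \<gamma>
      using exp_app_res[OF hom_in[OF f that] wf] hom_in[OF g that]
      by (simp add: hom_res[OF f that] hom_res[OF g that])
  qed
next
  case (14 \<Gamma> t A f)
  then show ?case by (simp add: tden_TMu)
next
  case (15 \<Gamma> t A f)
  then show ?case using denotes_wft[OF 15(1)] by (simp add: tden_TMu)
next
  case (16 \<Gamma> t A f)
  then have f: "f \<in> hom (ctx_den \<Gamma>) (tden A)" by simp
  note wf = wf_tree_tden[OF denotes_wft[OF 16(1)]]
  show ?case unfolding tden_simps
  proof (rule arr_hom[OF 16(3)])
    show "next_map (tden A) i (f i \<gamma>) \<in> stg (later_obj (tden A)) i" if "\<gamma> \<in> stg (ctx_den \<Gamma>) i" for i \<gamma>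
      using hom_in[OF f that] by (cases i) (auto simp: next_map_def wf_tree_res[OF wf])
    show "next_map (tden A) i (f i (res (ctx_den \<Gamma>) i \<gamma>)) =
        res (later_obj (tden A)) i (next_map (tden A) (Suc i) (f (Suc i) \<gamma>))"
      if "\<gamma> \<in> stg (ctx_den \<Gamma>) (Suc i)" for i \<gamma>
      using hom_res[OF f that] by (cases i) (auto simp: next_map_def)
  qed
next
  case (17 As ts fs \<Gamma> t A f)
  have sub: "const_sub \<Gamma> As fs" using 17 by (auto simp: const_sub_def intro: denotes_wft)
  have "wf_ctx As" using 17(1,5) by (rule denotes_wf_ctx)
  then have f: "f \<in> hom (ctx_den As) (later_obj (tden A))" using 17 by simp
  show ?case
  proof (rule arr_hom[OF 17(7)])
    \<comment> \<open>Stage \<open>Suc i\<close> of a delayed object is stage \<open>i\<close> of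
      the object itself, so evaluation one stage higher lands in the right set.\<close>
    show "f (Suc i) (sub_den As fs i (Suc i) \<gamma>) \<in> stg (tden A) i" if "\<gamma> \<in> stg (ctx_den \<Gamma>) i" for i \<gamma>
      using hom_in[OF f sub_den_in[OF sub that, of "Suc i"]] by simp
    show "f (Suc i) (sub_den As fs i (Suc i) (res (ctx_den \<Gamma>) i \<gamma>)) =
        res (tden A) i (f (Suc (Suc i)) (sub_den As fs (Suc i) (Suc (Suc i)) \<gamma>))"
      if "\<gamma> \<in> stg (ctx_den \<Gamma>) (Suc i)" for i \<gamma>
      using hom_res[OF f sub_den_in[OF sub that, of "Suc (Suc i)"]]
      by (simp add: sub_den_res[OF sub that] res_sub_den[OF sub that])
  qed
next
  case (18 \<Gamma> s A B f t g)
  have "wft 0 A" "wft 0 B" using denotes_wft[OF 18(1)] by auto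
  note wf = this[THEN wf_tree_tden]
  have f: "f \<in> hom (ctx_den \<Gamma>) (later_obj (exp_obj (tden A) (tden B)))"
    and g: "g \<in> hom (ctx_den \<Gamma>) (later_obj (tden A))"
    using 18 by auto
  let ?h = "\<lambda>i \<gamma>. case i of 0 \<Rightarrow> vunit | Suc j \<Rightarrow> exp_app (f i \<gamma>) j (g i \<gamma>)"
  show ?case unfolding tden_simps
  proof (rule arr_hom[OF 18(5)])
    show "?h i \<gamma> \<in> stg (later_obj (tden B)) i" if "\<gamma> \<in> stg (ctx_den \<Gamma>) i" for i \<gamma>
      using exp_app_in[OF _ wf, of "f i \<gamma>"] hom_in[OF f that] hom_in[OF g that] by (cases i) auto
    show "?h i (res (ctx_den \<Gamma>) i \<gamma>) = res (later_obj (tden B)) i (?h (Suc i) \<gamma>)"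
      if "\<gamma> \<in> stg (ctx_den \<Gamma>) (Suc i)" for i \<gamma>
    proof (cases i)
      case (Suc n)
      then have "f (Suc i) \<gamma> \<in> stg (exp_obj (tden A) (tden B)) (Suc n)" "g (Suc i) \<gamma> \<in> stg (tden A) (Suc n)"
        using hom_in[OF f that] hom_in[OF g that] by simp_all
      then show ?thesis
        using exp_app_res[OF _ wf, of "f (Suc i) \<gamma>" "Suc n" n "g (Suc i) \<gamma>"]
          hom_res[OF f that] hom_res[OF g that]
        by (simp add: Suc)
    qed simp
  qed
next
  case (19 As ts fs \<Gamma> t A f)
  have sub: "const_sub \<Gamma> As fs" using 19 by (auto simp: const_sub_def intro: denotes_wft)
  have "wf_ctx As" using 19(1,5) by (rule denotes_wf_ctx)
  then have f: "f \<in> hom (ctx_den As) (tden A)" using 19 by simp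
  show ?case unfolding tden_simps
  proof (rule arr_hom[OF 19(7)])
    show "vtup UNIV (\<lambda>j. f j (sub_den As fs i j \<gamma>)) \<in> stg (box_obj (tden A)) i"
      if "\<gamma> \<in> stg (ctx_den \<Gamma>) i" for i \<gamma>
      using global_elt_hom_sub[OF f sub that] by (auto simp: stg_box)
  qed (simp add: sub_den_res[OF sub])
next
  case (20 \<Gamma> t A f)
  then have f: "f \<in> hom (ctx_den \<Gamma>) (box_obj (tden A))" by simp
  show ?case
  proof (rule arr_hom[OF 20(3)])
    show "unbox_map i (f i \<gamma>) \<in> stg (tden A) i" if "\<gamma> \<in> stg (ctx_den \<Gamma>) i" for i \<gamma>
      using hom_in[OF f that] by (auto simp: stg_box unbox_map_def global_elt_def)
    show "unbox_map i (f i (res (ctx_den \<Gamma>) i \<gamma>)) = res (tden A) i (unbox_map (Suc i) (f (Suc i) \<gamma>))"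
      if "\<gamma> \<in> stg (ctx_den \<Gamma>) (Suc i)" for i \<gamma>
      using hom_in[OF f that] by (auto simp: hom_res[OF f that] stg_box unbox_map_def global_elt_def)
  qed
next
  case (21 As ts fs \<Gamma> t B1 B2 f)
  have sub: "const_sub \<Gamma> As fs" using 21 by (auto simp: const_sub_def intro: denotes_wft)
  have "wf_ctx As" using 21(1,5) by (rule denotes_wf_ctx)
  then have f: "f \<in> hom (ctx_den As) (sum_obj (tden B1) (tden B2))" using 21 by simp
  \<comment> \<open>The target stage \<open>i'\<close> is independent of \<open>i\<close> because
    boxed objects have the same set at every stage. Naturality uses this for a value computed at
    \<open>Suc i\<close> and regarded at \<open>i\<close>.\<close>
  have in_sum: "boxplus_den (\<lambda>j. f j (sub_den As fs i j \<gamma>)) \<in> stg (sum_obj (box_obj (tden B1)) (box_obj (tden B2))) i'"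
    if "\<gamma> \<in> stg (ctx_den \<Gamma>) i" for i i' \<gamma>
    using global_elt_sum[OF global_elt_hom_sub[OF f sub that]] by (auto simp: stg_box)
  show ?case unfolding tden_simps
  proof (rule arr_hom[OF 21(7)])
    show "boxplus_den (\<lambda>j. f j (sub_den As fs i j (res (ctx_den \<Gamma>) i \<gamma>))) =
        res (sum_obj (box_obj (tden B1)) (box_obj (tden B2))) i (boxplus_den (\<lambda>j. f j (sub_den As fs (Suc i) j \<gamma>)))"
      if "\<gamma> \<in> stg (ctx_den \<Gamma>) (Suc i)" for i \<gamma>
      using in_sum[OF that, of i] by (auto simp: sub_den_res[OF sub that])
  qed (rule in_sum)
qed

section \<open>Coherence\<close>

inductive_cases denotes_VarE: "denotes \<Gamma> (Var k) A f"
inductive_cases denotes_ZeroE: "denotes \<Gamma> Zero A f"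
inductive_cases denotes_SuccE: "denotes \<Gamma> (Succ t) A f"
inductive_cases denotes_UnitE: "denotes \<Gamma> Unit A f"
inductive_cases denotes_PairE: "denotes \<Gamma> (Pair s t) A f"
inductive_cases denotes_FstE: "denotes \<Gamma> (Fst t) A f"
inductive_cases denotes_SndE: "denotes \<Gamma> (Snd t) A f"
inductive_cases denotes_In1E: "denotes \<Gamma> (In1 t) A f"
inductive_cases denotes_In2E: "denotes \<Gamma> (In2 t) A f"
inductive_cases denotes_CaseE: "denotes \<Gamma> (Case t s1 s2) A f"
inductive_cases denotes_LamE: "denotes \<Gamma> (Lam t) A f"
inductive_cases denotes_AppE: "denotes \<Gamma> (App s t) A f"
inductive_cases denotes_FoldE: "denotes \<Gamma> (Fold t) A f"
inductive_cases denotes_UnfoldE: "denotes \<Gamma> (Unfold t) A f"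
inductive_cases denotes_NextE: "denotes \<Gamma> (Next t) A f"
inductive_cases denotes_PrevE: "denotes \<Gamma> (Prev ts t) A f"
inductive_cases denotes_LAppE: "denotes \<Gamma> (s \<circledast> t) A f"
inductive_cases denotes_BoxE: "denotes \<Gamma> (Box ts t) A f"
inductive_cases denotes_UnboxE: "denotes \<Gamma> (Unbox t) A f"
inductive_cases denotes_BoxPlusE: "denotes \<Gamma> (BoxPlus ts t) A f"

definition rel_ctx :: "ty list \<Rightarrow> ty list \<Rightarrow> nat \<Rightarrow> 'v::set_universe list \<Rightarrow> 'v list \<Rightarrow> bool" where
  "rel_ctx \<Gamma> \<Gamma>' i \<gamma> \<gamma>' \<longleftrightarrow> length \<Gamma>' = length \<Gamma> \<and>
     \<gamma> \<in> stg (ctx_den \<Gamma>) i \<and> \<gamma>' \<in> stg (ctx_den \<Gamma>') i \<and>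
     (\<forall>k<length \<Gamma>. rel (\<Gamma> ! k) (\<Gamma>' ! k) i (\<gamma> ! k) (\<gamma>' ! k))"

lemma rel_ctxD:
  assumes "rel_ctx \<Gamma> \<Gamma>' i \<gamma> \<gamma>'"
  shows "\<gamma> \<in> stg (ctx_den \<Gamma>) i" "\<gamma>' \<in> stg (ctx_den \<Gamma>') i"
  using assms by (simp_all add: rel_ctx_def)

lemma rel_ctx_Cons [simp]:
  "rel_ctx (A # \<Gamma>) (A' # \<Gamma>') i (a # \<gamma>) (a' # \<gamma>') \<longleftrightarrow>
   a \<in> stg (tden A) i \<and> a' \<in> stg (tden A') i \<and> rel A A' i a a' \<and> rel_ctx \<Gamma> \<Gamma>' i \<gamma> \<gamma>'"
  by (auto simp: rel_ctx_def nth_Cons split: nat.splits)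

lemma rel_ctx_restr:
  assumes "wf_ctx \<Gamma>" "wf_ctx \<Gamma>'" "rel_ctx \<Gamma> \<Gamma>' i \<gamma> \<gamma>'" "j \<le> i"
  shows "rel_ctx \<Gamma> \<Gamma>' j (restr (ctx_den \<Gamma>) j i \<gamma>) (restr (ctx_den \<Gamma>') j i \<gamma>')"
proof -
  note in_stg = rel_ctxD[OF assms(3)]
  have "rel (\<Gamma> ! k) (\<Gamma>' ! k) j (restr (ctx_den \<Gamma>) j i \<gamma> ! k) (restr (ctx_den \<Gamma>') j i \<gamma>' ! k)"
    if "k < length \<Gamma>" for k
    using assms in_stg that
    by (auto simp: rel_ctx_def ctx_den_iff restr_ctx_nth wf_ctx_nth intro!: rel_restr)
  then show ?thesis
    using assms in_stg by (simp add: rel_ctx_def restr_ctx_in)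
qed

lemma rel_ctx_sub_den:
  assumes sub: "const_sub \<Gamma> As fs" "const_sub \<Gamma>' As' fs'" and len: "length As' = length As"
    and in_stg: "\<gamma> \<in> stg (ctx_den \<Gamma>) i" "\<gamma>' \<in> stg (ctx_den \<Gamma>') i"
    and rel: "\<And>k. k < length As \<Longrightarrow> rel (As ! k) (As' ! k) i ((fs ! k) i \<gamma>) ((fs' ! k) i \<gamma>')"
  shows "rel_ctx As As' j (sub_den As fs i j \<gamma>) (sub_den As' fs' i j \<gamma>')"
proof -
  have "rel (As ! k) (As' ! k) j (transport (tden (As ! k)) i j ((fs ! k) i \<gamma>))
      (transport (tden (As' ! k)) i j ((fs' ! k) i \<gamma>'))" if k: "k < length As" for k
  proof (rule rel_transport)
    show "wft 0 (As ! k)" "wft 0 (As' ! k)" "const_ty (As ! k)" "const_ty (As' ! k)"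
      using sub len k by (auto simp: const_sub_def)
    show "(fs ! k) i \<gamma> \<in> stg (tden (As ! k)) i" "(fs' ! k) i \<gamma>' \<in> stg (tden (As' ! k)) i"
      using const_subD(3)[OF sub(1) k in_stg(1)] const_subD(3)[OF sub(2) _ in_stg(2)] len k by auto
  qed (rule rel[OF k])
  then show ?thesis
    using sub_den_in[OF sub(1) in_stg(1)] sub_den_in[OF sub(2) in_stg(2)] len
      const_subD(1)[OF sub(1)] const_subD(1)[OF sub(2)]
    by (simp add: rel_ctx_def sub_den_nth)
qed

lemma denotes_const_sub:
  assumes "length As = n" "length fs = n" "\<forall>k<n. const_ty (As ! k)"
    "\<forall>k<n. denotes \<Gamma> (ts ! k) (As ! k) (fs ! k)" "wf_ctx \<Gamma>"
  shows "const_sub \<Gamma> As fs" "wf_ctx As"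
  using assms by (auto simp: const_sub_def wf_ctx_def intro: denotes_wft denotes_hom)

text \<open>Fundamental lemma of the logical relation: the first derivation drives the induction,
  and the second is inverted at the same term constructor. Contexts vary along with types because
  binders may be typed differently in the two derivations.\<close>

lemma denotes_rel:
  fixes f :: "nat \<Rightarrow> 'v::set_universe list \<Rightarrow> 'v"
  assumes "denotes \<Gamma> t A f" "wf_ctx \<Gamma>" "denotes \<Gamma>' t A' f'" "wf_ctx \<Gamma>'" "rel_ctx \<Gamma> \<Gamma>' i \<gamma> \<gamma>'"
  shows "rel A A' i (f i \<gamma>) (f' i \<gamma>')"
  using assms
proof (induction arbitrary: \<Gamma>' A' f' i \<gamma> \<gamma>' rule: denotes.induct)
  case (1 k \<Gamma>)
  from 1(4) show ?case
    by (cases rule: denotes_VarE) (use 1 in \<open>auto simp: arr_eq rel_ctx_def\<close>)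
next
  case (2 \<Gamma>)
  from 2(2) show ?case
    by (cases rule: denotes_ZeroE) (auto simp: arr_eq rel_ctxD[OF 2(4)])
next
  case (3 \<Gamma> t f)
  note in_stg = rel_ctxD[OF 3(6)]
  from 3(4) show ?case
    by (cases rule: denotes_SuccE) (use 3(2)[OF 3(3) _ 3(5,6)] in \<open>auto simp: arr_eq in_stg\<close>)
next
  case (4 \<Gamma>)
  from 4(2) show ?case
    by (cases rule: denotes_UnitE) (auto simp: arr_eq rel_ctxD[OF 4(4)])
next
  case (5 \<Gamma> s A f t B g)
  note in_stg = rel_ctxD[OF 5(8)]
  from 5(6) show ?case
    by (cases rule: denotes_PairE)
      (use 5(3)[OF 5(5) _ 5(7,8)] 5(4)[OF 5(5) _ 5(7,8)] in \<open>auto simp: arr_eq in_stg\<close>)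
next
  case (6 \<Gamma> t A B f)
  note in_stg = rel_ctxD[OF 6(6)]
  from 6(4) obtain B1 f1 where t: "denotes \<Gamma>' t (TProd A' B1) f1" and f': "f' = arr \<Gamma>' (\<lambda>i \<gamma>. vfst (f1 i \<gamma>))"
    by (cases rule: denotes_FstE)
  from 6(2)[OF 6(3) t 6(5,6)] show ?case
    by (simp add: f' arr_eq in_stg)
next
  case (7 \<Gamma> t A B f)
  note in_stg = rel_ctxD[OF 7(6)]
  from 7(4) obtain B1 f1 where t: "denotes \<Gamma>' t (TProd B1 A') f1" and f': "f' = arr \<Gamma>' (\<lambda>i \<gamma>. vsnd (f1 i \<gamma>))"
    by (cases rule: denotes_SndE)
  from 7(2)[OF 7(3) t 7(5,6)] show ?case
    by (simp add: f' arr_eq in_stg)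
next
  case (8 \<Gamma> t f A)
  \<comment> \<open>The given environment would produce an element of the void type, so this case
    cannot arise and the two target types of \<open>Abort\<close> may be arbitrary.\<close>
  have "f i \<gamma> \<in> stg (tden TVoid) i"
    by (rule hom_in[OF denotes_hom[OF 8(1,4)] rel_ctxD(1)[OF 8(7)]])
  then show ?case by (simp add: zero_obj_def)
next
  case (9 \<Gamma> t A f B)
  note in_stg = rel_ctxD[OF 9(7)]
  from 9(5) show ?case
    by (cases rule: denotes_In1E) (use 9(3)[OF 9(4) _ 9(6,7)] in \<open>auto simp: arr_eq in_stg\<close>)
next
  case (10 \<Gamma> t B f A)
  note in_stg = rel_ctxD[OF 10(7)]
  from 10(5) show ?case
    by (cases rule: denotes_In2E) (use 10(3)[OF 10(4) _ 10(6,7)] in \<open>auto simp: arr_eq in_stg\<close>)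
next
  case (11 \<Gamma> t A B f s1 C g s2 h)
  note in_stg = rel_ctxD[OF 11(10)]
  from 11(8) obtain A1 B1 f1 g1 h1 where t: "denotes \<Gamma>' t (TSum A1 B1) f1"
    and s1: "denotes (A1 # \<Gamma>') s1 A' g1" and s2: "denotes (B1 # \<Gamma>') s2 A' h1"
    and f': "f' = arr \<Gamma>' (\<lambda>i \<gamma>. vcase (\<lambda>a. g1 i (a # \<gamma>)) (\<lambda>b. h1 i (b # \<gamma>)) (f1 i \<gamma>))"
    by (cases rule: denotes_CaseE)
  have wf: "wft 0 A" "wft 0 B" "wft 0 A1" "wft 0 B1"
    using denotes_wft[OF 11(1)] denotes_wft[OF t] by auto
  have f: "f i \<gamma> \<in> stg (tden (TSum A B)) i" "f1 i \<gamma>' \<in> stg (tden (TSum A1 B1)) i"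
    using hom_in[OF denotes_hom[OF 11(1,7)] in_stg(1)] hom_in[OF denotes_hom[OF t 11(9)] in_stg(2)] .
  have "rel (TSum A B) (TSum A1 B1) i (f i \<gamma>) (f1 i \<gamma>')"
    by (rule 11(4)[OF 11(7) t 11(9,10)])
  then consider (l) a b where "f i \<gamma> = vinl a" "f1 i \<gamma>' = vinl b" "rel A A1 i a b"
    | (r) a b where "f i \<gamma> = vinr a" "f1 i \<gamma>' = vinr b" "rel B B1 i a b"
    by auto
  then show ?case
  proof cases
    case l
    then have "rel C A' i (g i (a # \<gamma>)) (g1 i (b # \<gamma>'))"
      using f wf 11(7,9,10) by (intro 11(5)[OF _ s1]) auto
    then show ?thesis by (simp add: f' arr_eq in_stg l)
  next
    case r
    then have "rel C A' i (h i (a # \<gamma>)) (h1 i (b # \<gamma>'))"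
      using f wf 11(7,9,10) by (intro 11(6)[OF _ s2]) auto
    then show ?thesis by (simp add: f' arr_eq in_stg r)
  qed
next
  case (12 A \<Gamma> t B f)
  note in_stg = rel_ctxD[OF 12(7)]
  from 12(5) obtain A1 B1 f1 where A': "A' = TFun A1 B1" and t: "denotes (A1 # \<Gamma>') t B1 f1" "wft 0 A1"
    and f': "f' = arr \<Gamma>' (\<lambda>i \<gamma>. vtup {..i} (\<lambda>j. vgraph (stg (tden A1) j)
               (\<lambda>a. f1 j (a # restr (ctx_den \<Gamma>') j i \<gamma>))))"
    by (cases rule: denotes_LamE)
  note wfs = wf_tree_tden[OF 12(2)] wf_tree_tden[OF denotes_wft[OF 12(1)]]
    wf_tree_tden[OF t(2)] wf_tree_tden[OF denotes_wft[OF t(1)]]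
  have hom: "f \<in> hom (ctx_den (A # \<Gamma>)) (tden B)" "f1 \<in> hom (ctx_den (A1 # \<Gamma>')) (tden B1)"
    using denotes_hom[OF 12(1)] denotes_hom[OF t(1)] 12(2,4,6) t(2) by simp_all
  \<comment> \<open>Arguments arrive at any stage \<open>j \<le> i\<close>, so the related
    environments are first restricted to \<open>j\<close>.\<close>
  have "rel B B1 j (f j (a # restr (ctx_den \<Gamma>) j i \<gamma>)) (f1 j (b # restr (ctx_den \<Gamma>') j i \<gamma>'))"
    if "j \<le> i" "a \<in> stg (tden A) j" "b \<in> stg (tden A1) j" "rel A A1 j a b" for j a b
    using 12(2,4,6) t that rel_ctx_restr[OF 12(4,6,7) that(1)] by (intro 12(3)[OF _ t(1)]) auto
  moreover have "exp_app (arr \<Gamma> (\<lambda>i \<gamma>. vtup {..i} (\<lambda>j. vgraph (stg (tden A) j)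
      (\<lambda>a. f j (a # restr (ctx_den \<Gamma>) j i \<gamma>)))) i \<gamma>) j a = f j (a # restr (ctx_den \<Gamma>) j i \<gamma>)"
    if "j \<le> i" "a \<in> stg (tden A) j" for j a
    unfolding arr_eq[OF in_stg(1)] using that in_stg 12(4)
    by (subst exp_app_lam[OF wfs(1,2)]) (auto intro!: hom_in[OF hom(1)] restr_ctx_in)
  moreover have "exp_app (f' i \<gamma>') j a = f1 j (a # restr (ctx_den \<Gamma>') j i \<gamma>')"
    if "j \<le> i" "a \<in> stg (tden A1) j" for j a
    unfolding f' arr_eq[OF in_stg(2)] using that in_stg 12(6)
    by (subst exp_app_lam[OF wfs(3,4)]) (auto intro!: hom_in[OF hom(2)] restr_ctx_in)
  ultimately show ?case by (simp add: A')
next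
  case (13 \<Gamma> s A B f t g)
  note in_stg = rel_ctxD[OF 13(8)]
  from 13(6) obtain A1 f1 g1 where s: "denotes \<Gamma>' s (TFun A1 A') f1" and t: "denotes \<Gamma>' t A1 g1"
    and f': "f' = arr \<Gamma>' (\<lambda>i \<gamma>. exp_app (f1 i \<gamma>) i (g1 i \<gamma>))"
    by (cases rule: denotes_AppE)
  have "rel (TFun A B) (TFun A1 A') i (f i \<gamma>) (f1 i \<gamma>')" "rel A A1 i (g i \<gamma>) (g1 i \<gamma>')"
    using 13(3)[OF 13(5) s 13(7,8)] 13(4)[OF 13(5) t 13(7,8)] .
  moreover have "g i \<gamma> \<in> stg (tden A) i" "g1 i \<gamma>' \<in> stg (tden A1) i"
    using hom_in[OF denotes_hom[OF 13(2,5)] in_stg(1)] hom_in[OF denotes_hom[OF t 13(7)] in_stg(2)] .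
  ultimately show ?case by (simp add: f' arr_eq in_stg)
next
  case (14 \<Gamma> t A f)
  from 14(5) obtain A1 where A': "A' = TMu A1" and t: "denotes \<Gamma>' t (unfold_mu A1) f'"
    by (cases rule: denotes_FoldE)
  from 14(3)[OF 14(4) t 14(6,7)] show ?case
    by (simp add: A' rel_TMu[OF 14(2)])
next
  case (15 \<Gamma> t A f)
  from 15(4) obtain A1 where A': "A' = unfold_mu A1" and t: "denotes \<Gamma>' t (TMu A1) f'"
    by (cases rule: denotes_UnfoldE)
  from 15(2)[OF 15(3) t 15(5,6)] show ?case
    by (simp add: A' rel_TMu[OF denotes_wft[OF 15(1)]])
next
  case (16 \<Gamma> t A f)
  note in_stg = rel_ctxD[OF 16(6)]
  from 16(4) obtain A1 f1 where A': "A' = TLater A1" and t: "denotes \<Gamma>' t A1 f1"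
    and f': "f' = arr \<Gamma>' (\<lambda>i \<gamma>. next_map (tden A1) i (f1 i \<gamma>))"
    by (cases rule: denotes_NextE)
  have "rel A A1 i (f i \<gamma>) (f1 i \<gamma>')"
    by (rule 16(2)[OF 16(3) t 16(5,6)])
  moreover have "f i \<gamma> \<in> stg (tden A) i" "f1 i \<gamma>' \<in> stg (tden A1) i"
    using hom_in[OF denotes_hom[OF 16(1,3)] in_stg(1)] hom_in[OF denotes_hom[OF t 16(5)] in_stg(2)] .
  ultimately show ?case
    unfolding A' f' arr_eq[OF in_stg(1)] arr_eq[OF in_stg(2)]
    using denotes_wft[OF 16(1)] denotes_wft[OF t] by (cases i) (auto simp: next_map_def rel_res)
next
  case (17 As ts fs \<Gamma> t A f)
  note in_stg = rel_ctxD[OF 17(10)]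
  from 17(8) obtain As1 fs1 f1 where len: "length As1 = length ts" "length fs1 = length ts"
    and const: "\<forall>k<length ts. const_ty (As1 ! k)"
    and ts: "\<forall>k<length ts. denotes \<Gamma>' (ts ! k) (As1 ! k) (fs1 ! k)" and t: "denotes As1 t (TLater A') f1"
    and f': "f' = arr \<Gamma>' (\<lambda>i \<gamma>. f1 (Suc i) (sub_den As1 fs1 i (Suc i) \<gamma>))"
    by (cases rule: denotes_PrevE)
  have "\<forall>k<length ts. denotes \<Gamma> (ts ! k) (As ! k) (fs ! k)" using 17(5) by blast
  note sub = denotes_const_sub[OF 17(1-3) this 17(7)] denotes_const_sub[OF len const ts 17(9)]
  \<comment> \<open>Both lists of types are constant, so relatedness at stage \<open>i\<close>
    spreads to all stages; the body is evaluated at \<open>Suc i\<close>.\<close>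
  have "rel_ctx As As1 j (sub_den As fs i j \<gamma>) (sub_den As1 fs1 i j \<gamma>')" for j
    by (rule rel_ctx_sub_den[OF sub(1,3) _ in_stg]) (use 17(1,5,7,9,10) len ts in auto)
  from 17(6)[OF sub(2) t sub(4) this[of "Suc i"]] show ?case
    by (auto simp: f' arr_eq in_stg)
next
  case (18 \<Gamma> s A B f t g)
  note in_stg = rel_ctxD[OF 18(8)]
  from 18(6) obtain A1 B1 f1 g1 where A': "A' = TLater B1"
    and s: "denotes \<Gamma>' s (TLater (TFun A1 B1)) f1" and t: "denotes \<Gamma>' t (TLater A1) g1"
    and f': "f' = arr \<Gamma>' (\<lambda>i \<gamma>. case i of 0 \<Rightarrow> vunit | Suc j \<Rightarrow> exp_app (f1 i \<gamma>) j (g1 i \<gamma>))"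
    by (cases rule: denotes_LAppE)
  have "rel (TLater (TFun A B)) (TLater (TFun A1 B1)) i (f i \<gamma>) (f1 i \<gamma>')"
      "rel (TLater A) (TLater A1) i (g i \<gamma>) (g1 i \<gamma>')"
    using 18(3)[OF 18(5) s 18(7,8)] 18(4)[OF 18(5) t 18(7,8)] .
  moreover have "g i \<gamma> \<in> stg (tden (TLater A)) i" "g1 i \<gamma>' \<in> stg (tden (TLater A1)) i"
    using hom_in[OF denotes_hom[OF 18(2,5)] in_stg(1)] hom_in[OF denotes_hom[OF t 18(7)] in_stg(2)] .
  ultimately show ?case
    unfolding A' f' arr_eq[OF in_stg(1)] arr_eq[OF in_stg(2)] by (cases i) auto
next
  case (19 As ts fs \<Gamma> t A f)
  note in_stg = rel_ctxD[OF 19(10)]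
  from 19(8) obtain As1 fs1 A1 f1 where A': "A' = TBox A1"
    and len: "length As1 = length ts" "length fs1 = length ts"
    and const: "\<forall>k<length ts. const_ty (As1 ! k)"
    and ts: "\<forall>k<length ts. denotes \<Gamma>' (ts ! k) (As1 ! k) (fs1 ! k)" and t: "denotes As1 t A1 f1"
    and f': "f' = arr \<Gamma>' (\<lambda>i \<gamma>. vtup UNIV (\<lambda>j. f1 j (sub_den As1 fs1 i j \<gamma>)))"
    by (cases rule: denotes_BoxE)
  have "\<forall>k<length ts. denotes \<Gamma> (ts ! k) (As ! k) (fs ! k)" using 19(5) by blast
  note sub = denotes_const_sub[OF 19(1-3) this 19(7)] denotes_const_sub[OF len const ts 19(9)]
  have "rel_ctx As As1 j (sub_den As fs i j \<gamma>) (sub_den As1 fs1 i j \<gamma>')" for j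
    by (rule rel_ctx_sub_den[OF sub(1,3) _ in_stg]) (use 19(1,5,7,9,10) len ts in auto)
  from 19(6)[OF sub(2) t sub(4) this] show ?case
    by (simp add: A' f' arr_eq in_stg)
next
  case (20 \<Gamma> t A f)
  note in_stg = rel_ctxD[OF 20(6)]
  from 20(4) obtain f1 where t: "denotes \<Gamma>' t (TBox A') f1" and f': "f' = arr \<Gamma>' (\<lambda>i \<gamma>. unbox_map i (f1 i \<gamma>))"
    by (cases rule: denotes_UnboxE)
  from 20(2)[OF 20(3) t 20(5,6)] show ?case
    by (simp add: f' arr_eq in_stg unbox_map_def)
next
  case (21 As ts fs \<Gamma> t B1 B2 f)
  note in_stg = rel_ctxD[OF 21(10)]
  from 21(8) obtain As1 fs1 C1 C2 f1 where A': "A' = TSum (TBox C1) (TBox C2)"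
    and len: "length As1 = length ts" "length fs1 = length ts"
    and const: "\<forall>k<length ts. const_ty (As1 ! k)"
    and ts: "\<forall>k<length ts. denotes \<Gamma>' (ts ! k) (As1 ! k) (fs1 ! k)" and t: "denotes As1 t (TSum C1 C2) f1"
    and f': "f' = arr \<Gamma>' (\<lambda>i \<gamma>. boxplus_den (\<lambda>j. f1 j (sub_den As1 fs1 i j \<gamma>)))"
    by (cases rule: denotes_BoxPlusE)
  have "\<forall>k<length ts. denotes \<Gamma> (ts ! k) (As ! k) (fs ! k)" using 21(5) by blast
  note sub = denotes_const_sub[OF 21(1-3) this 21(7)] denotes_const_sub[OF len const ts 21(9)]
  have "rel_ctx As As1 j (sub_den As fs i j \<gamma>) (sub_den As1 fs1 i j \<gamma>')" for j
    by (rule rel_ctx_sub_den[OF sub(1,3) _ in_stg]) (use 21(1,5,7,9,10) len ts in auto)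
  note rel = 21(6)[OF sub(2) t sub(4) this]
  have "global_elt (sum_obj (tden B1) (tden B2)) (\<lambda>j. f j (sub_den As fs i j \<gamma>))"
    using global_elt_hom_sub[OF denotes_hom[OF 21(4) sub(2)] sub(1) in_stg(1)] by simp
  from global_elt_sum[OF this] obtain a where
    a: "(\<lambda>j. f j (sub_den As fs i j \<gamma>)) = (\<lambda>j. vinl (a j)) \<or> (\<lambda>j. f j (sub_den As fs i j \<gamma>)) = (\<lambda>j. vinr (a j))"
    by blast
  have "global_elt (sum_obj (tden C1) (tden C2)) (\<lambda>j. f1 j (sub_den As1 fs1 i j \<gamma>'))"
    using global_elt_hom_sub[OF denotes_hom[OF t sub(4)] sub(3) in_stg(2)] by simp
  from global_elt_sum[OF this] obtain b where
    b: "(\<lambda>j. f1 j (sub_den As1 fs1 i j \<gamma>')) = (\<lambda>j. vinl (b j)) \<or> (\<lambda>j. f1 j (sub_den As1 fs1 i j \<gamma>')) = (\<lambda>j. vinr (b j))"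
    by blast
  \<comment> \<open>Each side carries one tag for all stages, and relatedness at any single stage
    excludes different tags; the two mixed cases are contradictory.\<close>
  have "(\<exists>x y. boxplus_den (\<lambda>j. f j (sub_den As fs i j \<gamma>)) = vinl x \<and>
           boxplus_den (\<lambda>j. f1 j (sub_den As1 fs1 i j \<gamma>')) = vinl y \<and> rel (TBox B1) (TBox C1) i x y) \<or>
        (\<exists>x y. boxplus_den (\<lambda>j. f j (sub_den As fs i j \<gamma>)) = vinr x \<and>
           boxplus_den (\<lambda>j. f1 j (sub_den As1 fs1 i j \<gamma>')) = vinr y \<and> rel (TBox B2) (TBox C2) i x y)"
    using a b
  proof (elim disjE)
    assume *: "(\<lambda>j. f j (sub_den As fs i j \<gamma>)) = (\<lambda>j. vinl (a j))"
      "(\<lambda>j. f1 j (sub_den As1 fs1 i j \<gamma>')) = (\<lambda>j. vinl (b j))"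
    show ?thesis using rel unfolding *[THEN fun_cong] by simp
  next
    assume *: "(\<lambda>j. f j (sub_den As fs i j \<gamma>)) = (\<lambda>j. vinr (a j))"
      "(\<lambda>j. f1 j (sub_den As1 fs1 i j \<gamma>')) = (\<lambda>j. vinr (b j))"
    show ?thesis using rel unfolding *[THEN fun_cong] by simp
  next
    assume *: "(\<lambda>j. f j (sub_den As fs i j \<gamma>)) = (\<lambda>j. vinl (a j))"
      "(\<lambda>j. f1 j (sub_den As1 fs1 i j \<gamma>')) = (\<lambda>j. vinr (b j))"
    show ?thesis using rel unfolding *[THEN fun_cong] by simp
  next
    assume *: "(\<lambda>j. f j (sub_den As fs i j \<gamma>)) = (\<lambda>j. vinr (a j))"
      "(\<lambda>j. f1 j (sub_den As1 fs1 i j \<gamma>')) = (\<lambda>j. vinl (b j))"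
    show ?thesis using rel unfolding *[THEN fun_cong] by simp
  qed
  then show ?case unfolding rel.simps(6) A' f' arr_eq[OF in_stg(1)] arr_eq[OF in_stg(2)] by blast
qed

text \<open>The relation is equality on the diagonal, and the empty environment is related to
  itself. Off the context both sides are \<open>undefined\<close>.\<close>

lemma denotes_unique:
  fixes f g :: "nat \<Rightarrow> 'v::set_universe list \<Rightarrow> 'v"
  assumes "denotes [] t A f" "denotes [] t A g"
  shows "f = g"
proof (rule hom_eqI)
  show f: "f \<in> hom (ctx_den []) (tden A)" and g: "g \<in> hom (ctx_den []) (tden A)"
    using denotes_hom[OF assms(1)] denotes_hom[OF assms(2)] by simp_all
  fix i and \<gamma> :: "'v list"
  assume "\<gamma> \<in> stg (ctx_den []) i"
  then have "\<gamma> = []" by simp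
  moreover have "rel A A i (f i []) (g i [])"
    by (rule denotes_rel[OF assms(1) _ assms(2)]) (auto simp: rel_ctx_def)
  ultimately show "f i \<gamma> = g i \<gamma>"
    using rel_same[OF denotes_wft[OF assms(1)], of "f i []" i "g i []"] hom_in[OF f, of "[]" i] hom_in[OF g, of "[]" i] by simp
qed

section \<open>Substitution\<close>

abbreviation sub_eval :: "('i \<Rightarrow> 'a \<Rightarrow> 'b) list \<Rightarrow> 'i \<Rightarrow> 'a \<Rightarrow> 'b list" where
  "sub_eval gs i \<delta> \<equiv> map (\<lambda>g. g i \<delta>) gs"

text \<open>The composite of \<open>f\<close> with the morphism into a product whose components are
  \<open>gs\<close>, cut off outside the stages of \<open>\<Delta>\<close> as denotations
  are.\<close>

definition pull ::
  "ty list \<Rightarrow> (nat \<Rightarrow> 'v::set_universe list \<Rightarrow> 'v) \<Rightarrow> (nat \<Rightarrow> 'v list \<Rightarrow> 'v) list \<Rightarrow> nat \<Rightarrow> 'v list \<Rightarrow> 'v" where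
  "pull \<Delta> f gs = arr \<Delta> (\<lambda>i \<delta>. f i (sub_eval gs i \<delta>))"

lemma pull_eq: "\<delta> \<in> stg (ctx_den \<Delta>) i \<Longrightarrow> pull \<Delta> f gs i \<delta> = f i (sub_eval gs i \<delta>)"
  by (simp add: pull_def arr_eq)

definition hom_sub :: "ty list \<Rightarrow> ty list \<Rightarrow> (nat \<Rightarrow> 'v::set_universe list \<Rightarrow> 'v) list \<Rightarrow> bool" where
  "hom_sub \<Delta> \<Gamma> gs \<longleftrightarrow> wf_ctx \<Delta> \<and> length gs = length \<Gamma> \<and>
     (\<forall>k<length \<Gamma>. gs ! k \<in> hom (ctx_den \<Delta>) (tden (\<Gamma> ! k)))"

lemma hom_sub_in:
  assumes "hom_sub \<Delta> \<Gamma> gs" "\<delta> \<in> stg (ctx_den \<Delta>) i"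
  shows "sub_eval gs i \<delta> \<in> stg (ctx_den \<Gamma>) i"
  using assms by (auto simp: hom_sub_def ctx_den_iff[of _ \<Gamma>] hom_in)

lemma length_restr_ctx:
  "length \<gamma> = length \<Gamma> \<Longrightarrow> length (restr (ctx_den \<Gamma>) i j \<gamma>) = length \<Gamma>"
  by (induction j arbitrary: \<gamma>) (simp_all add: restr.simps length_res_ctx)

lemma hom_sub_restr:
  assumes gs: "hom_sub \<Delta> \<Gamma> gs" and \<delta>: "\<delta> \<in> stg (ctx_den \<Delta>) i" and "j \<le> i"
  shows "sub_eval gs j (restr (ctx_den \<Delta>) j i \<delta>) = restr (ctx_den \<Gamma>) j i (sub_eval gs i \<delta>)"
proof (rule nth_equalityI)
  have len: "length gs = length \<Gamma>" using gs by (simp add: hom_sub_def)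
  show "length (sub_eval gs j (restr (ctx_den \<Delta>) j i \<delta>)) = length (restr (ctx_den \<Gamma>) j i (sub_eval gs i \<delta>))"
    by (simp add: len length_restr_ctx)
  fix k assume "k < length (sub_eval gs j (restr (ctx_den \<Delta>) j i \<delta>))"
  then have k: "k < length \<Gamma>" by (simp add: len)
  then have g: "gs ! k \<in> hom (ctx_den \<Delta>) (tden (\<Gamma> ! k))" and "wf_ctx \<Delta>"
    using gs by (simp_all add: hom_sub_def)
  then show "sub_eval gs j (restr (ctx_den \<Delta>) j i \<delta>) ! k = restr (ctx_den \<Gamma>) j i (sub_eval gs i \<delta>) ! k"
    using k \<open>j \<le> i\<close> \<delta> by (simp add: len restr_ctx_nth restr_hom[OF g res_closed_ctx])
qed

lemma pull_arr:
  "hom_sub \<Delta> \<Gamma> gs \<Longrightarrow> pull \<Delta> (arr \<Gamma> f) gs = arr \<Delta> (\<lambda>i \<delta>. f i (sub_eval gs i \<delta>))"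
  unfolding pull_def by (rule arr_cong) (simp add: arr_eq hom_sub_in)

lemma denotes_arr_cong:
  assumes "denotes \<Delta> s A (arr \<Delta> f)" "\<And>i \<delta>. \<delta> \<in> stg (ctx_den \<Delta>) i \<Longrightarrow> f i \<delta> = g i \<delta>"
  shows "denotes \<Delta> s A (arr \<Delta> g)"
  using arr_cong[of \<Delta> f g] assms by simp

definition id_sub :: "ty list \<Rightarrow> (nat \<Rightarrow> 'v::set_universe list \<Rightarrow> 'v) list" where
  "id_sub \<Gamma> = map (\<lambda>k. arr \<Gamma> (\<lambda>i \<delta>. \<delta> ! k)) [0..<length \<Gamma>]"

lemma sub_eval_id: "\<gamma> \<in> stg (ctx_den \<Gamma>) i \<Longrightarrow> sub_eval (id_sub \<Gamma>) i \<gamma> = \<gamma>"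
  by (rule nth_equalityI) (simp_all add: id_sub_def arr_eq ctx_den_iff[of \<gamma> \<Gamma>])

lemma pull_id:
  assumes "f \<in> hom (ctx_den \<Gamma>) Y"
  shows "pull \<Gamma> f (id_sub \<Gamma>) = f"
proof -
  have "pull \<Gamma> f (id_sub \<Gamma>) = arr \<Gamma> f"
    unfolding pull_def by (rule arr_cong) (simp add: sub_eval_id)
  then show ?thesis by (simp add: arr_hom_eq[OF assms])
qed

abbreviation weaken ::
  "ty \<Rightarrow> ty list \<Rightarrow> (nat \<Rightarrow> 'v::set_universe list \<Rightarrow> 'v) \<Rightarrow> nat \<Rightarrow> 'v list \<Rightarrow> 'v" where
  "weaken B \<Delta> g \<equiv> arr (B # \<Delta>) (\<lambda>i \<delta>. g i (tl \<delta>))"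

text \<open>The semantic counterpart of \<open>ups\<close>: a projection for the new variable, and
  the old components precomposed with the projection that drops it.\<close>

definition lift_sub ::
  "ty \<Rightarrow> ty list \<Rightarrow> (nat \<Rightarrow> 'v::set_universe list \<Rightarrow> 'v) list \<Rightarrow> (nat \<Rightarrow> 'v list \<Rightarrow> 'v) list" where
  "lift_sub B \<Delta> gs = arr (B # \<Delta>) (\<lambda>i \<delta>. \<delta> ! 0) # map (weaken B \<Delta>) gs"

lemma sub_eval_lift:
  "a \<in> stg (tden B) i \<Longrightarrow> \<delta> \<in> stg (ctx_den \<Delta>) i \<Longrightarrow> sub_eval (lift_sub B \<Delta> gs) i (a # \<delta>) = a # sub_eval gs i \<delta>"
  by (simp add: lift_sub_def arr_eq)

lemma funpow_ups: "k < n \<Longrightarrow> (ups ^^ n) \<theta> k = Var k"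
  by (induction n arbitrary: k) (auto simp: ups_def split: nat.split)

lemma sub_den_pull:
  assumes "length fs = length As" "\<delta> \<in> stg (ctx_den \<Delta>) i"
  shows "sub_den As (map (\<lambda>f. pull \<Delta> f gs) fs) i j \<delta> = sub_den As fs i j (sub_eval gs i \<delta>)"
  by (rule nth_equalityI) (use assms in \<open>simp_all add: sub_den_nth pull_eq\<close>)

text \<open>
  The predicate \<open>Q\<close> allows one induction to serve twice: with \<open>Q\<close> restricted to variables it yields
  the weakening that is needed to take for \<open>Q\<close> all terms.
\<close>

lemma denotes_subst_generic:
  fixes f :: "nat \<Rightarrow> 'v::set_universe list \<Rightarrow> 'v"
    and Q :: "ty list \<Rightarrow> tm \<Rightarrow> ty \<Rightarrow> (nat \<Rightarrow> 'v list \<Rightarrow> 'v) \<Rightarrow> bool"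
  assumes Q_denotes: "\<And>\<Delta> s A g. Q \<Delta> s A g \<Longrightarrow> denotes \<Delta> s A g"
    and Q_Var: "\<And>\<Delta> k. wf_ctx \<Delta> \<Longrightarrow> k < length \<Delta> \<Longrightarrow> Q \<Delta> (Var k) (\<Delta> ! k) (arr \<Delta> (\<lambda>i \<delta>. \<delta> ! k))"
    and Q_weaken: "\<And>\<Delta> s A g B. Q \<Delta> s A g \<Longrightarrow> wf_ctx \<Delta> \<Longrightarrow> wft 0 B \<Longrightarrow>
      Q (B # \<Delta>) (rename Suc s) A (weaken B \<Delta> g)"
    and "denotes \<Gamma> t A f" "wf_ctx \<Delta>" "length gs = length \<Gamma>"
    and "\<forall>k<length \<Gamma>. Q \<Delta> (\<theta> k) (\<Gamma> ! k) (gs ! k)"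
  shows "denotes \<Delta> (subst \<theta> t) A (pull \<Delta> f gs)"
proof -
  define ok where "ok \<Delta> \<Gamma> \<theta> gs \<longleftrightarrow> wf_ctx \<Delta> \<and> length gs = length \<Gamma> \<and>
    (\<forall>k<length \<Gamma>. Q \<Delta> (\<theta> k) (\<Gamma> ! k) (gs ! k))" for \<Delta> \<Gamma> \<theta> gs
  have hs: "hom_sub \<Delta> \<Gamma> gs" if "ok \<Delta> \<Gamma> \<theta> gs" for \<Delta> \<Gamma> \<theta> gs
    using that by (auto simp: ok_def hom_sub_def intro: denotes_hom Q_denotes)
  have ok_lift: "ok (B # \<Delta>) (B # \<Gamma>) (ups \<theta>) (lift_sub B \<Delta> gs)"
    if "ok \<Delta> \<Gamma> \<theta> gs" "wft 0 B" for B \<Delta> \<Gamma> \<theta> gs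
    using that Q_Var[of "B # \<Delta>" 0] Q_weaken
    by (auto simp: ok_def lift_sub_def ups_def nth_Cons split: nat.split)
  have ok_id: "ok As As ((ups ^^ length As) \<theta>) (id_sub As)" if "wf_ctx As" for As \<theta>
    using that Q_Var by (auto simp: ok_def id_sub_def funpow_ups)
  \<comment> \<open>The body of an explicit substitution is typed in \<open>As\<close>, and
    \<open>ups\<close> iterated \<open>length As\<close> times fixes all of its variables; hence
    substitution leaves its denotation unchanged.\<close>
  have body: "denotes As (subst ((ups ^^ length As) \<theta>) t) B f"
    if "denotes As t B f" "wf_ctx As"
      and "\<And>\<Delta> \<theta> gs. ok \<Delta> As \<theta> gs \<Longrightarrow> denotes \<Delta> (subst \<theta> t) B (pull \<Delta> f gs)" for As t B f \<theta>
    using that(3)[OF ok_id[OF that(2)]] by (simp add: pull_id[OF denotes_hom[OF that(1,2)]])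
  have "ok \<Delta> \<Gamma> \<theta> gs" using assms(5-) by (simp add: ok_def)
  with assms(4) show ?thesis
  proof (induction arbitrary: \<Delta> \<theta> gs rule: denotes.induct)
    case (1 k \<Gamma>)
    then have k: "denotes \<Delta> (\<theta> k) (\<Gamma> ! k) (gs ! k)" "length gs = length \<Gamma>"
      using Q_denotes by (auto simp: ok_def)
    have "arr \<Delta> (\<lambda>i \<delta>. sub_eval gs i \<delta> ! k) = arr \<Delta> (gs ! k)"
      by (rule arr_cong) (use 1 k in simp)
    also have "\<dots> = gs ! k"
      using denotes_hom[OF k(1)] 1(3) by (auto simp: ok_def intro: arr_hom_eq)
    finally show ?case using k by (simp add: pull_arr[OF hs[OF 1(3)]])
  next
    case (2 \<Gamma>)
    then show ?case by (simp add: pull_arr[OF hs] denotes.intros del: vnat.simps)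
  next
    case (3 \<Gamma> t f)
    show ?case unfolding subst.simps pull_arr[OF hs[OF 3(3)]]
      by (rule denotes_arr_cong[OF denotes.intros(3)[OF 3(2)[OF 3(3)]]]) (simp add: pull_eq)
  next
    case (4 \<Gamma>)
    then show ?case by (simp add: pull_arr[OF hs] denotes.intros)
  next
    case (5 \<Gamma> s A f t B g)
    show ?case unfolding subst.simps pull_arr[OF hs[OF 5(5)]]
      by (rule denotes_arr_cong[OF denotes.intros(5)[OF 5(3)[OF 5(5)] 5(4)[OF 5(5)]]]) (simp add: pull_eq)
  next
    case (6 \<Gamma> t A B f)
    show ?case unfolding subst.simps pull_arr[OF hs[OF 6(3)]]
      by (rule denotes_arr_cong[OF denotes.intros(6)[OF 6(2)[OF 6(3)]]]) (simp add: pull_eq)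
  next
    case (7 \<Gamma> t A B f)
    show ?case unfolding subst.simps pull_arr[OF hs[OF 7(3)]]
      by (rule denotes_arr_cong[OF denotes.intros(7)[OF 7(2)[OF 7(3)]]]) (simp add: pull_eq)
  next
    case (8 \<Gamma> t f A)
    show ?case unfolding subst.simps pull_arr[OF hs[OF 8(4)]]
      by (rule denotes.intros(8)[OF 8(3)[OF 8(4)] 8(2)])
  next
    case (9 \<Gamma> t A f B)
    show ?case unfolding subst.simps pull_arr[OF hs[OF 9(4)]]
      by (rule denotes_arr_cong[OF denotes.intros(9)[OF 9(3)[OF 9(4)] 9(2)]]) (simp add: pull_eq)
  next
    case (10 \<Gamma> t B f A)
    show ?case unfolding subst.simps pull_arr[OF hs[OF 10(4)]]
      by (rule denotes_arr_cong[OF denotes.intros(10)[OF 10(3)[OF 10(4)] 10(2)]]) (simp add: pull_eq)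
  next
    case (11 \<Gamma> t A B f s1 C g s2 h)
    have wf: "wft 0 A" "wft 0 B" using denotes_wft[OF 11(1)] by auto
    have t: "denotes \<Delta> (subst \<theta> t) (TSum A B) (pull \<Delta> f gs)"
      by (rule 11(4)[OF 11(7)])
    have "wf_ctx \<Delta>" using 11(7) by (simp add: ok_def)
    \<comment> \<open>Membership shows the scrutinee to be an injection of an element of a stage,
      where the lifted substitution has its intended value.\<close>
    note pf = hom_in[OF denotes_hom[OF t this]]
    show ?case unfolding subst.simps pull_arr[OF hs[OF 11(7)]]
    proof (rule denotes_arr_cong[OF denotes.intros(11)[OF t
          11(5)[OF ok_lift[OF 11(7) wf(1)]] 11(6)[OF ok_lift[OF 11(7) wf(2)]]]])
      fix i and \<delta> :: "'v list"
      assume \<delta>: "\<delta> \<in> stg (ctx_den \<Delta>) i"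
      show "vcase (\<lambda>a. pull (A # \<Delta>) g (lift_sub A \<Delta> gs) i (a # \<delta>))
            (\<lambda>b. pull (B # \<Delta>) h (lift_sub B \<Delta> gs) i (b # \<delta>)) (pull \<Delta> f gs i \<delta>) =
          vcase (\<lambda>a. g i (a # sub_eval gs i \<delta>)) (\<lambda>b. h i (b # sub_eval gs i \<delta>)) (f i (sub_eval gs i \<delta>))"
        using pf[OF \<delta>] \<delta> by (auto simp: pull_eq sub_eval_lift)
    qed
  next
    case (12 A \<Gamma> t B f)
    note h = hs[OF 12(4)]
    have wf: "wf_ctx \<Delta>" using 12(4) by (simp add: ok_def)
    show ?case unfolding subst.simps pull_arr[OF h]
    proof (rule denotes_arr_cong[OF denotes.intros(12)[OF 12(3)[OF ok_lift[OF 12(4,2)]] 12(2)]],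
        intro vtup_cong vgraph_cong)
      fix i j and a :: 'v and \<delta> :: "'v list"
      assume "\<delta> \<in> stg (ctx_den \<Delta>) i" "j \<in> {..i}" "a \<in> stg (tden A) j"
      \<comment> \<open>Substitution commutes with restriction of the environment because each
        component of \<open>gs\<close> is a morphism.\<close>
      then show "pull (A # \<Delta>) f (lift_sub A \<Delta> gs) j (a # restr (ctx_den \<Delta>) j i \<delta>) =
          f j (a # restr (ctx_den \<Gamma>) j i (sub_eval gs i \<delta>))"
        using hom_sub_restr[OF h, of \<delta> i j] wf by (simp add: pull_eq sub_eval_lift restr_ctx_in)
    qed
  next
    case (13 \<Gamma> s A B f t g)
    show ?case unfolding subst.simps pull_arr[OF hs[OF 13(5)]]
      by (rule denotes_arr_cong[OF denotes.intros(13)[OF 13(3)[OF 13(5)] 13(4)[OF 13(5)]]]) (simp add: pull_eq)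
  next
    case (14 \<Gamma> t A f)
    then show ?case by (simp add: denotes.intros)
  next
    case (15 \<Gamma> t A f)
    then show ?case by (simp add: denotes.intros)
  next
    case (16 \<Gamma> t A f)
    show ?case unfolding subst.simps pull_arr[OF hs[OF 16(3)]]
      by (rule denotes_arr_cong[OF denotes.intros(16)[OF 16(2)[OF 16(3)]]]) (simp add: pull_eq)
  next
    case (17 As ts fs \<Gamma> t A f)
    have wf: "wf_ctx As" using 17(1,5) by (rule denotes_wf_ctx)
    have b: "denotes As (subst ((ups ^^ length ts) \<theta>) t) (TLater A) f"
      using body[OF 17(4) wf 17(6)] 17(1) by simp
    have ts: "\<forall>k<length (map (subst \<theta>) ts).
        denotes \<Delta> (map (subst \<theta>) ts ! k) (As ! k) (map (\<lambda>f. pull \<Delta> f gs) fs ! k)"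
      using 17(2,5,7) by simp
    show ?case unfolding subst.simps pull_arr[OF hs[OF 17(7)]]
      by (rule denotes_arr_cong[OF denotes.intros(17)[OF _ _ _ ts b]])
        (use 17(1-3) in \<open>simp_all add: sub_den_pull\<close>)
  next
    case (18 \<Gamma> s A B f t g)
    show ?case unfolding subst.simps pull_arr[OF hs[OF 18(5)]]
      by (rule denotes_arr_cong[OF denotes.intros(18)[OF 18(3)[OF 18(5)] 18(4)[OF 18(5)]]])
        (auto simp: pull_eq split: nat.split)
  next
    case (19 As ts fs \<Gamma> t A f)
    have wf: "wf_ctx As" using 19(1,5) by (rule denotes_wf_ctx)
    have b: "denotes As (subst ((ups ^^ length ts) \<theta>) t) A f"
      using body[OF 19(4) wf 19(6)] 19(1) by simp
    have ts: "\<forall>k<length (map (subst \<theta>) ts).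
        denotes \<Delta> (map (subst \<theta>) ts ! k) (As ! k) (map (\<lambda>f. pull \<Delta> f gs) fs ! k)"
      using 19(2,5,7) by simp
    show ?case unfolding subst.simps pull_arr[OF hs[OF 19(7)]]
      by (rule denotes_arr_cong[OF denotes.intros(19)[OF _ _ _ ts b]])
        (use 19(1-3) in \<open>simp_all add: sub_den_pull\<close>)
  next
    case (20 \<Gamma> t A f)
    show ?case unfolding subst.simps pull_arr[OF hs[OF 20(3)]]
      by (rule denotes_arr_cong[OF denotes.intros(20)[OF 20(2)[OF 20(3)]]]) (simp add: pull_eq)
  next
    case (21 As ts fs \<Gamma> t B1 B2 f)
    have wf: "wf_ctx As" using 21(1,5) by (rule denotes_wf_ctx)
    have b: "denotes As (subst ((ups ^^ length ts) \<theta>) t) (TSum B1 B2) f"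
      using body[OF 21(4) wf 21(6)] 21(1) by simp
    have ts: "\<forall>k<length (map (subst \<theta>) ts).
        denotes \<Delta> (map (subst \<theta>) ts ! k) (As ! k) (map (\<lambda>f. pull \<Delta> f gs) fs ! k)"
      using 21(2,5,7) by simp
    show ?case unfolding subst.simps pull_arr[OF hs[OF 21(7)]]
      by (rule denotes_arr_cong[OF denotes.intros(21)[OF _ _ _ ts b]])
        (use 21(1-3) in \<open>simp_all add: sub_den_pull\<close>)
  qed
qed

section \<open>Renaming, weakening and closed substitution\<close>

lemma ups_Var: "ups (Var \<circ> \<rho>) = Var \<circ> upr \<rho>"
  by (auto simp: ups_def upr_def fun_eq_iff split: nat.split)

lemma funpow_ups_Var: "(ups ^^ n) (Var \<circ> \<rho>) = Var \<circ> (upr ^^ n) \<rho>"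
  by (induction n) (simp_all add: ups_Var[unfolded comp_def] comp_def)

text \<open>Brings renaming within the scope of the generic substitution lemma.\<close>

lemma rename_eq_subst: "rename \<rho> t = subst (Var \<circ> \<rho>) t"
  by (induction t arbitrary: \<rho>) (simp_all add: ups_Var funpow_ups_Var)

lemma weaken_Var:
  assumes "l < length \<Delta>"
  shows "weaken B \<Delta> (arr \<Delta> (\<lambda>i \<delta>. \<delta> ! l)) =
    (arr (B # \<Delta>) (\<lambda>i \<delta>. \<delta> ! Suc l) :: nat \<Rightarrow> 'v::set_universe list \<Rightarrow> 'v)"
proof (rule arr_cong)
  fix i and \<gamma> :: "'v list"
  assume \<gamma>: "\<gamma> \<in> stg (ctx_den (B # \<Delta>)) i"
  then obtain a \<delta> where "\<gamma> = a # \<delta>" by (cases \<gamma>) (auto simp: ctx_den_iff)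
  with \<gamma> show "arr \<Delta> (\<lambda>i \<delta>. \<delta> ! l) i (tl \<gamma>) = \<gamma> ! Suc l"
    by (simp add: arr_eq)
qed

lemma denotes_weaken:
  assumes t: "denotes \<Delta> t A f" and wf: "wf_ctx \<Delta>" "wft 0 B"
  shows "denotes (B # \<Delta>) (rename Suc t) A (weaken B \<Delta> f)"
proof -
  define Q :: "ty list \<Rightarrow> tm \<Rightarrow> ty \<Rightarrow> (nat \<Rightarrow> 'a list \<Rightarrow> 'a) \<Rightarrow> bool" where
    "Q \<Delta> s A g \<longleftrightarrow> wft 0 A \<and> (\<exists>l<length \<Delta>. s = Var l \<and> A = \<Delta> ! l \<and> g = arr \<Delta> (\<lambda>i \<delta>. \<delta> ! l))"
    for \<Delta> s A g
  \<comment> \<open>The projections that skip the new first entry; their tuple drops the head of the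
    environment.\<close>
  let ?gs = "map (\<lambda>k. arr (B # \<Delta>) (\<lambda>i \<delta>. \<delta> ! Suc k)) [0..<length \<Delta>] :: (nat \<Rightarrow> 'a list \<Rightarrow> 'a) list"
  have "denotes (B # \<Delta>) (subst (Var \<circ> Suc) t) A (pull (B # \<Delta>) f ?gs)"
  proof (rule denotes_subst_generic[where Q = Q, OF _ _ _ t])
    show "denotes \<Delta> s A g" if "Q \<Delta> s A g" for \<Delta> s A g
      using that by (auto simp: Q_def intro: denotes.intros)
    show "Q \<Delta> (Var k) (\<Delta> ! k) (arr \<Delta> (\<lambda>i \<delta>. \<delta> ! k))" if "wf_ctx \<Delta>" "k < length \<Delta>" for \<Delta> k
      using that by (auto simp: Q_def wf_ctx_nth)
    show "Q (B # \<Delta>) (rename Suc s) A (weaken B \<Delta> g)" if "Q \<Delta> s A g" for \<Delta> s A g B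
      using that by (auto simp: Q_def weaken_Var)
  qed (use wf in \<open>auto simp: Q_def wf_ctx_nth\<close>)
  moreover have "pull (B # \<Delta>) f ?gs = weaken B \<Delta> f"
    unfolding pull_def
  proof (rule arr_cong)
    fix i and \<gamma> :: "'a list"
    assume \<gamma>: "\<gamma> \<in> stg (ctx_den (B # \<Delta>)) i"
    then have "sub_eval ?gs i \<gamma> = tl \<gamma>"
      by (intro nth_equalityI) (simp_all add: arr_eq ctx_den_iff[of \<gamma>] nth_tl)
    then show "f i (sub_eval ?gs i \<gamma>) = f i (tl \<gamma>)" by simp
  qed
  ultimately show ?thesis by (simp add: rename_eq_subst)
qed

lemma denotes_subst:
  assumes "denotes \<Gamma> t A f" "wf_ctx \<Delta>" "length gs = length \<Gamma>"
    and "\<forall>k<length \<Gamma>. denotes \<Delta> (\<theta> k) (\<Gamma> ! k) (gs ! k)"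
  shows "denotes \<Delta> (subst \<theta> t) A (pull \<Delta> f gs)"
  by (rule denotes_subst_generic[where Q = denotes, OF _ _ _ assms])
    (auto intro: denotes.intros denotes_weaken wf_ctx_nth)

lemma denotes_inst:
  assumes "denotes As t A f" "length As = length ts" "length fs = length ts"
    "\<forall>k<length ts. denotes [] (ts ! k) (As ! k) (fs ! k)"
  shows "denotes [] (inst t ts) A (arr [] (\<lambda>i \<delta>. f i (map (\<lambda>g. g i []) fs)))"
proof -
  have "denotes [] (inst t ts) A (pull [] f fs)"
    unfolding inst_def by (rule denotes_subst[OF assms(1)]) (use assms in auto)
  moreover have "pull [] f fs = arr [] (\<lambda>i \<delta>. f i (map (\<lambda>g. g i []) fs))"
    unfolding pull_def by (rule arr_cong) simp
  ultimately show ?thesis by simp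
qed

section \<open>Soundness\<close>

lemma denotes_closed_global_elt:
  assumes "denotes [] t A f"
  shows "global_elt (tden A) (\<lambda>i. f i [])"
  unfolding global_elt_def
proof
  show "f j [] \<in> stg (tden A) j \<and> res (tden A) j (f (Suc j) []) = f j []" for j
    using hom_in[OF denotes_hom[OF assms], of "[]" j] hom_res[OF denotes_hom[OF assms], of "[]" j]
    by simp
qed

text \<open>A closed term denotes a global element, so carrying its value from stage
  \<open>i\<close> to stage \<open>j\<close> gives its own value at \<open>j\<close>. In a redex an
  explicit substitution thus has the same effect as an ordinary one.\<close>

lemma sub_den_closed:
  assumes "length As = n" "length fs = n" "\<forall>k<n. const_ty (As ! k)"
    "\<forall>k<n. denotes [] (ts ! k) (As ! k) (fs ! k)"
  shows "sub_den As fs i j [] = map (\<lambda>g. g j []) fs"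
proof (rule nth_equalityI)
  fix k assume "k < length (sub_den As fs i j [])"
  then have k: "k < n" using assms by simp
  then show "sub_den As fs i j [] ! k = map (\<lambda>g. g j []) fs ! k"
    using assms transport_global_elt[OF const_tree_tden denotes_closed_global_elt, of "As ! k" "ts ! k" "fs ! k" i j]
    by (auto simp: sub_den_nth intro: denotes_wft)
qed (use assms in simp)

text \<open>The denotations of the parts are read off the given derivation and reassembled for the
  reduct into the same \<open>f\<close>, so preservation of the type and of the denotation come
  together.\<close>

lemma denotes_redex:
  fixes f :: "nat \<Rightarrow> 'v::set_universe list \<Rightarrow> 'v"
  assumes "t \<mapsto>\<^sub>0 u" "denotes [] t A f"
  shows "denotes [] u A f"
  using assms
proof (induction arbitrary: A f rule: redex.induct)
  case (1 s t)
  from 1 obtain B g where "denotes [] (Pair s t) (TProd A B) g" and f: "f = arr [] (\<lambda>i \<gamma>. vfst (g i \<gamma>))"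
    by (cases rule: denotes_FstE)
  then obtain g1 g2 where s: "denotes [] s A g1" and g: "g = arr [] (\<lambda>i \<gamma>. vpair (g1 i \<gamma>) (g2 i \<gamma>))"
    by (auto elim: denotes_PairE)
  have "f = arr [] g1" unfolding f g by (rule arr_cong) (simp add: arr_eq)
  then show ?case using s arr_hom_eq[OF denotes_hom[OF s]] by simp
next
  case (2 s t)
  from 2 obtain B g where "denotes [] (Pair s t) (TProd B A) g" and f: "f = arr [] (\<lambda>i \<gamma>. vsnd (g i \<gamma>))"
    by (cases rule: denotes_SndE)
  then obtain g1 g2 where s: "denotes [] t A g2" and g: "g = arr [] (\<lambda>i \<gamma>. vpair (g1 i \<gamma>) (g2 i \<gamma>))"
    by (auto elim: denotes_PairE)
  have "f = arr [] g2" unfolding f g by (rule arr_cong) (simp add: arr_eq)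
  then show ?case using s arr_hom_eq[OF denotes_hom[OF s]] by simp
next
  case (3 t s1 s2)
  from 3 obtain B C e g h where "denotes [] (In1 t) (TSum B C) e" and s: "denotes [B] s1 A g"
    and f: "f = arr [] (\<lambda>i \<gamma>. vcase (\<lambda>a. g i (a # \<gamma>)) (\<lambda>b. h i (b # \<gamma>)) (e i \<gamma>))"
    by (cases rule: denotes_CaseE)
  then obtain e1 where t: "denotes [] t B e1" and e: "e = arr [] (\<lambda>i \<gamma>. vinl (e1 i \<gamma>))"
    by (auto elim: denotes_In1E)
  have "denotes [] (inst s1 [t]) A (arr [] (\<lambda>i \<delta>. g i (map (\<lambda>g. g i []) [e1])))"
    by (rule denotes_inst[OF s]) (use t in auto)
  then show ?case unfolding f e by (rule denotes_arr_cong) (simp add: arr_eq)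
next
  case (4 t s1 s2)
  from 4 obtain B C e g h where "denotes [] (In2 t) (TSum B C) e" and s: "denotes [C] s2 A h"
    and f: "f = arr [] (\<lambda>i \<gamma>. vcase (\<lambda>a. g i (a # \<gamma>)) (\<lambda>b. h i (b # \<gamma>)) (e i \<gamma>))"
    by (cases rule: denotes_CaseE)
  then obtain e1 where t: "denotes [] t C e1" and e: "e = arr [] (\<lambda>i \<gamma>. vinr (e1 i \<gamma>))"
    by (auto elim: denotes_In2E)
  have "denotes [] (inst s2 [t]) A (arr [] (\<lambda>i \<delta>. h i (map (\<lambda>g. g i []) [e1])))"
    by (rule denotes_inst[OF s]) (use t in auto)
  then show ?case unfolding f e by (rule denotes_arr_cong) (simp add: arr_eq)
next
  case (5 s t)
  from 5 obtain B e g where "denotes [] (Lam s) (TFun B A) e" and t: "denotes [] t B g"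
    and f: "f = arr [] (\<lambda>i \<gamma>. exp_app (e i \<gamma>) i (g i \<gamma>))"
    by (cases rule: denotes_AppE)
  then obtain e1 where s: "denotes [B] s A e1" "wft 0 B"
    and e: "e = arr [] (\<lambda>i \<gamma>. vtup {..i} (\<lambda>j. vgraph (stg (tden B) j) (\<lambda>a. e1 j (a # restr (ctx_den []) j i \<gamma>))))"
    by (auto elim: denotes_LamE)
  have hom: "e1 \<in> hom (ctx_den [B]) (tden A)" "g \<in> hom (ctx_den []) (tden B)"
    using denotes_hom[OF s(1)] denotes_hom[OF t] s(2) by auto
  note wf = wf_tree_tden[OF s(2)] wf_tree_tden[OF denotes_wft[OF s(1)]]
  have "denotes [] (inst s [t]) A (arr [] (\<lambda>i \<delta>. e1 i (map (\<lambda>g. g i []) [g])))"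
    by (rule denotes_inst[OF s(1)]) (use t in auto)
  then show ?case unfolding f e
  proof (rule denotes_arr_cong)
    fix i and \<delta> :: "'v list"
    assume "\<delta> \<in> stg (ctx_den []) i"
    then have \<delta>: "\<delta> = []" by simp
    \<comment> \<open>The application uses the component at the current stage \<open>i\<close>,
      where the environment is not restricted at all, so the value is that of the instantiated
      body.\<close>
    have "exp_app (vtup {..i} (\<lambda>j. vgraph (stg (tden B) j) (\<lambda>a. e1 j (a # restr (ctx_den []) j i [])))) i (g i []) =
        e1 i (g i [] # restr (ctx_den []) i i [])"
      by (rule exp_app_lam[OF wf]) (auto intro!: hom_in[OF hom(1)] hom_in[OF hom(2)])
    then show "e1 i (map (\<lambda>g. g i []) [g]) = exp_app (arr [] (\<lambda>i \<gamma>. vtup {..i} (\<lambda>j. vgraph (stg (tden B) j)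
        (\<lambda>a. e1 j (a # restr (ctx_den []) j i \<gamma>)))) i \<delta>) i (g i \<delta>)"
      by (simp add: \<delta> arr_eq)
  qed
next
  case (6 t)
  \<comment> \<open>Both rules keep the denotation, the isomorphism between a recursive type and its
    unfolding being the identity.\<close>
  then show ?case by (auto elim!: denotes_UnfoldE denotes_FoldE)
next
  case (7 ts t)
  from 7(2) obtain As fs g where len: "length As = length ts" "length fs = length ts"
    and const: "\<forall>k<length ts. const_ty (As ! k)"
    and ts: "\<forall>k<length ts. denotes [] (ts ! k) (As ! k) (fs ! k)" and t: "denotes As t (TLater A) g"
    and f: "f = arr [] (\<lambda>i \<gamma>. g (Suc i) (sub_den As fs i (Suc i) \<gamma>))"
    by (cases rule: denotes_PrevE)
  note i = denotes_inst[OF t len ts]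
  have "denotes [] (Prev [] (inst t ts)) A (arr [] (\<lambda>i \<gamma>.
      arr [] (\<lambda>i \<delta>. g i (map (\<lambda>g. g i []) fs)) (Suc i) (sub_den [] [] i (Suc i) \<gamma>)))"
    by (rule denotes.intros(17)) (use i in auto)
  then show ?case unfolding f
    by (rule denotes_arr_cong) (simp add: arr_eq sub_den_closed[OF len const ts])
next
  case (8 t)
  from 8 obtain fs g where "denotes [] (Next t) (TLater A) g"
    and f: "f = arr [] (\<lambda>i \<gamma>. g (Suc i) (sub_den [] fs i (Suc i) \<gamma>))"
    by (cases rule: denotes_PrevE) auto
  then obtain g1 where t: "denotes [] t A g1" and g: "g = arr [] (\<lambda>i \<gamma>. next_map (tden A) i (g1 i \<gamma>))"
    by (auto elim: denotes_NextE)
  \<comment> \<open>\<open>Prev\<close> evaluates at stage \<open>Suc i\<close>, and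
    \<open>Next\<close> restricts from there to \<open>i\<close>. A closed term is a global element,
    so the result is its value at \<open>i\<close>.\<close>
  have "f = arr [] g1" unfolding f g
    by (rule arr_cong) (use denotes_closed_global_elt[OF t] in \<open>simp add: arr_eq next_map_def global_elt_def\<close>)
  then show ?case using t arr_hom_eq[OF denotes_hom[OF t]] by simp
next
  case (9 s t)
  from 9 obtain B C e g where A: "A = TLater C" and "denotes [] (Next s) (TLater (TFun B C)) e"
    and "denotes [] (Next t) (TLater B) g"
    and f: "f = arr [] (\<lambda>i \<gamma>. case i of 0 \<Rightarrow> vunit | Suc j \<Rightarrow> exp_app (e i \<gamma>) j (g i \<gamma>))"
    by (cases rule: denotes_LAppE)
  then obtain e1 g1 where s: "denotes [] s (TFun B C) e1" and t: "denotes [] t B g1"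
    and e: "e = arr [] (\<lambda>i \<gamma>. next_map (tden (TFun B C)) i (e1 i \<gamma>))"
    and g: "g = arr [] (\<lambda>i \<gamma>. next_map (tden B) i (g1 i \<gamma>))"
    by (auto elim!: denotes_NextE)
  have "wft 0 B" "wft 0 C" using denotes_wft[OF s] by auto
  note wf = this[THEN wf_tree_tden]
  have "denotes [] (Next (App s t)) (TLater C)
      (arr [] (\<lambda>i \<gamma>. next_map (tden C) i (arr [] (\<lambda>i \<gamma>. exp_app (e1 i \<gamma>) i (g1 i \<gamma>)) i \<gamma>)))"
    by (rule denotes.intros(16)[OF denotes.intros(13)[OF s t]])
  then show ?case unfolding f A
  proof (rule denotes_arr_cong)
    fix i and \<delta> :: "'v list"
    assume \<delta>: "\<delta> \<in> stg (ctx_den []) i"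
    show "next_map (tden C) i (arr [] (\<lambda>i \<gamma>. exp_app (e1 i \<gamma>) i (g1 i \<gamma>)) i \<delta>) =
        (case i of 0 \<Rightarrow> vunit | Suc j \<Rightarrow> exp_app (e i \<delta>) j (g i \<delta>))"
    proof (cases i)
      case (Suc j)
      have "e1 i \<delta> \<in> stg (exp_obj (tden B) (tden C)) (Suc j)" "g1 i \<delta> \<in> stg (tden B) (Suc j)"
        using hom_in[OF denotes_hom[OF s] \<delta>] hom_in[OF denotes_hom[OF t] \<delta>] Suc by auto
      \<comment> \<open>Applying and then restricting agrees with restricting both parts and then
        applying: this is naturality of the components of the function.\<close>
      then show ?thesis
        using exp_app_res[OF _ wf, of "e1 i \<delta>" "Suc j" j "g1 i \<delta>"] \<delta>
        by (simp add: e g arr_eq Suc next_map_def)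
    qed (simp add: next_map_def)
  qed
next
  case (10 ts t)
  from 10 obtain e where "denotes [] (Box ts t) (TBox A) e" and f: "f = arr [] (\<lambda>i \<gamma>. unbox_map i (e i \<gamma>))"
    by (cases rule: denotes_UnboxE)
  then obtain As fs g where len: "length As = length ts" "length fs = length ts"
    and const: "\<forall>k<length ts. const_ty (As ! k)"
    and ts: "\<forall>k<length ts. denotes [] (ts ! k) (As ! k) (fs ! k)" and t: "denotes As t A g"
    and e: "e = arr [] (\<lambda>i \<gamma>. vtup UNIV (\<lambda>j. g j (sub_den As fs i j \<gamma>)))"
    by (auto elim: denotes_BoxE)
  from denotes_inst[OF t len ts] show ?case unfolding f e
    by (rule denotes_arr_cong) (simp add: arr_eq unbox_map_def sub_den_closed[OF len const ts])
next
  case (11 ts t)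
  from 11(2) obtain As fs B C g where A: "A = TSum (TBox B) (TBox C)"
    and len: "length As = length ts" "length fs = length ts"
    and const: "\<forall>k<length ts. const_ty (As ! k)"
    and ts: "\<forall>k<length ts. denotes [] (ts ! k) (As ! k) (fs ! k)" and t: "denotes As t (TSum B C) g"
    and f: "f = arr [] (\<lambda>i \<gamma>. boxplus_den (\<lambda>j. g j (sub_den As fs i j \<gamma>)))"
    by (cases rule: denotes_BoxPlusE)
  note i = denotes_inst[OF t len ts]
  have "denotes [] (BoxPlus [] (inst t ts)) A (arr [] (\<lambda>i \<gamma>. boxplus_den
      (\<lambda>j. arr [] (\<lambda>i \<delta>. g i (map (\<lambda>g. g i []) fs)) j (sub_den [] [] i j \<gamma>))))"
    unfolding A by (rule denotes.intros(21)) (use i in auto)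
  then show ?case unfolding f
    by (rule denotes_arr_cong) (simp add: arr_eq sub_den_closed[OF len const ts])
next
  case (12 t)
  from 12 obtain B C fs e where A: "A = TSum (TBox B) (TBox C)" and "denotes [] (In1 t) (TSum B C) e"
    and f: "f = arr [] (\<lambda>i \<gamma>. boxplus_den (\<lambda>j. e j (sub_den [] fs i j \<gamma>)))"
    by (cases rule: denotes_BoxPlusE) auto
  then obtain g where t: "denotes [] t B g" and "wft 0 C" and e: "e = arr [] (\<lambda>i \<gamma>. vinl (g i \<gamma>))"
    by (auto elim: denotes_In1E)
  then have "denotes [] (In1 (Box [] t)) A
      (arr [] (\<lambda>i \<gamma>. vinl (arr [] (\<lambda>i \<gamma>. vtup UNIV (\<lambda>j. g j (sub_den [] [] i j \<gamma>))) i \<gamma>)))"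
    unfolding A by (intro denotes.intros(9) denotes.intros(19) wft.intros) auto
  then show ?case unfolding f e
    by (rule denotes_arr_cong) (simp add: arr_eq)
next
  case (13 t)
  from 13 obtain B C fs e where A: "A = TSum (TBox B) (TBox C)" and "denotes [] (In2 t) (TSum B C) e"
    and f: "f = arr [] (\<lambda>i \<gamma>. boxplus_den (\<lambda>j. e j (sub_den [] fs i j \<gamma>)))"
    by (cases rule: denotes_BoxPlusE) auto
  then obtain g where t: "denotes [] t C g" and "wft 0 B" and e: "e = arr [] (\<lambda>i \<gamma>. vinr (g i \<gamma>))"
    by (auto elim: denotes_In2E)
  then have "denotes [] (In2 (Box [] t)) A
      (arr [] (\<lambda>i \<gamma>. vinr (arr [] (\<lambda>i \<gamma>. vtup UNIV (\<lambda>j. g j (sub_den [] [] i j \<gamma>))) i \<gamma>)))"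
    unfolding A by (intro denotes.intros(10) denotes.intros(19) wft.intros) auto
  then show ?case unfolding f e
    by (rule denotes_arr_cong) (simp add: arr_eq)
qed

text \<open>The hole lies neither under a binder of \<open>Case\<close> or \<open>Lam\<close> nor in
  an explicit substitution, and the bodies of \<open>Prev []\<close> and \<open>BoxPlus []\<close>
  are typed in the empty context. The path to the hole thus stays closed, and each rule can be
  reapplied with the same denotations.\<close>

lemma denotes_eval_ctx:
  fixes f :: "nat \<Rightarrow> 'v::set_universe list \<Rightarrow> 'v"
  assumes "eval_ctx E"
    and "\<And>A (f :: nat \<Rightarrow> 'v list \<Rightarrow> 'v). denotes [] t A f \<Longrightarrow> denotes [] u A f"
    and "denotes [] (E t) A f"
  shows "denotes [] (E u) A f"
  using assms
proof (induction arbitrary: A f rule: eval_ctx.induct)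
  case (2 E)
  from 2(4) show ?case by (cases rule: denotes_SuccE) (use 2 in \<open>auto intro: denotes.intros\<close>)
next
  case (3 E)
  from 3(4) show ?case by (cases rule: denotes_FstE) (use 3 in \<open>auto intro: denotes.intros\<close>)
next
  case (4 E)
  from 4(4) show ?case by (cases rule: denotes_SndE) (use 4 in \<open>auto intro: denotes.intros\<close>)
next
  case (5 E s1 s2)
  from 5(4) show ?case by (cases rule: denotes_CaseE) (use 5 in \<open>auto intro: denotes.intros\<close>)
next
  case (6 E s)
  from 6(4) show ?case by (cases rule: denotes_AppE) (use 6 in \<open>auto intro: denotes.intros\<close>)
next
  case (7 E)
  from 7(4) show ?case by (cases rule: denotes_UnfoldE) (use 7 in \<open>auto intro: denotes.intros\<close>)
next
  case (8 E)
  from 8(4) obtain fs g where E: "denotes [] (E t) (TLater A) g" "fs = []"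
    and f: "f = arr [] (\<lambda>i \<gamma>. g (Suc i) (sub_den [] fs i (Suc i) \<gamma>))"
    by (cases rule: denotes_PrevE) auto
  show ?case unfolding f by (rule denotes.intros(17)) (use 8(2)[OF 8(3) E(1)] E(2) in auto)
next
  case (9 E s)
  from 9(4) show ?case by (cases rule: denotes_LAppE) (use 9 in \<open>auto intro: denotes.intros\<close>)
next
  case (10 v E)
  from 10(5) show ?case by (cases rule: denotes_LAppE) (use 10 in \<open>auto intro: denotes.intros\<close>)
next
  case (11 E)
  from 11(4) show ?case by (cases rule: denotes_UnboxE) (use 11 in \<open>auto intro: denotes.intros\<close>)
next
  case (12 E)
  from 12(4) obtain fs B C g where E: "denotes [] (E t) (TSum B C) g" "fs = []"
    and A: "A = TSum (TBox B) (TBox C)" and f: "f = arr [] (\<lambda>i \<gamma>. boxplus_den (\<lambda>j. g j (sub_den [] fs i j \<gamma>)))"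
    by (cases rule: denotes_BoxPlusE) auto
  show ?case unfolding f A by (rule denotes.intros(21)) (use 12(2)[OF 12(3) E(1)] E(2) in auto)
qed

lemma denotes_steps: "t \<Zsurj> u \<Longrightarrow> denotes [] t A f \<Longrightarrow> denotes [] u A f"
proof (induction rule: rtranclp_induct)
  case (step u u')
  then show ?case by (auto elim!: step.cases intro: denotes_eval_ctx denotes_redex)
qed

section \<open>Well-definedness of the denotation and the conclusion\<close>

lemma typing_denotes: "\<Gamma> \<turnstile> t \<^bold>: A \<Longrightarrow> \<exists>f :: nat \<Rightarrow> 'v::set_universe list \<Rightarrow> 'v. denotes \<Gamma> t A f"
proof (induction rule: typing.induct)
  case (17 As ts \<Gamma> t A)
  \<comment> \<open>A denotation is chosen for each entry of the explicit substitution; tabulating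
    \<open>F\<close> gives the list that the rule requires.\<close>
  then obtain F :: "nat \<Rightarrow> nat \<Rightarrow> 'v list \<Rightarrow> 'v" and g :: "nat \<Rightarrow> 'v list \<Rightarrow> 'v" where
    "\<forall>k<length ts. denotes \<Gamma> (ts ! k) (As ! k) (F k)" "denotes As t (TLater A) g"
    by metis
  then show ?case
    using denotes.intros(17)[of As ts "map F [0..<length ts]" \<Gamma> t A g] 17 by auto
next
  case (19 As ts \<Gamma> t A)
  then obtain F :: "nat \<Rightarrow> nat \<Rightarrow> 'v list \<Rightarrow> 'v" and g :: "nat \<Rightarrow> 'v list \<Rightarrow> 'v" where
    "\<forall>k<length ts. denotes \<Gamma> (ts ! k) (As ! k) (F k)" "denotes As t A g"
    by metis
  then show ?case
    using denotes.intros(19)[of As ts "map F [0..<length ts]" \<Gamma> t A g] 19 by auto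
next
  case (21 As ts \<Gamma> t B1 B2)
  then obtain F :: "nat \<Rightarrow> nat \<Rightarrow> 'v list \<Rightarrow> 'v" and g :: "nat \<Rightarrow> 'v list \<Rightarrow> 'v" where
    "\<forall>k<length ts. denotes \<Gamma> (ts ! k) (As ! k) (F k)" "denotes As t (TSum B1 B2) g"
    by metis
  then show ?case
    using denotes.intros(21)[of As ts "map F [0..<length ts]" \<Gamma> t B1 B2 g] 21 by auto
qed (blast intro: denotes.intros)+

text \<open>Coherence makes the description in \<open>den\<close> unambiguous, so that it returns
  the denotation of any derivation at hand.\<close>

lemma den_eq: "denotes [] t A f \<Longrightarrow> den [] t A = f"
  unfolding den_def by (rule the_equality) (auto intro: denotes_unique)

theorem theorem2p9:
  fixes t u :: tm and A :: ty
  assumes "[] \<turnstile> t \<^bold>: A" and "t \<Zsurj> u"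
  shows "(den [] t A :: nat \<Rightarrow> 'v::set_universe list \<Rightarrow> 'v) = den [] u A"
proof -
  obtain f :: "nat \<Rightarrow> 'v list \<Rightarrow> 'v" where f: "denotes [] t A f"
    using typing_denotes[OF assms(1)] by blast
  show ?thesis
    using den_eq[OF f] den_eq[OF denotes_steps[OF assms(2) f]] by simp
qed

end
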